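(* Let $\mathrm S$ be a dependent type theory admitting all the rules of two-dimensional type theory $\mathrm{ML}_2$. For each context $\Gamma$ and type $\Gamma\vdash A\ \mathsf{type}$ of $\mathrm S$, the weakening $2$-functor $\Delta_A:=\mathfrak T_{\mathrm S}(\pi_A)\colon\mathfrak T_{\mathrm S}(\Gamma)\to\mathfrak T_{\mathrm S}(\Gamma.A)$ has a left retract biadjoint $\Sigma_A$.
   Context: **Type theory.** $\mathrm S$ has judgement forms $A\ \mathsf{type}$, $a:A$, $A=B\ \mathsf{type}$, $a=b:A$ (definitional equality), relative to contexts $\Gamma=(x_1:A_1,\dots,x_n:A_n)$ with $A_i$ a type in context $(x_1:A_1,\dots,x_{i-1}:A_{i-1})$; equality rules (definitional equality is a congruence) and structural rules (weakening, contraction, exchange, substitution). All rules are relative to an arbitrary ambient context, and all operations are stable under substitution in it. Rules of $\mathrm{ML}_2$: - $\Sigma$: from $A$ and $x:A\vdash B(x)$ form $\Sigma(A,B)$; from $a:A$, $b:B(a)$ get $\langle a,b\rangle:\Sigma(A,B)$; from $z:\Sigma(A,B)\vdash C(z)\ \mathsf{type}$ and $x:A,y:B(x)\vdash d(x,y):C(\langle x,y\rangle)$ get $z:\Sigma(A,B)\vdash \mathrm E_d(z):C(z)$ with $\mathrm E_d(\langle x,y\rangle)=d(x,y)$. - Unit: $\mathbf 1\ \mathsf{type}$; $\star:\mathbf 1$; from $z:\mathbf 1\vdash C(z)\ \mathsf{type}$ and $d:C(\star)$ get $z:\mathbf 1\vdash\mathrm U_d(z):C(z)$ with $\mathrm U_d(\star)=d$.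 - Identity: from $a,b:A$ form $\mathrm{Id}_A(a,b)$; $\mathrm r(a):\mathrm{Id}_A(a,a)$; from $x,y:A,p:\mathrm{Id}_A(x,y)\vdash C(x,y,p)\ \mathsf{type}$ and $x:A\vdash d(x):C(x,x,\mathrm r(x))$ get $x,y:A,p:\mathrm{Id}_A(x,y)\vdash\mathrm J_d(x,y,p):C(x,y,p)$ with $\mathrm J_d(x,x,\mathrm r(x))=d(x)$. - $\Pi$: form $\Pi(A,B)$; from $x:A\vdash f(x):B(x)$ get $\lambda f:\Pi(A,B)$; from $m:\Pi(A,B)$ get $y:A\vdash m\cdot y:B(y)$; $(\lambda f)\cdot y=f(y)$. - Discrete identity types: if $p,q:\mathrm{Id}_A(a,b)$ and $\alpha:\mathrm{Id}(p,q)$ then $p=q$ and $\alpha=\mathrm r(p)$. - Function extensionality: from $m,n:\Pi(A,B)$ and $x:A\vdash p(x):\mathrm{Id}(m\cdot x,n\cdot x)$ get $\mathsf{ext}(m,n,p):\mathrm{Id}(m,n)$; $\mathsf{ext}(m,m,[x]\mathrm r(m\cdot x))=\mathrm r(m)$; $\mathsf{ext}(m,n,p)\ast x=p(x)$, where $p\ast a:=\mathrm J_{[x]\mathrm r(x\cdot a)}(m,n,p)$. By $\Pi$-abstracting over a telescope $\Delta$ one derives extended identity elimination/computation, in which $C$ and the conclusion live in context $x,y:A,p:\mathrm{Id}_A(x,y),\Delta$ and $d$ in context $x:A,\Delta[x,x,\mathrm r(x)/x,y,p]$. Vector notation is used: $x:\Gamma$ stands for a list of variables of the successive types of $\Gamma$.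 **The 2-category $\mathfrak T_{\mathrm S}(\Gamma)$.** (Modulo $\alpha$-conversion and definitional equality.) Objects: types $A$ in context $\Gamma$. 1-cells $A\to B$: judgements $x:\Gamma,y:A(x)\vdash f(x,y):B(x)$, composed by substitution. 2-cells $f\Rightarrow g$: judgements $x:\Gamma,y:A(x)\vdash\alpha(x,y):\mathrm{Id}_{B(x)}(f(x,y),g(x,y))$. For $p:\mathrm{Id}_A(y,y')$, $q:\mathrm{Id}_A(y',y'')$, the composite $q\circ p:\mathrm{Id}_A(y,y'')$ is defined by elimination on $q$ with $\mathrm r(y')\circ p=p$; for $h\colon A\to B$, $h^\bullet(p):\mathrm{Id}_B(hy,hy')$ is defined by elimination on $p$ with $h^\bullet(\mathrm r(y))=\mathrm r(hy)$. Vertical composition of 2-cells is pointwise $\circ$, identities are $\mathrm r(f(x,y))$, whiskering on the right is substitution and on the left is application of $h^\bullet$. $\Gamma.A$ is the context $(x:\Gamma,y:A(x))$, $\pi_A\colon\Gamma.A\to\Gamma$ is its projection, and $\Delta_A=\mathfrak T_{\mathrm S}(\pi_A)$ sends a type, term or identity proof in context $\Gamma$ to the same one weakened to context $\Gamma.A$. **Retract biadjoints.** A functor $P$ is a *surjective equivalence* if there are a functor $I$ with $PI=\mathrm{id}$ and an isomorphism $\theta\colon\mathrm{id}\Rightarrow IP$ with $\theta I=\mathrm{id}_I$, $P\theta=\mathrm{id}_P$. For a 2-functor $U\colon\mathbf K\to\mathbf L$ and $x\in\mathbf L$, a *retract bireflection* of $x$ along $U$ is an object $Fx\in\mathbf K$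 with a morphism $\eta_x\colon x\to UFx$ such that for each $y\in\mathbf K$ the functor $\mathbf K(Fx,y)\to\mathbf L(x,Uy)$, $h\mapsto Uh\circ\eta_x$, is a surjective equivalence of categories. A *left retract biadjoint* for $U$ is a choice, for each $x\in\mathbf L$, of a retract bireflection of $x$ along $U$. *)

theory Defs
  imports Main
begin

section \<open>Raw expressions\<close>

text \<open>
  Types and terms share one raw syntax over an arbitrary set \<open>'s\<close> of symbols. Variables are
  de Bruijn indices, so \<open>\<alpha>\<close>-convertible expressions are equal. In \<open>Op s [(k\<^sub>1, e\<^sub>1), \<dots>]\<close> the
  symbol \<open>s\<close> binds \<open>k\<^sub>i\<close> variables in its \<open>i\<close>-th argument.
\<close>

datatype 's expr = Var nat | Op 's "(nat \<times> 's expr) list"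

definition lift_ren :: "(nat \<Rightarrow> nat) \<Rightarrow> nat \<Rightarrow> nat" where
  "lift_ren \<rho> = case_nat 0 (\<lambda>i. Suc (\<rho> i))"

fun rename :: "(nat \<Rightarrow> nat) \<Rightarrow> 's expr \<Rightarrow> 's expr" where
  "rename \<rho> (Var i) = Var (\<rho> i)"
| "rename \<rho> (Op s es) = Op s (map (\<lambda>(k, e). (k, rename ((lift_ren ^^ k) \<rho>) e)) es)"

type_synonym 's subst = "nat \<Rightarrow> 's expr"

text \<open>\<open>a \<triangleright> \<sigma>\<close> sends the most recent variable to \<open>a\<close> and the others according to \<open>\<sigma>\<close>.\<close>

abbreviation extend :: "'s expr \<Rightarrow> 's subst \<Rightarrow> 's subst" (infixr "\<triangleright>" 65) where
  "a \<triangleright> \<sigma> \<equiv> case_nat a \<sigma>"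

definition lift :: "'s subst \<Rightarrow> 's subst" where
  "lift \<sigma> = Var 0 \<triangleright> (\<lambda>i. rename Suc (\<sigma> i))"

fun subst :: "'s subst \<Rightarrow> 's expr \<Rightarrow> 's expr" where
  "subst \<sigma> (Var i) = \<sigma> i"
| "subst \<sigma> (Op s es) = Op s (map (\<lambda>(k, e). (k, subst ((lift ^^ k) \<sigma>) e)) es)"

fun scoped :: "nat \<Rightarrow> 's expr \<Rightarrow> bool" where
  "scoped n (Var i) \<longleftrightarrow> i < n"
| "scoped n (Op s es) \<longleftrightarrow> (\<forall>(k, e) \<in> set es. scoped (n + k) e)"

definition drop_vars :: "nat \<Rightarrow> 's subst" where
  "drop_vars n = (\<lambda>i. Var (i + n))"

abbreviation shift :: "nat \<Rightarrow> 's expr \<Rightarrow> 's expr" where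
  "shift n \<equiv> subst (drop_vars n)"

text \<open>\<open>shift_under n\<close> is \<open>shift n\<close> for an expression depending on one further, bound, variable.\<close>

abbreviation shift_under :: "nat \<Rightarrow> 's expr \<Rightarrow> 's expr" where
  "shift_under n \<equiv> subst (lift (drop_vars n))"

abbreviation inst :: "'s expr \<Rightarrow> 's expr \<Rightarrow> 's expr" where
  "inst a \<equiv> subst (a \<triangleright> Var)"

abbreviation inst3 :: "'s expr \<Rightarrow> 's expr \<Rightarrow> 's expr \<Rightarrow> 's expr \<Rightarrow> 's expr" where
  "inst3 a b p \<equiv> subst (p \<triangleright> b \<triangleright> a \<triangleright> Var)"

section \<open>Dependent type theories\<close>

text \<open>Contexts are lists of types whose head is the most recently added type.\<close>

type_synonym 's ctxt = "'s expr list"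

record 's judgements =
  is_ty :: "'s ctxt \<Rightarrow> 's expr \<Rightarrow> bool"  ("_ \<turnstile>\<index> _ Ty" [51, 51] 50)
  is_tm :: "'s ctxt \<Rightarrow> 's expr \<Rightarrow> 's expr \<Rightarrow> bool"  ("_ \<turnstile>\<index> _ \<tturnstile> _" [51, 51, 51] 50)
  eq_ty :: "'s ctxt \<Rightarrow> 's expr \<Rightarrow> 's expr \<Rightarrow> bool"  ("_ \<turnstile>\<index> _ \<doteq> _ Ty" [51, 51, 51] 50)
  eq_tm :: "'s ctxt \<Rightarrow> 's expr \<Rightarrow> 's expr \<Rightarrow> 's expr \<Rightarrow> bool"
    ("_ \<turnstile>\<index> _ \<doteq> _ \<tturnstile> _" [51, 51, 51, 51] 50)

primrec ctx :: "('s, 'z) judgements_scheme \<Rightarrow> 's ctxt \<Rightarrow> bool" where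
  "ctx S [] \<longleftrightarrow> True"
| "ctx S (A # \<Gamma>) \<longleftrightarrow> ctx S \<Gamma> \<and> \<Gamma> \<turnstile>\<^bsub>S\<^esub> A Ty"

definition lookup :: "'s ctxt \<Rightarrow> nat \<Rightarrow> 's expr" where
  "lookup \<Gamma> i = shift (Suc i) (\<Gamma> ! i)"

definition ctx_mor :: "('s, 'z) judgements_scheme \<Rightarrow> 's ctxt \<Rightarrow> 's subst \<Rightarrow> 's ctxt \<Rightarrow> bool" where
  "ctx_mor S \<Delta> \<sigma> \<Gamma> \<longleftrightarrow> ctx S \<Delta> \<and> ctx S \<Gamma> \<and>
     (\<forall>i < length \<Gamma>. \<Delta> \<turnstile>\<^bsub>S\<^esub> \<sigma> i \<tturnstile> subst \<sigma> (lookup \<Gamma> i))"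

definition ctx_mor_eq ::
  "('s, 'z) judgements_scheme \<Rightarrow> 's ctxt \<Rightarrow> 's subst \<Rightarrow> 's subst \<Rightarrow> 's ctxt \<Rightarrow> bool" where
  "ctx_mor_eq S \<Delta> \<sigma> \<tau> \<Gamma> \<longleftrightarrow> ctx_mor S \<Delta> \<sigma> \<Gamma> \<and> ctx_mor S \<Delta> \<tau> \<Gamma> \<and>
     (\<forall>i < length \<Gamma>. \<Delta> \<turnstile>\<^bsub>S\<^esub> \<sigma> i \<doteq> \<tau> i \<tturnstile> subst \<sigma> (lookup \<Gamma> i))"

text \<open>
  A type theory is any family of judgements closed under the structural and equality rules. It may
  have further symbols and rules. Weakening, contraction, exchange and substitution for a variable
  are the instances of substitution along a context morphism at variable renamings and at
  morphisms replacing one variable by a term.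
\<close>

locale type_theory =
  fixes S :: "('s, 'z) judgements_scheme" (structure)
  assumes ty_ctx: "\<Gamma> \<turnstile> A Ty \<Longrightarrow> ctx S \<Gamma>"
    and tm_ty: "\<Gamma> \<turnstile> a \<tturnstile> A \<Longrightarrow> \<Gamma> \<turnstile> A Ty"
    and eq_ty_left: "\<Gamma> \<turnstile> A \<doteq> B Ty \<Longrightarrow> \<Gamma> \<turnstile> A Ty"
    and eq_ty_right: "\<Gamma> \<turnstile> A \<doteq> B Ty \<Longrightarrow> \<Gamma> \<turnstile> B Ty"
    and eq_tm_left: "\<Gamma> \<turnstile> a \<doteq> b \<tturnstile> A \<Longrightarrow> \<Gamma> \<turnstile> a \<tturnstile> A"
    and eq_tm_right: "\<Gamma> \<turnstile> a \<doteq> b \<tturnstile> A \<Longrightarrow> \<Gamma> \<turnstile> b \<tturnstile> A"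
    and ty_scoped: "\<Gamma> \<turnstile> A Ty \<Longrightarrow> scoped (length \<Gamma>) A"
    and tm_scoped: "\<Gamma> \<turnstile> a \<tturnstile> A \<Longrightarrow> scoped (length \<Gamma>) a"
    and ty_refl: "\<Gamma> \<turnstile> A Ty \<Longrightarrow> \<Gamma> \<turnstile> A \<doteq> A Ty"
    and ty_sym: "\<Gamma> \<turnstile> A \<doteq> B Ty \<Longrightarrow> \<Gamma> \<turnstile> B \<doteq> A Ty"
    and ty_trans: "\<Gamma> \<turnstile> A \<doteq> B Ty \<Longrightarrow> \<Gamma> \<turnstile> B \<doteq> C Ty \<Longrightarrow> \<Gamma> \<turnstile> A \<doteq> C Ty"
    and tm_refl: "\<Gamma> \<turnstile> a \<tturnstile> A \<Longrightarrow> \<Gamma> \<turnstile> a \<doteq> a \<tturnstile> A"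
    and tm_sym: "\<Gamma> \<turnstile> a \<doteq> b \<tturnstile> A \<Longrightarrow> \<Gamma> \<turnstile> b \<doteq> a \<tturnstile> A"
    and tm_trans: "\<Gamma> \<turnstile> a \<doteq> b \<tturnstile> A \<Longrightarrow> \<Gamma> \<turnstile> b \<doteq> c \<tturnstile> A \<Longrightarrow> \<Gamma> \<turnstile> a \<doteq> c \<tturnstile> A"
    and tm_conv: "\<Gamma> \<turnstile> a \<tturnstile> A \<Longrightarrow> \<Gamma> \<turnstile> A \<doteq> B Ty \<Longrightarrow> \<Gamma> \<turnstile> a \<tturnstile> B"
    and eq_tm_conv: "\<Gamma> \<turnstile> a \<doteq> b \<tturnstile> A \<Longrightarrow> \<Gamma> \<turnstile> A \<doteq> B Ty \<Longrightarrow> \<Gamma> \<turnstile> a \<doteq> b \<tturnstile> B"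
    and var: "ctx S \<Gamma> \<Longrightarrow> i < length \<Gamma> \<Longrightarrow> \<Gamma> \<turnstile> Var i \<tturnstile> lookup \<Gamma> i"
    and ty_subst: "ctx_mor S \<Delta> \<sigma> \<Gamma> \<Longrightarrow> \<Gamma> \<turnstile> A Ty \<Longrightarrow> \<Delta> \<turnstile> subst \<sigma> A Ty"
    and tm_subst: "ctx_mor S \<Delta> \<sigma> \<Gamma> \<Longrightarrow> \<Gamma> \<turnstile> a \<tturnstile> A \<Longrightarrow> \<Delta> \<turnstile> subst \<sigma> a \<tturnstile> subst \<sigma> A"
    and eq_ty_subst: "ctx_mor S \<Delta> \<sigma> \<Gamma> \<Longrightarrow> \<Gamma> \<turnstile> A \<doteq> B Ty \<Longrightarrow> \<Delta> \<turnstile> subst \<sigma> A \<doteq> subst \<sigma> B Ty"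
    and eq_tm_subst: "ctx_mor S \<Delta> \<sigma> \<Gamma> \<Longrightarrow> \<Gamma> \<turnstile> a \<doteq> b \<tturnstile> A \<Longrightarrow>
      \<Delta> \<turnstile> subst \<sigma> a \<doteq> subst \<sigma> b \<tturnstile> subst \<sigma> A"
    and ty_subst_cong: "ctx_mor_eq S \<Delta> \<sigma> \<tau> \<Gamma> \<Longrightarrow> \<Gamma> \<turnstile> A Ty \<Longrightarrow>
      \<Delta> \<turnstile> subst \<sigma> A \<doteq> subst \<tau> A Ty"
    and tm_subst_cong: "ctx_mor_eq S \<Delta> \<sigma> \<tau> \<Gamma> \<Longrightarrow> \<Gamma> \<turnstile> a \<tturnstile> A \<Longrightarrow>
      \<Delta> \<turnstile> subst \<sigma> a \<doteq> subst \<tau> a \<tturnstile> subst \<sigma> A"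

section \<open>Two-dimensional type theory\<close>

text \<open>
  The operations of the theory act on raw expressions and take all the data of the corresponding
  rule as arguments. An argument or result that lives in an extension of the ambient context uses
  the indices \<open>0, 1, \<dots>\<close> for the additional variables; in particular \<open>Sg_elim A B C d\<close>, \<open>One_elim C d\<close>,
  \<open>Id_elim A C d\<close> and \<open>app A B m\<close> live in the context ending in \<open>z : \<Sigma>(A,B)\<close>, in \<open>z : 1\<close>, in
  \<open>x, y : A, p : Id(x,y)\<close> and in \<open>y : A\<close>, respectively.
\<close>

record 's ml2 = "'s judgements" +
  Sg :: "'s expr \<Rightarrow> 's expr \<Rightarrow> 's expr"
  pair :: "'s expr \<Rightarrow> 's expr \<Rightarrow> 's expr \<Rightarrow> 's expr \<Rightarrow> 's expr"
  Sg_elim :: "'s expr \<Rightarrow> 's expr \<Rightarrow> 's expr \<Rightarrow> 's expr \<Rightarrow> 's expr"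
  One :: "'s expr"
  star :: "'s expr"
  One_elim :: "'s expr \<Rightarrow> 's expr \<Rightarrow> 's expr"
  Idt :: "'s expr \<Rightarrow> 's expr \<Rightarrow> 's expr \<Rightarrow> 's expr"
  rfl :: "'s expr \<Rightarrow> 's expr \<Rightarrow> 's expr"
  Id_elim :: "'s expr \<Rightarrow> 's expr \<Rightarrow> 's expr \<Rightarrow> 's expr"
  Pt :: "'s expr \<Rightarrow> 's expr \<Rightarrow> 's expr"
  lam :: "'s expr \<Rightarrow> 's expr \<Rightarrow> 's expr \<Rightarrow> 's expr"
  app :: "'s expr \<Rightarrow> 's expr \<Rightarrow> 's expr \<Rightarrow> 's expr"
  ext :: "'s expr \<Rightarrow> 's expr \<Rightarrow> 's expr \<Rightarrow> 's expr \<Rightarrow> 's expr \<Rightarrow> 's expr"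

text \<open>The morphism \<open>(x : A, y : B(x)) \<rightarrow> (z : \<Sigma>(A,B))\<close> over the ambient context, given by \<open>\<langle>x,y\<rangle>\<close>.\<close>

definition pair_subst :: "('s, 'z) ml2_scheme \<Rightarrow> 's expr \<Rightarrow> 's expr \<Rightarrow> 's subst" where
  "pair_subst S A B =
     pair S (shift 2 A) (shift_under 2 B) (Var 1) (Var 0) \<triangleright> drop_vars 2"

text \<open>The context \<open>(x, y : A, p : Id(x,y))\<close> over an ambient context.\<close>

definition Id_ctx :: "('s, 'z) ml2_scheme \<Rightarrow> 's expr \<Rightarrow> 's ctxt \<Rightarrow> 's ctxt" where
  "Id_ctx S A \<Gamma> = Idt S (shift 2 A) (Var 1) (Var 0) # shift 1 A # A # \<Gamma>"

text \<open>The morphism \<open>(x : A) \<rightarrow> (x, y : A, p : Id(x,y))\<close> given by \<open>(x, x, r(x))\<close>.\<close>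

definition rfl_subst :: "('s, 'z) ml2_scheme \<Rightarrow> 's expr \<Rightarrow> 's subst" where
  "rfl_subst S A = rfl S (shift 1 A) (Var 0) \<triangleright> Var 0 \<triangleright> Var 0 \<triangleright> drop_vars 1"

definition app_at :: "('s, 'z) ml2_scheme \<Rightarrow> 's expr \<Rightarrow> 's expr \<Rightarrow> 's expr \<Rightarrow> 's expr \<Rightarrow> 's expr" where
  "app_at S A B m a = inst a (app S A B m)"

text \<open>\<open>happly S A B m n p a\<close> is \<open>p \<ast> a : Id(m \<cdot> a, n \<cdot> a)\<close>, for \<open>p : Id(m, n)\<close> and \<open>a : A\<close>.\<close>

definition happly :: "('s, 'z) ml2_scheme \<Rightarrow> 's expr \<Rightarrow> 's expr \<Rightarrow> 's expr \<Rightarrow> 's expr \<Rightarrow> 's expr \<Rightarrow>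
    's expr \<Rightarrow> 's expr" where
  "happly S A B m n p a =
     inst3 m n p
       (Id_elim S (Pt S A B)
         (Idt S (shift 3 (inst a B))
            (app_at S (shift 3 A) (shift_under 3 B) (Var 2) (shift 3 a))
            (app_at S (shift 3 A) (shift_under 3 B) (Var 1) (shift 3 a)))
         (rfl S (shift 1 (inst a B))
            (app_at S (shift 1 A) (shift_under 1 B) (Var 0) (shift 1 a))))"

locale ML2 = type_theory S
  for S :: "('s, 'z) ml2_scheme" (structure) +
  assumes subst_Sg: "subst \<sigma> (Sg S A B) = Sg S (subst \<sigma> A) (subst (lift \<sigma>) B)"
    and subst_pair: "subst \<sigma> (pair S A B a b) =
      pair S (subst \<sigma> A) (subst (lift \<sigma>) B) (subst \<sigma> a) (subst \<sigma> b)"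
    and subst_Sg_elim: "subst (lift \<sigma>) (Sg_elim S A B C d) =
      Sg_elim S (subst \<sigma> A) (subst (lift \<sigma>) B) (subst (lift \<sigma>) C) (subst (lift (lift \<sigma>)) d)"
    and subst_One: "subst \<sigma> (One S) = One S"
    and subst_star: "subst \<sigma> (star S) = star S"
    and subst_One_elim: "subst (lift \<sigma>) (One_elim S C d) = One_elim S (subst (lift \<sigma>) C) (subst \<sigma> d)"
    and subst_Idt: "subst \<sigma> (Idt S A a b) = Idt S (subst \<sigma> A) (subst \<sigma> a) (subst \<sigma> b)"
    and subst_rfl: "subst \<sigma> (rfl S A a) = rfl S (subst \<sigma> A) (subst \<sigma> a)"
    and subst_Id_elim: "subst (lift (lift (lift \<sigma>))) (Id_elim S A C d) =
      Id_elim S (subst \<sigma> A) (subst (lift (lift (lift \<sigma>))) C) (subst (lift \<sigma>) d)"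
    and subst_Pt: "subst \<sigma> (Pt S A B) = Pt S (subst \<sigma> A) (subst (lift \<sigma>) B)"
    and subst_lam: "subst \<sigma> (lam S A B f) =
      lam S (subst \<sigma> A) (subst (lift \<sigma>) B) (subst (lift \<sigma>) f)"
    and subst_app: "subst (lift \<sigma>) (app S A B m) =
      app S (subst \<sigma> A) (subst (lift \<sigma>) B) (subst \<sigma> m)"
    and subst_ext: "subst \<sigma> (ext S A B m n p) =
      ext S (subst \<sigma> A) (subst (lift \<sigma>) B) (subst \<sigma> m) (subst \<sigma> n) (subst (lift \<sigma>) p)"

  assumes Sg_form: "\<Gamma> \<turnstile> A Ty \<Longrightarrow> A # \<Gamma> \<turnstile> B Ty \<Longrightarrow> \<Gamma> \<turnstile> Sg S A B Ty"
    and pair_intro: "A # \<Gamma> \<turnstile> B Ty \<Longrightarrow> \<Gamma> \<turnstile> a \<tturnstile> A \<Longrightarrow> \<Gamma> \<turnstile> b \<tturnstile> inst a B \<Longrightarrow>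
      \<Gamma> \<turnstile> pair S A B a b \<tturnstile> Sg S A B"
    and Sg_elim: "Sg S A B # \<Gamma> \<turnstile> C Ty \<Longrightarrow> B # A # \<Gamma> \<turnstile> d \<tturnstile> subst (pair_subst S A B) C \<Longrightarrow>
      Sg S A B # \<Gamma> \<turnstile> Sg_elim S A B C d \<tturnstile> C"
    and Sg_comp: "Sg S A B # \<Gamma> \<turnstile> C Ty \<Longrightarrow> B # A # \<Gamma> \<turnstile> d \<tturnstile> subst (pair_subst S A B) C \<Longrightarrow>
      B # A # \<Gamma> \<turnstile> subst (pair_subst S A B) (Sg_elim S A B C d) \<doteq> d \<tturnstile> subst (pair_subst S A B) C"

  assumes One_form: "ctx S \<Gamma> \<Longrightarrow> \<Gamma> \<turnstile> One S Ty"
    and star_intro: "ctx S \<Gamma> \<Longrightarrow> \<Gamma> \<turnstile> star S \<tturnstile> One S"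
    and One_elim: "One S # \<Gamma> \<turnstile> C Ty \<Longrightarrow> \<Gamma> \<turnstile> d \<tturnstile> inst (star S) C \<Longrightarrow>
      One S # \<Gamma> \<turnstile> One_elim S C d \<tturnstile> C"
    and One_comp: "One S # \<Gamma> \<turnstile> C Ty \<Longrightarrow> \<Gamma> \<turnstile> d \<tturnstile> inst (star S) C \<Longrightarrow>
      \<Gamma> \<turnstile> inst (star S) (One_elim S C d) \<doteq> d \<tturnstile> inst (star S) C"

  assumes Id_form: "\<Gamma> \<turnstile> a \<tturnstile> A \<Longrightarrow> \<Gamma> \<turnstile> b \<tturnstile> A \<Longrightarrow> \<Gamma> \<turnstile> Idt S A a b Ty"
    and rfl_intro: "\<Gamma> \<turnstile> a \<tturnstile> A \<Longrightarrow> \<Gamma> \<turnstile> rfl S A a \<tturnstile> Idt S A a a"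
    and Id_elim: "Id_ctx S A \<Gamma> \<turnstile> C Ty \<Longrightarrow> A # \<Gamma> \<turnstile> d \<tturnstile> subst (rfl_subst S A) C \<Longrightarrow>
      Id_ctx S A \<Gamma> \<turnstile> Id_elim S A C d \<tturnstile> C"
    and Id_comp: "Id_ctx S A \<Gamma> \<turnstile> C Ty \<Longrightarrow> A # \<Gamma> \<turnstile> d \<tturnstile> subst (rfl_subst S A) C \<Longrightarrow>
      A # \<Gamma> \<turnstile> subst (rfl_subst S A) (Id_elim S A C d) \<doteq> d \<tturnstile> subst (rfl_subst S A) C"

  assumes Pt_form: "\<Gamma> \<turnstile> A Ty \<Longrightarrow> A # \<Gamma> \<turnstile> B Ty \<Longrightarrow> \<Gamma> \<turnstile> Pt S A B Ty"
    and lam_intro: "A # \<Gamma> \<turnstile> f \<tturnstile> B \<Longrightarrow> \<Gamma> \<turnstile> lam S A B f \<tturnstile> Pt S A B"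
    and app_elim: "A # \<Gamma> \<turnstile> B Ty \<Longrightarrow> \<Gamma> \<turnstile> m \<tturnstile> Pt S A B \<Longrightarrow> A # \<Gamma> \<turnstile> app S A B m \<tturnstile> B"
    and Pt_comp: "A # \<Gamma> \<turnstile> f \<tturnstile> B \<Longrightarrow> A # \<Gamma> \<turnstile> app S A B (lam S A B f) \<doteq> f \<tturnstile> B"

  assumes Id_discrete: "\<Gamma> \<turnstile> p \<tturnstile> Idt S A a b \<Longrightarrow> \<Gamma> \<turnstile> q \<tturnstile> Idt S A a b \<Longrightarrow>
      \<Gamma> \<turnstile> \<alpha> \<tturnstile> Idt S (Idt S A a b) p q \<Longrightarrow> \<Gamma> \<turnstile> p \<doteq> q \<tturnstile> Idt S A a b"
    and Id_discrete_rfl: "\<Gamma> \<turnstile> p \<tturnstile> Idt S A a b \<Longrightarrow> \<Gamma> \<turnstile> q \<tturnstile> Idt S A a b \<Longrightarrow>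
      \<Gamma> \<turnstile> \<alpha> \<tturnstile> Idt S (Idt S A a b) p q \<Longrightarrow>
      \<Gamma> \<turnstile> \<alpha> \<doteq> rfl S (Idt S A a b) p \<tturnstile> Idt S (Idt S A a b) p q"

  assumes ext_intro: "A # \<Gamma> \<turnstile> B Ty \<Longrightarrow> \<Gamma> \<turnstile> m \<tturnstile> Pt S A B \<Longrightarrow> \<Gamma> \<turnstile> n \<tturnstile> Pt S A B \<Longrightarrow>
      A # \<Gamma> \<turnstile> p \<tturnstile> Idt S B (app S A B m) (app S A B n) \<Longrightarrow>
      \<Gamma> \<turnstile> ext S A B m n p \<tturnstile> Idt S (Pt S A B) m n"
    and ext_rfl: "A # \<Gamma> \<turnstile> B Ty \<Longrightarrow> \<Gamma> \<turnstile> m \<tturnstile> Pt S A B \<Longrightarrow>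
      \<Gamma> \<turnstile> ext S A B m m (rfl S B (app S A B m)) \<doteq> rfl S (Pt S A B) m \<tturnstile> Idt S (Pt S A B) m m"
    and ext_happly: "A # \<Gamma> \<turnstile> B Ty \<Longrightarrow> \<Gamma> \<turnstile> m \<tturnstile> Pt S A B \<Longrightarrow> \<Gamma> \<turnstile> n \<tturnstile> Pt S A B \<Longrightarrow>
      A # \<Gamma> \<turnstile> p \<tturnstile> Idt S B (app S A B m) (app S A B n) \<Longrightarrow>
      A # \<Gamma> \<turnstile> happly S (shift 1 A) (shift_under 1 B) (shift 1 m) (shift 1 n)
          (shift 1 (ext S A B m n p)) (Var 0)
        \<doteq> p \<tturnstile> Idt S B (app S A B m) (app S A B n)"

  assumes Sg_cong: "\<Gamma> \<turnstile> A \<doteq> A' Ty \<Longrightarrow> A # \<Gamma> \<turnstile> B \<doteq> B' Ty \<Longrightarrow> \<Gamma> \<turnstile> Sg S A B \<doteq> Sg S A' B' Ty"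
    and pair_cong: "\<Gamma> \<turnstile> A \<doteq> A' Ty \<Longrightarrow> A # \<Gamma> \<turnstile> B \<doteq> B' Ty \<Longrightarrow> \<Gamma> \<turnstile> a \<doteq> a' \<tturnstile> A \<Longrightarrow>
      \<Gamma> \<turnstile> b \<doteq> b' \<tturnstile> inst a B \<Longrightarrow> \<Gamma> \<turnstile> pair S A B a b \<doteq> pair S A' B' a' b' \<tturnstile> Sg S A B"
    and Sg_elim_cong: "\<Gamma> \<turnstile> A \<doteq> A' Ty \<Longrightarrow> A # \<Gamma> \<turnstile> B \<doteq> B' Ty \<Longrightarrow> Sg S A B # \<Gamma> \<turnstile> C \<doteq> C' Ty \<Longrightarrow>
      B # A # \<Gamma> \<turnstile> d \<doteq> d' \<tturnstile> subst (pair_subst S A B) C \<Longrightarrow>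
      Sg S A B # \<Gamma> \<turnstile> Sg_elim S A B C d \<doteq> Sg_elim S A' B' C' d' \<tturnstile> C"
    and One_elim_cong: "One S # \<Gamma> \<turnstile> C \<doteq> C' Ty \<Longrightarrow> \<Gamma> \<turnstile> d \<doteq> d' \<tturnstile> inst (star S) C \<Longrightarrow>
      One S # \<Gamma> \<turnstile> One_elim S C d \<doteq> One_elim S C' d' \<tturnstile> C"
    and Id_cong: "\<Gamma> \<turnstile> A \<doteq> A' Ty \<Longrightarrow> \<Gamma> \<turnstile> a \<doteq> a' \<tturnstile> A \<Longrightarrow> \<Gamma> \<turnstile> b \<doteq> b' \<tturnstile> A \<Longrightarrow>
      \<Gamma> \<turnstile> Idt S A a b \<doteq> Idt S A' a' b' Ty"
    and rfl_cong: "\<Gamma> \<turnstile> A \<doteq> A' Ty \<Longrightarrow> \<Gamma> \<turnstile> a \<doteq> a' \<tturnstile> A \<Longrightarrow>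
      \<Gamma> \<turnstile> rfl S A a \<doteq> rfl S A' a' \<tturnstile> Idt S A a a"
    and Id_elim_cong: "\<Gamma> \<turnstile> A \<doteq> A' Ty \<Longrightarrow> Id_ctx S A \<Gamma> \<turnstile> C \<doteq> C' Ty \<Longrightarrow>
      A # \<Gamma> \<turnstile> d \<doteq> d' \<tturnstile> subst (rfl_subst S A) C \<Longrightarrow>
      Id_ctx S A \<Gamma> \<turnstile> Id_elim S A C d \<doteq> Id_elim S A' C' d' \<tturnstile> C"
    and Pt_cong: "\<Gamma> \<turnstile> A \<doteq> A' Ty \<Longrightarrow> A # \<Gamma> \<turnstile> B \<doteq> B' Ty \<Longrightarrow> \<Gamma> \<turnstile> Pt S A B \<doteq> Pt S A' B' Ty"
    and lam_cong: "\<Gamma> \<turnstile> A \<doteq> A' Ty \<Longrightarrow> A # \<Gamma> \<turnstile> B \<doteq> B' Ty \<Longrightarrow> A # \<Gamma> \<turnstile> f \<doteq> f' \<tturnstile> B \<Longrightarrow>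
      \<Gamma> \<turnstile> lam S A B f \<doteq> lam S A' B' f' \<tturnstile> Pt S A B"
    and app_cong: "\<Gamma> \<turnstile> A \<doteq> A' Ty \<Longrightarrow> A # \<Gamma> \<turnstile> B \<doteq> B' Ty \<Longrightarrow> \<Gamma> \<turnstile> m \<doteq> m' \<tturnstile> Pt S A B \<Longrightarrow>
      A # \<Gamma> \<turnstile> app S A B m \<doteq> app S A' B' m' \<tturnstile> B"
    and ext_cong: "\<Gamma> \<turnstile> A \<doteq> A' Ty \<Longrightarrow> A # \<Gamma> \<turnstile> B \<doteq> B' Ty \<Longrightarrow> \<Gamma> \<turnstile> m \<doteq> m' \<tturnstile> Pt S A B \<Longrightarrow>
      \<Gamma> \<turnstile> n \<doteq> n' \<tturnstile> Pt S A B \<Longrightarrow> A # \<Gamma> \<turnstile> p \<doteq> p' \<tturnstile> Idt S B (app S A B m) (app S A B n) \<Longrightarrow>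
      \<Gamma> \<turnstile> ext S A B m n p \<doteq> ext S A' B' m' n' p' \<tturnstile> Idt S (Pt S A B) m n"

section \<open>Categories, 2-categories and retract biadjoints\<close>

record ('o, 'a) category =
  Obj :: "'o set"
  Hom :: "'o \<Rightarrow> 'o \<Rightarrow> 'a set"
  Ident :: "'o \<Rightarrow> 'a"
  Comp :: "'a \<Rightarrow> 'a \<Rightarrow> 'a"

definition is_category :: "('o, 'a) category \<Rightarrow> bool" where
  "is_category C \<longleftrightarrow>
     (\<forall>x \<in> Obj C. Ident C x \<in> Hom C x x) \<and>
     (\<forall>x \<in> Obj C. \<forall>y \<in> Obj C. \<forall>z \<in> Obj C. \<forall>f \<in> Hom C x y. \<forall>g \<in> Hom C y z.
        Comp C g f \<in> Hom C x z) \<and>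
     (\<forall>x \<in> Obj C. \<forall>y \<in> Obj C. \<forall>f \<in> Hom C x y.
        Comp C f (Ident C x) = f \<and> Comp C (Ident C y) f = f) \<and>
     (\<forall>w \<in> Obj C. \<forall>x \<in> Obj C. \<forall>y \<in> Obj C. \<forall>z \<in> Obj C.
        \<forall>f \<in> Hom C w x. \<forall>g \<in> Hom C x y. \<forall>h \<in> Hom C y z.
        Comp C h (Comp C g f) = Comp C (Comp C h g) f)"

definition is_functor ::
  "('o, 'a) category \<Rightarrow> ('p, 'b) category \<Rightarrow> ('o \<Rightarrow> 'p) \<Rightarrow> ('a \<Rightarrow> 'b) \<Rightarrow> bool" where
  "is_functor C D F\<^sub>0 F\<^sub>1 \<longleftrightarrow> is_category C \<and> is_category D \<and>
     (\<forall>x \<in> Obj C. F\<^sub>0 x \<in> Obj D) \<and>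
     (\<forall>x \<in> Obj C. \<forall>y \<in> Obj C. \<forall>f \<in> Hom C x y. F\<^sub>1 f \<in> Hom D (F\<^sub>0 x) (F\<^sub>0 y)) \<and>
     (\<forall>x \<in> Obj C. F\<^sub>1 (Ident C x) = Ident D (F\<^sub>0 x)) \<and>
     (\<forall>x \<in> Obj C. \<forall>y \<in> Obj C. \<forall>z \<in> Obj C. \<forall>f \<in> Hom C x y. \<forall>g \<in> Hom C y z.
        F\<^sub>1 (Comp C g f) = Comp D (F\<^sub>1 g) (F\<^sub>1 f))"

definition is_iso :: "('o, 'a) category \<Rightarrow> 'o \<Rightarrow> 'o \<Rightarrow> 'a \<Rightarrow> bool" where
  "is_iso C x y f \<longleftrightarrow> f \<in> Hom C x y \<and>
     (\<exists>g \<in> Hom C y x. Comp C g f = Ident C x \<and> Comp C f g = Ident C y)"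

definition surjective_equivalence ::
  "('o, 'a) category \<Rightarrow> ('p, 'b) category \<Rightarrow> ('o \<Rightarrow> 'p) \<Rightarrow> ('a \<Rightarrow> 'b) \<Rightarrow> bool" where
  "surjective_equivalence C D P\<^sub>0 P\<^sub>1 \<longleftrightarrow> is_functor C D P\<^sub>0 P\<^sub>1 \<and>
     (\<exists>I\<^sub>0 I\<^sub>1 \<theta>. is_functor D C I\<^sub>0 I\<^sub>1 \<and>
        (\<forall>d \<in> Obj D. P\<^sub>0 (I\<^sub>0 d) = d) \<and>
        (\<forall>d \<in> Obj D. \<forall>d' \<in> Obj D. \<forall>g \<in> Hom D d d'. P\<^sub>1 (I\<^sub>1 g) = g) \<and>
        (\<forall>c \<in> Obj C. is_iso C c (I\<^sub>0 (P\<^sub>0 c)) (\<theta> c)) \<and>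
        (\<forall>c \<in> Obj C. \<forall>c' \<in> Obj C. \<forall>f \<in> Hom C c c'.
           Comp C (\<theta> c') f = Comp C (I\<^sub>1 (P\<^sub>1 f)) (\<theta> c)) \<and>
        (\<forall>d \<in> Obj D. \<theta> (I\<^sub>0 d) = Ident C (I\<^sub>0 d)) \<and>
        (\<forall>c \<in> Obj C. P\<^sub>1 (\<theta> c) = Ident D (P\<^sub>0 c)))"

text \<open>
  2-categories are presented by hom-categories, composition of 1-cells, and the whiskerings
  \<open>wl h \<alpha> = h\<alpha>\<close> and \<open>wr \<alpha> f = \<alpha>f\<close>.
\<close>

record ('o, 'm, 'c) two_category =
  Ob :: "'o set"
  HomCat :: "'o \<Rightarrow> 'o \<Rightarrow> ('m, 'c) category"
  id1 :: "'o \<Rightarrow> 'm"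
  comp1 :: "'m \<Rightarrow> 'm \<Rightarrow> 'm"
  wl :: "'m \<Rightarrow> 'c \<Rightarrow> 'c"
  wr :: "'c \<Rightarrow> 'm \<Rightarrow> 'c"

abbreviation cells1 :: "('o, 'm, 'c) two_category \<Rightarrow> 'o \<Rightarrow> 'o \<Rightarrow> 'm set" where
  "cells1 K x y \<equiv> Obj (HomCat K x y)"

abbreviation cells2 :: "('o, 'm, 'c) two_category \<Rightarrow> 'o \<Rightarrow> 'o \<Rightarrow> 'm \<Rightarrow> 'm \<Rightarrow> 'c set" where
  "cells2 K x y \<equiv> Hom (HomCat K x y)"

definition is_two_category :: "('o, 'm, 'c) two_category \<Rightarrow> bool" where
  "is_two_category K \<longleftrightarrow>
     (\<forall>x \<in> Ob K. \<forall>y \<in> Ob K. is_category (HomCat K x y)) \<and>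
     (\<forall>x \<in> Ob K. id1 K x \<in> cells1 K x x) \<and>
     (\<forall>x \<in> Ob K. \<forall>y \<in> Ob K. \<forall>z \<in> Ob K. \<forall>f \<in> cells1 K x y. \<forall>g \<in> cells1 K y z.
        comp1 K g f \<in> cells1 K x z) \<and>
     (\<forall>x \<in> Ob K. \<forall>y \<in> Ob K. \<forall>f \<in> cells1 K x y.
        comp1 K f (id1 K x) = f \<and> comp1 K (id1 K y) f = f) \<and>
     (\<forall>w \<in> Ob K. \<forall>x \<in> Ob K. \<forall>y \<in> Ob K. \<forall>z \<in> Ob K.
        \<forall>f \<in> cells1 K w x. \<forall>g \<in> cells1 K x y. \<forall>h \<in> cells1 K y z.
        comp1 K h (comp1 K g f) = comp1 K (comp1 K h g) f) \<and>
     (\<forall>x \<in> Ob K. \<forall>y \<in> Ob K. \<forall>z \<in> Ob K. \<forall>h \<in> cells1 K y z.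
        is_functor (HomCat K x y) (HomCat K x z) (comp1 K h) (wl K h)) \<and>
     (\<forall>x \<in> Ob K. \<forall>y \<in> Ob K. \<forall>z \<in> Ob K. \<forall>f \<in> cells1 K x y.
        is_functor (HomCat K y z) (HomCat K x z) (\<lambda>g. comp1 K g f) (\<lambda>\<alpha>. wr K \<alpha> f)) \<and>
     (\<forall>x \<in> Ob K. \<forall>y \<in> Ob K. \<forall>f \<in> cells1 K x y. \<forall>f' \<in> cells1 K x y. \<forall>\<alpha> \<in> cells2 K x y f f'.
        wl K (id1 K y) \<alpha> = \<alpha> \<and> wr K \<alpha> (id1 K x) = \<alpha>) \<and>
     (\<forall>w \<in> Ob K. \<forall>x \<in> Ob K. \<forall>y \<in> Ob K. \<forall>z \<in> Ob K.
        \<forall>f \<in> cells1 K w x. \<forall>f' \<in> cells1 K w x. \<forall>\<alpha> \<in> cells2 K w x f f'.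
        \<forall>g \<in> cells1 K x y. \<forall>h \<in> cells1 K y z.
        wl K (comp1 K h g) \<alpha> = wl K h (wl K g \<alpha>)) \<and>
     (\<forall>w \<in> Ob K. \<forall>x \<in> Ob K. \<forall>y \<in> Ob K. \<forall>z \<in> Ob K.
        \<forall>f \<in> cells1 K w x. \<forall>g \<in> cells1 K x y.
        \<forall>h \<in> cells1 K y z. \<forall>h' \<in> cells1 K y z. \<forall>\<alpha> \<in> cells2 K y z h h'.
        wr K \<alpha> (comp1 K g f) = wr K (wr K \<alpha> g) f) \<and>
     (\<forall>w \<in> Ob K. \<forall>x \<in> Ob K. \<forall>y \<in> Ob K. \<forall>z \<in> Ob K.
        \<forall>f \<in> cells1 K w x. \<forall>g \<in> cells1 K x y. \<forall>g' \<in> cells1 K x y. \<forall>\<alpha> \<in> cells2 K x y g g'.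
        \<forall>h \<in> cells1 K y z.
        wr K (wl K h \<alpha>) f = wl K h (wr K \<alpha> f)) \<and>
     (\<forall>x \<in> Ob K. \<forall>y \<in> Ob K. \<forall>z \<in> Ob K.
        \<forall>f \<in> cells1 K x y. \<forall>f' \<in> cells1 K x y. \<forall>\<alpha> \<in> cells2 K x y f f'.
        \<forall>g \<in> cells1 K y z. \<forall>g' \<in> cells1 K y z. \<forall>\<beta> \<in> cells2 K y z g g'.
        Comp (HomCat K x z) (wr K \<beta> f') (wl K g \<alpha>) = Comp (HomCat K x z) (wl K g' \<alpha>) (wr K \<beta> f))"

record ('o, 'm, 'c, 'p, 'n, 'd) two_map =
  on0 :: "'o \<Rightarrow> 'p"
  on1 :: "'m \<Rightarrow> 'n"
  on2 :: "'c \<Rightarrow> 'd"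

definition is_two_functor ::
  "('o, 'm, 'c) two_category \<Rightarrow> ('p, 'n, 'd) two_category \<Rightarrow> ('o, 'm, 'c, 'p, 'n, 'd) two_map \<Rightarrow> bool"
  where
  "is_two_functor K L U \<longleftrightarrow> is_two_category K \<and> is_two_category L \<and>
     (\<forall>x \<in> Ob K. on0 U x \<in> Ob L) \<and>
     (\<forall>x \<in> Ob K. \<forall>y \<in> Ob K.
        is_functor (HomCat K x y) (HomCat L (on0 U x) (on0 U y)) (on1 U) (on2 U)) \<and>
     (\<forall>x \<in> Ob K. on1 U (id1 K x) = id1 L (on0 U x)) \<and>
     (\<forall>x \<in> Ob K. \<forall>y \<in> Ob K. \<forall>z \<in> Ob K. \<forall>f \<in> cells1 K x y. \<forall>g \<in> cells1 K y z.
        on1 U (comp1 K g f) = comp1 L (on1 U g) (on1 U f)) \<and>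
     (\<forall>x \<in> Ob K. \<forall>y \<in> Ob K. \<forall>z \<in> Ob K.
        \<forall>f \<in> cells1 K x y. \<forall>f' \<in> cells1 K x y. \<forall>\<alpha> \<in> cells2 K x y f f'. \<forall>h \<in> cells1 K y z.
        on2 U (wl K h \<alpha>) = wl L (on1 U h) (on2 U \<alpha>)) \<and>
     (\<forall>x \<in> Ob K. \<forall>y \<in> Ob K. \<forall>z \<in> Ob K.
        \<forall>f \<in> cells1 K x y. \<forall>g \<in> cells1 K y z. \<forall>g' \<in> cells1 K y z. \<forall>\<alpha> \<in> cells2 K y z g g'.
        on2 U (wr K \<alpha> f) = wr L (on2 U \<alpha>) (on1 U f))"

definition retract_bireflection ::
  "('o, 'm, 'c) two_category \<Rightarrow> ('p, 'n, 'd) two_category \<Rightarrow> ('o, 'm, 'c, 'p, 'n, 'd) two_map \<Rightarrow>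
     'p \<Rightarrow> 'o \<Rightarrow> 'n \<Rightarrow> bool" where
  "retract_bireflection K L U x z \<eta> \<longleftrightarrow> z \<in> Ob K \<and> \<eta> \<in> cells1 L x (on0 U z) \<and>
     (\<forall>y \<in> Ob K. surjective_equivalence (HomCat K z y) (HomCat L x (on0 U y))
        (\<lambda>h. comp1 L (on1 U h) \<eta>) (\<lambda>\<alpha>. wr L (on2 U \<alpha>) \<eta>))"

definition left_retract_biadjoint ::
  "('o, 'm, 'c) two_category \<Rightarrow> ('p, 'n, 'd) two_category \<Rightarrow> ('o, 'm, 'c, 'p, 'n, 'd) two_map \<Rightarrow>
     ('p \<Rightarrow> 'o) \<Rightarrow> ('p \<Rightarrow> 'n) \<Rightarrow> bool" where
  "left_retract_biadjoint K L U F \<eta> \<longleftrightarrow> is_two_functor K L U \<and>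
     (\<forall>x \<in> Ob L. retract_bireflection K L U x (F x) (\<eta> x))"

section \<open>The 2-category of types in a context\<close>

text \<open>
  Composition \<open>q \<circ> p\<close> of \<open>p : Id(a,b)\<close> and \<open>q : Id(b,c)\<close>: eliminate \<open>q : Id(x,y)\<close> into
  \<open>\<Pi>(Id(a,x), Id(a,y))\<close>, with the identity function over \<open>r(x)\<close>, and apply the result to \<open>p\<close>.
\<close>

definition Id_trans :: "('s, 'z) ml2_scheme \<Rightarrow> 's expr \<Rightarrow> 's expr \<Rightarrow> 's expr \<Rightarrow> 's expr \<Rightarrow>
    's expr \<Rightarrow> 's expr \<Rightarrow> 's expr" where
  "Id_trans S A a b c q p =
     app_at S (Idt S A a b) (shift 1 (Idt S A a c))
       (inst3 b c q
         (Id_elim S A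
           (Pt S (Idt S (shift 3 A) (shift 3 a) (Var 2)) (Idt S (shift 4 A) (shift 4 a) (Var 2)))
           (lam S (Idt S (shift 1 A) (shift 1 a) (Var 0)) (Idt S (shift 2 A) (shift 2 a) (Var 1))
             (Var 0))))
       p"

text \<open>
  \<open>Id_ap S A B h a b p\<close> is \<open>h\<^sup>\<bullet>(p) : Id\<^sub>B(h a, h b)\<close> for \<open>p : Id\<^sub>A(a,b)\<close>; here \<open>x : A \<turnstile> h(x) : B\<close>, and
  \<open>A\<close>, \<open>B\<close> live in the ambient context.
\<close>

definition Id_ap :: "('s, 'z) ml2_scheme \<Rightarrow> 's expr \<Rightarrow> 's expr \<Rightarrow> 's expr \<Rightarrow> 's expr \<Rightarrow>
    's expr \<Rightarrow> 's expr \<Rightarrow> 's expr" where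
  "Id_ap S A B h a b p =
     inst3 a b p
       (Id_elim S A
         (Idt S (shift 3 B) (subst (Var 2 \<triangleright> drop_vars 3) h) (subst (Var 1 \<triangleright> drop_vars 3) h))
         (rfl S (shift 1 B) h))"

text \<open>
  Types, 1-cells and 2-cells are classes, modulo definitional equality, of the judgements
  \<open>\<Gamma> \<turnstile> A type\<close>, \<open>\<Gamma>, y : A \<turnstile> f : B\<close> and \<open>\<Gamma>, y : A \<turnstile> \<alpha> : Id\<^sub>B(f, g)\<close>. A judgement is represented by the
  tuple of its constituents, and operations on classes are given on representatives.
\<close>

type_synonym 's ty_class = "'s expr set"
type_synonym 's tm_class = "('s expr \<times> 's expr \<times> 's expr) set"
type_synonym 's id_class = "('s expr \<times> 's expr \<times> 's expr \<times> 's expr \<times> 's expr) set"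

definition ty_class :: "('s, 'z) ml2_scheme \<Rightarrow> 's ctxt \<Rightarrow> 's expr \<Rightarrow> 's ty_class" where
  "ty_class S \<Gamma> A = {A'. \<Gamma> \<turnstile>\<^bsub>S\<^esub> A \<doteq> A' Ty}"

definition tm_class :: "('s, 'z) ml2_scheme \<Rightarrow> 's ctxt \<Rightarrow> 's expr \<Rightarrow> 's expr \<Rightarrow> 's expr \<Rightarrow> 's tm_class"
  where
  "tm_class S \<Gamma> A B f = {(A', B', f').
     \<Gamma> \<turnstile>\<^bsub>S\<^esub> A \<doteq> A' Ty \<and> \<Gamma> \<turnstile>\<^bsub>S\<^esub> B \<doteq> B' Ty \<and> A # \<Gamma> \<turnstile>\<^bsub>S\<^esub> f \<doteq> f' \<tturnstile> shift 1 B}"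

definition id_class :: "('s, 'z) ml2_scheme \<Rightarrow> 's ctxt \<Rightarrow> 's expr \<Rightarrow> 's expr \<Rightarrow> 's expr \<Rightarrow> 's expr \<Rightarrow>
    's expr \<Rightarrow> 's id_class" where
  "id_class S \<Gamma> A B f g \<alpha> = {(A', B', f', g', \<alpha>').
     \<Gamma> \<turnstile>\<^bsub>S\<^esub> A \<doteq> A' Ty \<and> \<Gamma> \<turnstile>\<^bsub>S\<^esub> B \<doteq> B' Ty \<and>
     A # \<Gamma> \<turnstile>\<^bsub>S\<^esub> f \<doteq> f' \<tturnstile> shift 1 B \<and> A # \<Gamma> \<turnstile>\<^bsub>S\<^esub> g \<doteq> g' \<tturnstile> shift 1 B \<and>
     A # \<Gamma> \<turnstile>\<^bsub>S\<^esub> \<alpha> \<doteq> \<alpha>' \<tturnstile> Idt S (shift 1 B) f g}"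

text \<open>\<open>precomp f e\<close> is \<open>e(f(x))\<close>, where \<open>x : A \<turnstile> f(x) : B\<close> and \<open>e(y)\<close> depends on \<open>y : B\<close>.\<close>

abbreviation precomp :: "'s expr \<Rightarrow> 's expr \<Rightarrow> 's expr" where
  "precomp f \<equiv> subst (f \<triangleright> drop_vars 1)"

definition types_homcat :: "('s, 'z) ml2_scheme \<Rightarrow> 's ctxt \<Rightarrow> 's ty_class \<Rightarrow> 's ty_class \<Rightarrow>
    ('s tm_class, 's id_class) category" where
  "types_homcat S \<Gamma> X Y =
     \<lparr>Obj = {tm_class S \<Gamma> A B f | A B f. A \<in> X \<and> B \<in> Y \<and> A # \<Gamma> \<turnstile>\<^bsub>S\<^esub> f \<tturnstile> shift 1 B},
      Hom = (\<lambda>F G. {id_class S \<Gamma> A B f g \<alpha> | A B f g \<alpha>.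
        (A, B, f) \<in> F \<and> (A, B, g) \<in> G \<and> A # \<Gamma> \<turnstile>\<^bsub>S\<^esub> \<alpha> \<tturnstile> Idt S (shift 1 B) f g}),
      Ident = (\<lambda>F. \<Union>(A, B, f) \<in> F. id_class S \<Gamma> A B f f (rfl S (shift 1 B) f)),
      Comp = (\<lambda>\<beta>s \<alpha>s. \<Union>{id_class S \<Gamma> A B f k (Id_trans S (shift 1 B) f g k \<beta> \<alpha>) | A B f g k \<alpha> \<beta>.
        (A, B, f, g, \<alpha>) \<in> \<alpha>s \<and> (A, B, g, k, \<beta>) \<in> \<beta>s})\<rparr>"

definition types_two_category :: "('s, 'z) ml2_scheme \<Rightarrow> 's ctxt \<Rightarrow>
    ('s ty_class, 's tm_class, 's id_class) two_category" where
  "types_two_category S \<Gamma> =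
     \<lparr>Ob = {ty_class S \<Gamma> A | A. \<Gamma> \<turnstile>\<^bsub>S\<^esub> A Ty},
      HomCat = types_homcat S \<Gamma>,
      id1 = (\<lambda>X. \<Union>A \<in> X. tm_class S \<Gamma> A A (Var 0)),
      comp1 = (\<lambda>G F. \<Union>{tm_class S \<Gamma> A C (precomp f g) | A B C f g.
        (A, B, f) \<in> F \<and> (B, C, g) \<in> G}),
      wl = (\<lambda>H \<alpha>s. \<Union>{id_class S \<Gamma> A C (precomp f h) (precomp g h)
          (Id_ap S (shift 1 B) (shift 1 C) (shift_under 1 h) f g \<alpha>) | A B C f g h \<alpha>.
        (A, B, f, g, \<alpha>) \<in> \<alpha>s \<and> (B, C, h) \<in> H}),
      wr = (\<lambda>\<alpha>s F. \<Union>{id_class S \<Gamma> A C (precomp f g) (precomp f k) (precomp f \<alpha>) | A B C f g k \<alpha>.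
        (A, B, f) \<in> F \<and> (B, C, g, k, \<alpha>) \<in> \<alpha>s})\<rparr>"

text \<open>The action of \<open>types_two_category\<close> on a context morphism \<open>\<sigma>\<close> with domain \<open>\<Delta>\<close>.\<close>

definition types_two_map :: "('s, 'z) ml2_scheme \<Rightarrow> 's ctxt \<Rightarrow> 's subst \<Rightarrow>
    ('s ty_class, 's tm_class, 's id_class, 's ty_class, 's tm_class, 's id_class) two_map" where
  "types_two_map S \<Delta> \<sigma> =
     \<lparr>on0 = (\<lambda>X. \<Union>A \<in> X. ty_class S \<Delta> (subst \<sigma> A)),
      on1 = (\<lambda>F. \<Union>(A, B, f) \<in> F. tm_class S \<Delta> (subst \<sigma> A) (subst \<sigma> B) (subst (lift \<sigma>) f)),
      on2 = (\<lambda>\<alpha>s. \<Union>(A, B, f, g, \<alpha>) \<in> \<alpha>s. id_class S \<Delta> (subst \<sigma> A) (subst \<sigma> B)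
        (subst (lift \<sigma>) f) (subst (lift \<sigma>) g) (subst (lift \<sigma>) \<alpha>))\<rparr>"

definition weakening :: "('s, 'z) ml2_scheme \<Rightarrow> 's ctxt \<Rightarrow> 's expr \<Rightarrow>
    ('s ty_class, 's tm_class, 's id_class, 's ty_class, 's tm_class, 's id_class) two_map" where
  "weakening S \<Gamma> A = types_two_map S (A # \<Gamma>) (drop_vars 1)"

end

theory Submission
  imports Defs
begin

text \<open>
  The reflection of \<open>\<Gamma>, x : A \<turnstile> B type\<close> is \<open>\<Sigma>(A,B)\<close>, with unit the pairing \<open>\<langle>x,y\<rangle>\<close>. Precomposition with
  pairing is surjective on objects and full by \<open>\<Sigma>\<close>-elimination and its computation rule; it is
  faithful because two elements of an identity type over \<open>\<Sigma>(A,B)\<close> that agree on pairs are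
  propositionally equal, again by \<open>\<Sigma>\<close>-elimination, hence definitionally equal, identity types being
  discrete. In the same way the 2-category laws follow by identity elimination from the case of
  reflexivity, where they are computation rules.
\<close>

section \<open>Calculus of substitutions\<close>

text \<open>Discreteness turns propositional equality into definitional equality, but only between
  elements of identity types. Hence 2-cells obey strict laws, whereas the rules used here do not
  identify two terms over \<open>\<Sigma>(A,B)\<close> that agree on pairs: precomposition with
  pairing is shown to be a surjective equivalence, not an isomorphism. A law about a single path
  needs only the plain eliminator. When two consecutive paths occur, eliminating one moves an
  endpoint of the other, so the other must be abstracted along with it by a
  \<open>\<Pi>\<close>-type in the motive. Cells are classes modulo definitional equality of types,
  endpoints and terms at once. Every operation is first shown independent of representatives;
  afterwards the types are fixed and one computes with expressions. What is defined by substitution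
  (right whiskering, the action of a context morphism) is functorial already on raw expressions;
  vertical composition and left whiskering rest on computation rules and discreteness.\<close>

definition subst_comp :: "'s subst \<Rightarrow> 's subst \<Rightarrow> 's subst" where
  "subst_comp \<sigma> \<tau> = (\<lambda>i. subst \<sigma> (\<tau> i))"

lemma lift_Var_comp: "lift (\<lambda>i. Var (\<rho> i)) = (\<lambda>i. Var (lift_ren \<rho> i))"
  by (rule HOL.ext) (simp add: lift_def lift_ren_def split: nat.split)

text \<open>Renaming serves to define \<open>lift\<close> before \<open>subst\<close> is available;
  from here on it can be treated as a substitution by variables.\<close>

lemma rename_eq_subst:
  fixes e :: "'s expr"
  shows "rename \<rho> e = subst (\<lambda>i. Var (\<rho> i)) e"
proof (induction \<rho> e rule: rename.induct)
  case (2 \<rho> s es)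
  have "(lift ^^ k) (\<lambda>i. Var (\<rho> i)) = (\<lambda>i. Var ((lift_ren ^^ k) \<rho> i) :: 's expr)"
    for k
    by (induction k) (simp_all add: lift_Var_comp)
  with 2 show ?case by auto
qed simp

lemma lift_comp_ren: "(\<lambda>i. lift \<sigma> (lift_ren \<rho> i)) = lift (\<lambda>i. \<sigma> (\<rho> i))"
  by (rule HOL.ext) (simp add: lift_def lift_ren_def split: nat.split)

text \<open>Composition of substitutions passes under a binder only if \<open>lift\<close> respects
  it, and \<open>lift\<close> renames. The two cases in which one factor is a renaming therefore
  precede the general law \<open>subst_subst\<close>.\<close>

lemma subst_rename: "subst \<sigma> (rename \<rho> e) = subst (\<lambda>i. \<sigma> (\<rho> i)) e"
proof (induction \<rho> e arbitrary: \<sigma> rule: rename.induct)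
  case (2 \<rho> s es)
  have "(\<lambda>i. (lift ^^ k) \<sigma> ((lift_ren ^^ k) \<rho> i)) = (lift ^^ k) (\<lambda>i. \<sigma> (\<rho> i))" for k
    by (induction k) (simp_all add: lift_comp_ren)
  with 2 show ?case by auto
qed simp

lemma lift_rename_comp: "lift (\<lambda>i. rename \<rho> (\<sigma> i)) = (\<lambda>i. rename (lift_ren \<rho>) (lift \<sigma> i))"
proof
  fix i
  show "lift (\<lambda>i. rename \<rho> (\<sigma> i)) i = rename (lift_ren \<rho>) (lift \<sigma> i)"
    by (cases i) (simp_all add: lift_def lift_ren_def rename_eq_subst subst_rename[unfolded rename_eq_subst])
qed

lemma rename_subst: "rename \<rho> (subst \<sigma> e) = subst (\<lambda>i. rename \<rho> (\<sigma> i)) e"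
proof (induction \<sigma> e arbitrary: \<rho> rule: subst.induct)
  case (2 \<sigma> s es)
  have "(lift ^^ k) (\<lambda>i. rename \<rho> (\<sigma> i)) = (\<lambda>i. rename ((lift_ren ^^ k) \<rho>) ((lift ^^ k) \<sigma> i))" for k
    by (induction k) (simp_all add: lift_rename_comp)
  with 2 show ?case by auto
qed simp

lemma lift_subst_comp: "lift (subst_comp \<sigma> \<tau>) = subst_comp (lift \<sigma>) (lift \<tau>)"
proof
  fix i
  show "lift (subst_comp \<sigma> \<tau>) i = subst_comp (lift \<sigma>) (lift \<tau>) i"
    by (cases i) (simp_all add: lift_def subst_comp_def subst_rename rename_subst)
qed

lemma subst_subst: "subst \<sigma> (subst \<tau> e) = subst (subst_comp \<sigma> \<tau>) e"
proof (induction \<tau> e arbitrary: \<sigma> rule: subst.induct)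
  case (2 \<tau> s es)
  have "(lift ^^ k) (subst_comp \<sigma> \<tau>) = subst_comp ((lift ^^ k) \<sigma>) ((lift ^^ k) \<tau>)" for k
    by (induction k) (simp_all add: lift_subst_comp)
  with 2 show ?case by auto
qed (simp add: subst_comp_def)

lemma lift_Var: "lift Var = Var"
  by (rule HOL.ext) (simp add: lift_def split: nat.split)

lemma subst_Var: "subst Var e = e"
proof (induction "Var :: nat \<Rightarrow> 'a expr" e rule: subst.induct)
  case (2 s es)
  have "(lift ^^ k) Var = (Var :: nat \<Rightarrow> 'a expr)" for k
    by (induction k) (simp_all add: lift_Var)
  with 2 show ?case by (auto intro!: map_idI)
qed simp

lemma lift_eq: "lift \<sigma> = Var 0 \<triangleright> subst_comp (drop_vars 1) \<sigma>"
  by (simp add: lift_def subst_comp_def drop_vars_def rename_eq_subst)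

lemma subst_comp_extend: "subst_comp \<sigma> (a \<triangleright> \<tau>) = subst \<sigma> a \<triangleright> subst_comp \<sigma> \<tau>"
  by (rule HOL.ext) (simp add: subst_comp_def split: nat.split)

lemma subst_comp_extend_drop:
  "subst_comp (a \<triangleright> \<sigma>) (drop_vars (Suc n)) = subst_comp \<sigma> (drop_vars n)"
  "subst_comp (a \<triangleright> \<sigma>) (drop_vars (numeral k)) = subst_comp \<sigma> (drop_vars (pred_numeral k))"
  by (simp_all add: subst_comp_def drop_vars_def numeral_eq_Suc)

lemma drop_vars_0: "drop_vars 0 = Var"
  by (simp add: drop_vars_def)

lemma subst_comp_Var: "subst_comp \<sigma> Var = \<sigma>" "subst_comp Var \<sigma> = \<sigma>"
  by (simp_all add: subst_comp_def subst_Var)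

lemma subst_comp_drop_drop: "subst_comp (drop_vars m) (drop_vars n) = drop_vars (n + m)"
  by (simp add: subst_comp_def drop_vars_def add.assoc)

lemma subst_comp_assoc: "subst_comp (subst_comp \<rho> \<sigma>) \<tau> = subst_comp \<rho> (subst_comp \<sigma> \<tau>)"
  by (simp add: subst_comp_def subst_subst)

lemma drop_vars_apply: "drop_vars n i = Var (i + n)"
  by (simp add: drop_vars_def)

lemma subst_comp_apply: "subst_comp \<sigma> \<tau> i = subst \<sigma> (\<tau> i)"
  by (simp add: subst_comp_def)

lemma subst_comp_extend_drop_subst_comp:
  "subst_comp (a \<triangleright> \<sigma>) (subst_comp (drop_vars (Suc n)) \<tau>) = subst_comp \<sigma> (subst_comp (drop_vars n) \<tau>)"
  "subst_comp (a \<triangleright> \<sigma>) (subst_comp (drop_vars (numeral k)) \<tau>) = subst_comp \<sigma> (subst_comp (drop_vars (pred_numeral k)) \<tau>)"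
  "subst_comp (drop_vars m) (subst_comp (drop_vars n) \<tau>) = subst_comp (drop_vars (n + m)) \<tau>"
  by (simp_all add: subst_comp_assoc[symmetric] subst_comp_extend_drop subst_comp_drop_drop)

text \<open>The instances n = 0, 1, 2 of
  \<open>Var n \<triangleright> drop_vars (n + 1) = drop_vars n\<close>: splitting off the newest
  remaining variable of a projection changes nothing.\<close>

lemma extend_eta: "Var 0 \<triangleright> drop_vars (Suc 0) = Var"
  "Var (Suc 0) \<triangleright> drop_vars 2 = drop_vars (Suc 0)" "Var 2 \<triangleright> drop_vars 3 = drop_vars 2"
  by (rule HOL.ext, simp add: drop_vars_def split: nat.split)+

text \<open>Oriented like the sigma-calculus of explicit substitutions: nested substitutions merge
  into one, which becomes a list of extensions over a projection. Judgements that differ only in how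
  substitutions are composed thereby become syntactically equal.\<close>

lemmas sub_norm = subst_subst subst_Var lift_eq subst_comp_extend subst_comp_extend_drop drop_vars_0 subst_comp_Var
  subst_comp_drop_drop subst_comp_assoc drop_vars_apply subst_comp_apply subst_comp_extend_drop_subst_comp extend_eta
  numeral_2_eq_2[symmetric]

section \<open>Context morphisms and congruence of substitution\<close>

context type_theory
begin

lemma lookup_Cons: "subst (a \<triangleright> \<sigma>) (lookup (A # \<Gamma>) (Suc i)) = subst \<sigma> (lookup \<Gamma> i)"
  "subst (a \<triangleright> \<sigma>) (lookup (A # \<Gamma>) 0) = subst \<sigma> A"
  by (simp_all add: lookup_def sub_norm)

lemma ctx_mor_extend:
  assumes "ctx_mor S \<Delta> \<sigma> \<Gamma>" "\<Gamma> \<turnstile> A Ty" "\<Delta> \<turnstile> a \<tturnstile> subst \<sigma> A"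
  shows "ctx_mor S \<Delta> (a \<triangleright> \<sigma>) (A # \<Gamma>)"
  using assms by (auto simp: ctx_mor_def less_Suc_eq_0_disj lookup_Cons)

text \<open>Variable \<open>i\<close> of \<open>\<Gamma>\<close> is variable \<open>i + n\<close> of
  \<open>\<Delta>\<close>, and shifting its type by \<open>Suc i\<close> and then by
  \<open>n\<close> is shifting it by \<open>Suc (i + n)\<close>, so the required type is met without
  conversion.\<close>

lemma ctx_mor_drop:
  assumes "ctx S \<Delta>" "drop n \<Delta> = \<Gamma>"
  shows "ctx_mor S \<Delta> (drop_vars n) \<Gamma>"
proof -
  have "ctx S (drop n \<Delta>)"
    using assms(1) by (induction \<Delta> arbitrary: n) (auto simp: drop_Cons split: nat.split)
  moreover have "\<Delta> \<turnstile> Var (i + n) \<tturnstile> subst (drop_vars n) (lookup \<Gamma> i)" if "i < length \<Gamma>" for i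
  proof -
    have "subst (drop_vars n) (lookup \<Gamma> i) = lookup \<Delta> (i + n)"
      using assms(2) that by (auto simp: lookup_def sub_norm add.commute)
    then show ?thesis
      using assms that by (auto intro: var)
  qed
  ultimately show ?thesis
    using assms by (simp add: ctx_mor_def drop_vars_def)
qed

lemma ctx_mor_Var: "ctx S \<Gamma> \<Longrightarrow> ctx_mor S \<Gamma> Var \<Gamma>"
  using ctx_mor_drop[of \<Gamma> 0 \<Gamma>] by (simp add: drop_vars_0)

lemma var': "ctx S \<Gamma> \<Longrightarrow> i < length \<Gamma> \<Longrightarrow> lookup \<Gamma> i = A \<Longrightarrow> \<Gamma> \<turnstile> Var i \<tturnstile> A"
  using var by blast

lemma var_0: "\<Gamma> \<turnstile> A Ty \<Longrightarrow> A # \<Gamma> \<turnstile> Var 0 \<tturnstile> shift 1 A"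
  by (rule var') (auto simp: lookup_def dest: ty_ctx)

lemma ctx_mor_comp:
  assumes "ctx_mor S \<Delta> \<sigma> \<Gamma>" "ctx_mor S \<Gamma> \<tau> \<Theta>"
  shows "ctx_mor S \<Delta> (subst_comp \<sigma> \<tau>) \<Theta>"
  using assms tm_subst[OF assms(1)] by (auto simp: ctx_mor_def subst_subst[symmetric] subst_comp_apply)

lemma ctx_mor_weaken:
  assumes "ctx_mor S \<Delta> \<sigma> \<Gamma>" "\<Delta> \<turnstile> B Ty"
  shows "ctx_mor S (B # \<Delta>) (subst_comp (drop_vars 1) \<sigma>) \<Gamma>"
  by (rule ctx_mor_comp[OF ctx_mor_drop assms(1)]) (use assms(2) in \<open>auto dest: ty_ctx\<close>)

lemma ctx_mor_lift:
  assumes "ctx_mor S \<Delta> \<sigma> \<Gamma>" "\<Gamma> \<turnstile> A Ty"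
  shows "ctx_mor S (subst \<sigma> A # \<Delta>) (lift \<sigma>) (A # \<Gamma>)"
proof -
  have A: "\<Delta> \<turnstile> subst \<sigma> A Ty"
    using assms by (rule ty_subst)
  show ?thesis
    unfolding lift_eq
    by (intro ctx_mor_extend ctx_mor_weaken assms A) (use var_0[OF A] in \<open>simp add: subst_subst\<close>)
qed

lemma ctx_mor_eq_refl: "ctx_mor S \<Delta> \<sigma> \<Gamma> \<Longrightarrow> ctx_mor_eq S \<Delta> \<sigma> \<sigma> \<Gamma>"
  by (auto simp: ctx_mor_eq_def ctx_mor_def intro: tm_refl)

lemma ctx_mor_eq_extend:
  assumes "ctx_mor_eq S \<Delta> \<sigma> \<tau> \<Gamma>" "\<Gamma> \<turnstile> A Ty" "\<Delta> \<turnstile> a \<doteq> b \<tturnstile> subst \<sigma> A"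
  shows "ctx_mor_eq S \<Delta> (a \<triangleright> \<sigma>) (b \<triangleright> \<tau>) (A # \<Gamma>)"
proof -
  \<comment> \<open>\<open>b\<close> is known only at the type \<open>subst \<sigma> A\<close>,
    while a morphism extending \<open>\<tau>\<close> needs it at \<open>subst \<tau> A\<close>;
    congruence of substitution in types supplies the conversion.\<close>
  have "\<Delta> \<turnstile> b \<tturnstile> subst \<tau> A"
    using assms eq_tm_right tm_conv ty_subst_cong by blast
  then have "ctx_mor S \<Delta> (b \<triangleright> \<tau>) (A # \<Gamma>)" "ctx_mor S \<Delta> (a \<triangleright> \<sigma>) (A # \<Gamma>)"
    using assms eq_tm_left by (auto simp: ctx_mor_eq_def intro: ctx_mor_extend)
  then show ?thesis
    using assms by (auto simp: ctx_mor_eq_def less_Suc_eq_0_disj lookup_Cons)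
qed

lemma eq_tm_subst_cong:
  assumes "ctx_mor_eq S \<Delta> \<sigma> \<tau> \<Gamma>" "\<Gamma> \<turnstile> a \<doteq> b \<tturnstile> A"
  shows "\<Delta> \<turnstile> subst \<sigma> a \<doteq> subst \<tau> b \<tturnstile> subst \<sigma> A"
proof (rule tm_trans)
  show "\<Delta> \<turnstile> subst \<sigma> a \<doteq> subst \<sigma> b \<tturnstile> subst \<sigma> A"
    using assms by (auto simp: ctx_mor_eq_def intro: eq_tm_subst)
  show "\<Delta> \<turnstile> subst \<sigma> b \<doteq> subst \<tau> b \<tturnstile> subst \<sigma> A"
    using assms eq_tm_right by (auto intro: tm_subst_cong)
qed

lemma shift_ty: "\<Gamma> \<turnstile> A Ty \<Longrightarrow> ctx S \<Delta> \<Longrightarrow> drop n \<Delta> = \<Gamma> \<Longrightarrow> \<Delta> \<turnstile> shift n A Ty"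
  using ctx_mor_drop ty_subst by blast

lemma shift_tm: "\<Gamma> \<turnstile> a \<tturnstile> A \<Longrightarrow> ctx S \<Delta> \<Longrightarrow> drop n \<Delta> = \<Gamma> \<Longrightarrow> \<Delta> \<turnstile> shift n a \<tturnstile> shift n A"
  using ctx_mor_drop tm_subst by blast

lemma shift_eq_ty: "\<Gamma> \<turnstile> A \<doteq> B Ty \<Longrightarrow> ctx S \<Delta> \<Longrightarrow> drop n \<Delta> = \<Gamma> \<Longrightarrow> \<Delta> \<turnstile> shift n A \<doteq> shift n B Ty"
  using ctx_mor_drop eq_ty_subst by blast

lemma shift_eq_tm: "\<Gamma> \<turnstile> a \<doteq> b \<tturnstile> A \<Longrightarrow> ctx S \<Delta> \<Longrightarrow> drop n \<Delta> = \<Gamma> \<Longrightarrow>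
    \<Delta> \<turnstile> shift n a \<doteq> shift n b \<tturnstile> shift n A"
  using ctx_mor_drop eq_tm_subst by blast

text \<open>Context conversion is not among the structural rules. It is obtained as substitution
  along the identity substitution, read as a morphism between two contexts whose last types are
  equal.\<close>

lemma ctx_mor_conv:
  assumes "\<Gamma> \<turnstile> A \<doteq> B Ty"
  shows "ctx_mor S (B # \<Gamma>) Var (A # \<Gamma>)"
proof -
  have AB: "\<Gamma> \<turnstile> A Ty" "\<Gamma> \<turnstile> B Ty" "ctx S \<Gamma>"
    using assms eq_ty_left eq_ty_right ty_ctx by blast+
  have "B # \<Gamma> \<turnstile> shift 1 B \<doteq> shift 1 A Ty"
    by (rule shift_eq_ty[OF ty_sym[OF assms]]) (use AB in auto)
  then have "B # \<Gamma> \<turnstile> Var 0 \<tturnstile> shift 1 A"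
    using var_0[OF AB(2)] tm_conv by blast
  moreover have "ctx_mor S (B # \<Gamma>) (drop_vars 1) \<Gamma>"
    by (rule ctx_mor_drop) (use AB in auto)
  ultimately have "ctx_mor S (B # \<Gamma>) (Var 0 \<triangleright> drop_vars 1) (A # \<Gamma>)"
    using AB(1) ctx_mor_extend by blast
  then show ?thesis
    by (simp add: extend_eta)
qed

lemma eq_tm_ctx_conv:
  assumes "\<Gamma> \<turnstile> A \<doteq> B Ty" "A # \<Gamma> \<turnstile> a \<doteq> b \<tturnstile> T"
  shows "B # \<Gamma> \<turnstile> a \<doteq> b \<tturnstile> T"
  using eq_tm_subst[OF ctx_mor_conv[OF assms(1)] assms(2)] by (simp add: subst_Var)

end

section \<open>Elimination on identity types\<close>

text \<open>\<open>Id_elim\<close> lives in a context extended by three variables, and its stability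
  law speaks only of triply lifted substitutions. Its instance at \<open>a\<close>,
  \<open>b\<close>, \<open>p\<close> lives in the ambient context and commutes with every
  substitution.\<close>

definition J :: "('s, 'z) ml2_scheme \<Rightarrow> 's expr \<Rightarrow> 's expr \<Rightarrow> 's expr \<Rightarrow> 's expr \<Rightarrow> 's expr \<Rightarrow>
    's expr \<Rightarrow> 's expr" where
  "J S A C d a b p = inst3 a b p (Id_elim S A C d)"

context ML2
begin

text \<open>The stability law for \<open>app\<close> covers only \<open>lift \<sigma>\<close>; the
  substitution \<open>a \<triangleright> \<sigma>\<close> factors as \<open>lift \<sigma>\<close>
  followed by instantiation at \<open>a\<close>. The same factorisation handles
  \<open>Id_elim\<close> below.\<close>

lemma subst_app_extend: "subst (a \<triangleright> \<sigma>) (app S A B m) =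
    app_at S (subst \<sigma> A) (subst (lift \<sigma>) B) (subst \<sigma> m) a"
  unfolding app_at_def subst_app[symmetric] by (simp add: sub_norm)

lemma subst_app_at: "subst \<sigma> (app_at S A B m a) =
    app_at S (subst \<sigma> A) (subst (lift \<sigma>) B) (subst \<sigma> m) (subst \<sigma> a)"
  unfolding app_at_def subst_app[symmetric] by (simp add: sub_norm)

lemma subst_Id_elim_extend: "subst (p \<triangleright> b \<triangleright> a \<triangleright> \<sigma>) (Id_elim S A C d) =
    J S (subst \<sigma> A) (subst (lift (lift (lift \<sigma>))) C) (subst (lift \<sigma>) d) a b p"
  unfolding J_def subst_Id_elim[symmetric] by (simp add: sub_norm)

lemma subst_J: "subst \<sigma> (J S A C d a b p) =
    J S (subst \<sigma> A) (subst (lift (lift (lift \<sigma>))) C) (subst (lift \<sigma>) d)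
      (subst \<sigma> a) (subst \<sigma> b) (subst \<sigma> p)"
  unfolding J_def subst_Id_elim[symmetric] by (simp add: sub_norm)

lemmas op_norm = subst_Sg subst_pair subst_One subst_star subst_Idt subst_rfl subst_Pt subst_lam
  subst_ext subst_app_at subst_J subst_app_extend subst_Id_elim_extend

lemma Id_ctx_ctx:
  assumes "\<Gamma> \<turnstile> A Ty"
  shows "ctx S (Id_ctx S A \<Gamma>)"
proof -
  have 1: "A # \<Gamma> \<turnstile> shift 1 A Ty"
    using assms by (auto intro!: shift_ty dest: ty_ctx)
  have "shift 1 A # A # \<Gamma> \<turnstile> Idt S (shift 2 A) (Var 1) (Var 0) Ty"
    using assms 1 by (intro Id_form var') (auto simp: lookup_def sub_norm dest: ty_ctx)
  then show ?thesis
    using assms 1 by (auto simp: Id_ctx_def dest: ty_ctx)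
qed

lemma inst_eq:
  assumes "\<Gamma> \<turnstile> a \<doteq> b \<tturnstile> A" "\<Gamma> \<turnstile> A Ty"
  shows "ctx_mor_eq S \<Gamma> (a \<triangleright> Var) (b \<triangleright> Var) (A # \<Gamma>)"
  using assms by (auto intro!: ctx_mor_eq_extend ctx_mor_eq_refl ctx_mor_Var simp: subst_Var dest: ty_ctx)

lemma inst_mor:
  assumes "\<Gamma> \<turnstile> a \<tturnstile> A"
  shows "ctx_mor S \<Gamma> (a \<triangleright> Var) (A # \<Gamma>)"
  using inst_eq[OF tm_refl[OF assms] tm_ty[OF assms]] by (simp add: ctx_mor_eq_def)

text \<open>The passage from definitional to propositional equality, by converting the second
  endpoint of reflexivity. \<open>Id_discrete\<close> provides the way back between identity
  proofs.\<close>

lemma rfl_of_eq: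
  assumes "\<Gamma> \<turnstile> a \<doteq> b \<tturnstile> A"
  shows "\<Gamma> \<turnstile> rfl S A a \<tturnstile> Idt S A a b"
proof -
  have a: "\<Gamma> \<turnstile> a \<tturnstile> A"
    using assms by (rule eq_tm_left)
  show ?thesis
    by (rule tm_conv[OF rfl_intro[OF a] Id_cong[OF ty_refl[OF tm_ty[OF a]] tm_refl[OF a] assms]])
qed

lemma inst3_eq:
  assumes "\<Gamma> \<turnstile> A Ty" "\<Gamma> \<turnstile> a \<doteq> a' \<tturnstile> A" "\<Gamma> \<turnstile> b \<doteq> b' \<tturnstile> A" "\<Gamma> \<turnstile> p \<doteq> p' \<tturnstile> Idt S A a b"
  shows "ctx_mor_eq S \<Gamma> (p \<triangleright> b \<triangleright> a \<triangleright> Var) (p' \<triangleright> b' \<triangleright> a' \<triangleright> Var) (Id_ctx S A \<Gamma>)"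
proof -
  have "ctx S (Id_ctx S A \<Gamma>)"
    using assms(1) by (rule Id_ctx_ctx)
  then show ?thesis
    unfolding Id_ctx_def using assms
    by (intro ctx_mor_eq_extend ctx_mor_eq_refl ctx_mor_Var) (simp_all add: sub_norm op_norm)
qed

lemma inst3_mor:
  assumes "\<Gamma> \<turnstile> A Ty" "\<Gamma> \<turnstile> a \<tturnstile> A" "\<Gamma> \<turnstile> b \<tturnstile> A" "\<Gamma> \<turnstile> p \<tturnstile> Idt S A a b"
  shows "ctx_mor S \<Gamma> (p \<triangleright> b \<triangleright> a \<triangleright> Var) (Id_ctx S A \<Gamma>)"
  using inst3_eq[of \<Gamma> A a a b b p p] assms tm_refl by (auto simp: ctx_mor_eq_def)

lemma J_cong:
  assumes "\<Gamma> \<turnstile> A \<doteq> A' Ty" "Id_ctx S A \<Gamma> \<turnstile> C \<doteq> C' Ty"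
    "A # \<Gamma> \<turnstile> d \<doteq> d' \<tturnstile> subst (rfl_subst S A) C"
    "\<Gamma> \<turnstile> a \<doteq> a' \<tturnstile> A" "\<Gamma> \<turnstile> b \<doteq> b' \<tturnstile> A" "\<Gamma> \<turnstile> p \<doteq> p' \<tturnstile> Idt S A a b"
  shows "\<Gamma> \<turnstile> J S A C d a b p \<doteq> J S A' C' d' a' b' p' \<tturnstile> inst3 a b p C"
  unfolding J_def
  by (rule eq_tm_subst_cong[OF inst3_eq Id_elim_cong]) (use assms eq_ty_left in blast)+

lemma J_rfl:
  assumes "Id_ctx S A \<Gamma> \<turnstile> C Ty" "A # \<Gamma> \<turnstile> d \<tturnstile> subst (rfl_subst S A) C" "\<Gamma> \<turnstile> a \<tturnstile> A"
  shows "\<Gamma> \<turnstile> J S A C d a a (rfl S A a) \<doteq> inst a d \<tturnstile> inst3 a a (rfl S A a) C"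
proof -
  from eq_tm_subst[OF inst_mor[OF assms(3)] Id_comp[OF assms(1,2)]] show ?thesis
    by (simp add: rfl_subst_def sub_norm op_norm)
qed

lemma app_at_cong:
  assumes "\<Gamma> \<turnstile> A \<doteq> A' Ty" "A # \<Gamma> \<turnstile> B \<doteq> B' Ty" "\<Gamma> \<turnstile> m \<doteq> m' \<tturnstile> Pt S A B" "\<Gamma> \<turnstile> a \<doteq> a' \<tturnstile> A"
  shows "\<Gamma> \<turnstile> app_at S A B m a \<doteq> app_at S A' B' m' a' \<tturnstile> inst a B"
  unfolding app_at_def
  by (rule eq_tm_subst_cong[OF inst_eq app_cong]) (use assms eq_ty_left in blast)+

lemma app_at_lam:
  assumes "A # \<Gamma> \<turnstile> f \<tturnstile> B" "\<Gamma> \<turnstile> a \<tturnstile> A"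
  shows "\<Gamma> \<turnstile> app_at S A B (lam S A B f) a \<doteq> inst a f \<tturnstile> inst a B"
  unfolding app_at_def
  by (rule eq_tm_subst[OF inst_mor Pt_comp]) (use assms in blast)+

text \<open>
  Identity elimination into an identity type of an identity type proves a definitional equality,
  identity types being discrete.
\<close>

lemma Id_eqI:
  assumes u: "Id_ctx S A \<Gamma> \<turnstile> u \<tturnstile> Idt S T s t" and v: "Id_ctx S A \<Gamma> \<turnstile> v \<tturnstile> Idt S T s t"
    and uv: "A # \<Gamma> \<turnstile> subst (rfl_subst S A) u \<doteq> subst (rfl_subst S A) v
      \<tturnstile> subst (rfl_subst S A) (Idt S T s t)"
    and a: "\<Gamma> \<turnstile> a \<tturnstile> A" and b: "\<Gamma> \<turnstile> b \<tturnstile> A" and p: "\<Gamma> \<turnstile> p \<tturnstile> Idt S A a b"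
  shows "\<Gamma> \<turnstile> inst3 a b p u \<doteq> inst3 a b p v \<tturnstile> inst3 a b p (Idt S T s t)"
proof -
  have A: "\<Gamma> \<turnstile> A Ty"
    using a by (rule tm_ty)
  let ?\<rho> = "rfl_subst S A"
  have C: "Id_ctx S A \<Gamma> \<turnstile> Idt S (Idt S T s t) u v Ty"
    using u v by (rule Id_form)
  have "A # \<Gamma> \<turnstile> rfl S (subst ?\<rho> (Idt S T s t)) (subst ?\<rho> u) \<tturnstile> subst ?\<rho> (Idt S (Idt S T s t) u v)"
    \<comment> \<open>This instance pushes the substitution through the outer identity type only;
      the inner one has to remain as in \<open>uv\<close>, where it is the type of the
      equality.\<close>
    unfolding subst_Idt[of _ "Idt S T s t" u v]
    using uv by (rule rfl_of_eq)
  from Id_elim[OF C this] have "Id_ctx S A \<Gamma> \<turnstile> u \<doteq> v \<tturnstile> Idt S T s t"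
    by (rule Id_discrete[OF u v])
  then show ?thesis
    by (rule eq_tm_subst[OF inst3_mor[OF A a b p]])
qed

text \<open>
  Here \<open>u\<close> and \<open>v\<close> depend on a further variable of type \<open>E(x,y,p)\<close>, which is abstracted before
  eliminating.
\<close>

lemma Id_eqI_extended:
  assumes u: "E # Id_ctx S A \<Gamma> \<turnstile> u \<tturnstile> Idt S T s t" and v: "E # Id_ctx S A \<Gamma> \<turnstile> v \<tturnstile> Idt S T s t"
    and uv: "subst (rfl_subst S A) E # A # \<Gamma> \<turnstile> subst (lift (rfl_subst S A)) u
      \<doteq> subst (lift (rfl_subst S A)) v \<tturnstile> subst (lift (rfl_subst S A)) (Idt S T s t)"
    and a: "\<Gamma> \<turnstile> a \<tturnstile> A" and b: "\<Gamma> \<turnstile> b \<tturnstile> A" and p: "\<Gamma> \<turnstile> p \<tturnstile> Idt S A a b"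
    and q: "\<Gamma> \<turnstile> q \<tturnstile> inst3 a b p E"
  shows "\<Gamma> \<turnstile> subst (q \<triangleright> p \<triangleright> b \<triangleright> a \<triangleright> Var) u \<doteq> subst (q \<triangleright> p \<triangleright> b \<triangleright> a \<triangleright> Var) v
    \<tturnstile> subst (q \<triangleright> p \<triangleright> b \<triangleright> a \<triangleright> Var) (Idt S T s t)"
proof -
  have A: "\<Gamma> \<turnstile> A Ty"
    using a by (rule tm_ty)
  have E: "Id_ctx S A \<Gamma> \<turnstile> E Ty"
    using ty_ctx[OF tm_ty[OF u]] by simp
  let ?\<rho> = "rfl_subst S A" and ?I = "Idt S (Idt S T s t) u v"
  have I: "E # Id_ctx S A \<Gamma> \<turnstile> ?I Ty"
    using u v by (rule Id_form)
  have C: "Id_ctx S A \<Gamma> \<turnstile> Pt S E ?I Ty"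
    using E I by (rule Pt_form)
  have "subst ?\<rho> E # A # \<Gamma> \<turnstile> rfl S (subst (lift ?\<rho>) (Idt S T s t)) (subst (lift ?\<rho>) u)
      \<tturnstile> subst (lift ?\<rho>) ?I"
    unfolding subst_Idt[of _ "Idt S T s t" u v]
    using uv by (rule rfl_of_eq)
  from lam_intro[OF this] have "A # \<Gamma> \<turnstile> lam S (subst ?\<rho> E) (subst (lift ?\<rho>) ?I)
      (rfl S (subst (lift ?\<rho>) (Idt S T s t)) (subst (lift ?\<rho>) u)) \<tturnstile> subst ?\<rho> (Pt S E ?I)"
    by (simp add: subst_Pt)
  \<comment> \<open>The eliminator yields a function on \<open>E\<close>; its value at the generic
    element of \<open>E\<close> inhabits \<open>?I\<close> in the very context of \<open>u\<close>
    and \<open>v\<close>, where discreteness applies.\<close>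
  from app_elim[OF I Id_elim[OF C this]] have "E # Id_ctx S A \<Gamma> \<turnstile> u \<doteq> v \<tturnstile> Idt S T s t"
    by (rule Id_discrete[OF u v])
  then show ?thesis
    by (rule eq_tm_subst[OF ctx_mor_extend[OF inst3_mor[OF A a b p] E q]])
qed

end

section \<open>The groupoid structure of identity types\<close>

context ML2
begin

section \<open>Composition of paths and action of a map on paths\<close>

lemma Id_trans_J: "Id_trans S A a b c q p =
    app_at S (Idt S A a b) (shift 1 (Idt S A a c))
      (J S A (Pt S (Idt S (shift 3 A) (shift 3 a) (Var 2)) (Idt S (shift 4 A) (shift 4 a) (Var 2)))
        (lam S (Idt S (shift 1 A) (shift 1 a) (Var 0)) (Idt S (shift 2 A) (shift 2 a) (Var 1)) (Var 0))
        b c q) p"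
  by (simp only: Id_trans_def J_def)

lemma Id_ap_J: "Id_ap S A B h a b p =
    J S A (Idt S (shift 3 B) (subst (Var 2 \<triangleright> drop_vars 3) h) (subst (Var 1 \<triangleright> drop_vars 3) h))
      (rfl S (shift 1 B) h) a b p"
  by (simp only: Id_ap_def J_def)

lemma subst_Id_trans: "subst \<sigma> (Id_trans S A a b c q p) =
    Id_trans S (subst \<sigma> A) (subst \<sigma> a) (subst \<sigma> b) (subst \<sigma> c) (subst \<sigma> q) (subst \<sigma> p)"
  by (simp add: Id_trans_J sub_norm op_norm)

lemma subst_Id_ap: "subst \<sigma> (Id_ap S A B h a b p) =
    Id_ap S (subst \<sigma> A) (subst \<sigma> B) (subst (lift \<sigma>) h) (subst \<sigma> a) (subst \<sigma> b) (subst \<sigma> p)"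
  by (simp add: Id_ap_J sub_norm op_norm)

lemmas norm = sub_norm op_norm subst_Id_trans subst_Id_ap

lemma shift_under_mor:
  assumes "\<Gamma> \<turnstile> A Ty" "ctx S \<Delta>" "drop n \<Delta> = \<Gamma>"
  shows "ctx_mor S (shift n A # \<Delta>) (lift (drop_vars n)) (A # \<Gamma>)"
  using assms by (intro ctx_mor_lift ctx_mor_drop)

lemma Var_subst_mor:
  assumes "\<Gamma> \<turnstile> A Ty" "ctx S \<Delta>" "drop n \<Delta> = \<Gamma>" "\<Delta> \<turnstile> a \<tturnstile> shift n A"
  shows "ctx_mor S \<Delta> (a \<triangleright> drop_vars n) (A # \<Gamma>)"
  using assms by (intro ctx_mor_extend ctx_mor_drop)

lemma Id_ctx_drop: "drop 3 (Id_ctx S A \<Gamma>) = \<Gamma>" "drop 4 (E # Id_ctx S A \<Gamma>) = \<Gamma>"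
  by (simp_all add: Id_ctx_def)

lemma Id_ctx_vars:
  assumes "\<Gamma> \<turnstile> A Ty"
  shows "Id_ctx S A \<Gamma> \<turnstile> shift 3 A Ty" "Id_ctx S A \<Gamma> \<turnstile> Var 2 \<tturnstile> shift 3 A"
    "Id_ctx S A \<Gamma> \<turnstile> Var 1 \<tturnstile> shift 3 A"
    "Id_ctx S A \<Gamma> \<turnstile> Var 0 \<tturnstile> Idt S (shift 3 A) (Var 2) (Var 1)"
  using Id_ctx_ctx[OF assms] assms
  by (auto intro!: var' shift_ty simp: Id_ctx_drop lookup_def norm) (simp_all add: Id_ctx_def norm)

lemma head_var:
  assumes "\<Gamma> \<turnstile> A Ty"
  shows "A # \<Gamma> \<turnstile> shift 1 A Ty" "A # \<Gamma> \<turnstile> Var 0 \<tturnstile> shift 1 A" "ctx S (A # \<Gamma>)"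
  using var_0[OF assms] assms by (auto intro!: shift_ty dest: ty_ctx)

text \<open>Congruence comes before typing: with equal arguments on both sides it yields the typing
  rule \<open>Id_trans_tm\<close>, so the layers of the definition are checked only once.\<close>

lemma Id_trans_cong:
  assumes A: "\<Gamma> \<turnstile> A \<doteq> A' Ty" and a: "\<Gamma> \<turnstile> a \<doteq> a' \<tturnstile> A" and b: "\<Gamma> \<turnstile> b \<doteq> b' \<tturnstile> A"
    and c: "\<Gamma> \<turnstile> c \<doteq> c' \<tturnstile> A" and q: "\<Gamma> \<turnstile> q \<doteq> q' \<tturnstile> Idt S A b c"
    and p: "\<Gamma> \<turnstile> p \<doteq> p' \<tturnstile> Idt S A a b"
  shows "\<Gamma> \<turnstile> Id_trans S A a b c q p \<doteq> Id_trans S A' a' b' c' q' p' \<tturnstile> Idt S A a c"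
proof -
  \<comment> \<open>The motive over \<open>x, y, q\<close> is
    \<open>\<Pi>(Id(a,x), Id(a,y))\<close>. \<open>?E\<close> is its domain, and \<open>?D\<close>
    is that domain restricted to the diagonal.\<close>
  let ?K = "Id_ctx S A \<Gamma>" and ?E = "Idt S (shift 3 A) (shift 3 a) (Var 2)"
    and ?D = "Idt S (shift 1 A) (shift 1 a) (Var 0)"
  have tA: "\<Gamma> \<turnstile> A Ty"
    using A by (rule eq_ty_left)
  have K: "ctx S ?K" and G: "ctx S \<Gamma>"
    using tA by (auto intro: Id_ctx_ctx dest: ty_ctx)
  have E: "?K \<turnstile> ?E \<doteq> Idt S (shift 3 A') (shift 3 a') (Var 2) Ty"
    by (intro Id_cong tm_refl Id_ctx_vars tA shift_eq_ty[OF A] shift_eq_tm[OF a] K Id_ctx_drop)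
  have EK: "ctx S (?E # ?K)"
    using K eq_ty_left[OF E] by simp
  \<comment> \<open>Below the additional variable of type \<open>?E\<close> the index 2 denotes
    \<open>y\<close>; inside \<open>?E\<close> the same index denotes \<open>x\<close>.\<close>
  have "?E # ?K \<turnstile> Var 2 \<tturnstile> shift 4 A"
    by (rule var'[OF EK]) (simp_all add: lookup_def Id_ctx_def norm)
  then have F: "?E # ?K \<turnstile> Idt S (shift 4 A) (shift 4 a) (Var 2) \<doteq> Idt S (shift 4 A') (shift 4 a') (Var 2) Ty"
    by (intro Id_cong tm_refl shift_eq_ty[OF A] shift_eq_tm[OF a] EK Id_ctx_drop)
  note C = Pt_cong[OF E F]
  have D: "A # \<Gamma> \<turnstile> ?D \<doteq> Idt S (shift 1 A') (shift 1 a') (Var 0) Ty"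
    by (intro Id_cong tm_refl head_var tA shift_eq_ty[OF A] shift_eq_tm[OF a]) simp_all
  have DG: "ctx S (?D # A # \<Gamma>)"
    using tA G eq_ty_left[OF D] by simp
  have v: "?D # A # \<Gamma> \<turnstile> Var 1 \<tturnstile> shift 2 A"
    "?D # A # \<Gamma> \<turnstile> Var 0 \<tturnstile> Idt S (shift 2 A) (shift 2 a) (Var 1)"
    by (rule var'[OF DG]; simp add: lookup_def norm)+
  have "?D # A # \<Gamma> \<turnstile> Idt S (shift 2 A) (shift 2 a) (Var 1) \<doteq> Idt S (shift 2 A') (shift 2 a') (Var 1) Ty"
    by (intro Id_cong tm_refl v shift_eq_ty[OF A] shift_eq_tm[OF a] DG) simp_all
  note d = lam_cong[OF D this tm_refl[OF v(2)]]
  have "\<Gamma> \<turnstile> J S A (Pt S ?E (Idt S (shift 4 A) (shift 4 a) (Var 2)))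
        (lam S ?D (Idt S (shift 2 A) (shift 2 a) (Var 1)) (Var 0)) b c q
      \<doteq> J S A' (Pt S (Idt S (shift 3 A') (shift 3 a') (Var 2)) (Idt S (shift 4 A') (shift 4 a') (Var 2)))
        (lam S (Idt S (shift 1 A') (shift 1 a') (Var 0)) (Idt S (shift 2 A') (shift 2 a') (Var 1)) (Var 0))
        b' c' q'
      \<tturnstile> inst3 b c q (Pt S ?E (Idt S (shift 4 A) (shift 4 a) (Var 2)))"
    by (rule J_cong[OF A C _ b c q]) (use d in \<open>simp add: rfl_subst_def norm\<close>)
  then have j: "\<Gamma> \<turnstile> J S A (Pt S ?E (Idt S (shift 4 A) (shift 4 a) (Var 2)))
        (lam S ?D (Idt S (shift 2 A) (shift 2 a) (Var 1)) (Var 0)) b c q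
      \<doteq> J S A' (Pt S (Idt S (shift 3 A') (shift 3 a') (Var 2)) (Idt S (shift 4 A') (shift 4 a') (Var 2)))
        (lam S (Idt S (shift 1 A') (shift 1 a') (Var 0)) (Idt S (shift 2 A') (shift 2 a') (Var 1)) (Var 0))
        b' c' q'
      \<tturnstile> Pt S (Idt S A a b) (shift 1 (Idt S A a c))"
    by (simp add: norm)
  have I: "\<Gamma> \<turnstile> Idt S A a b \<doteq> Idt S A' a' b' Ty" "\<Gamma> \<turnstile> Idt S A a c \<doteq> Idt S A' a' c' Ty"
    by (intro Id_cong A a b c)+
  have "ctx S (Idt S A a b # \<Gamma>)"
    using G eq_ty_left[OF I(1)] by simp
  then have "Idt S A a b # \<Gamma> \<turnstile> shift 1 (Idt S A a c) \<doteq> shift 1 (Idt S A' a' c') Ty"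
    by (rule shift_eq_ty[OF I(2)]) simp
  from app_at_cong[OF I(1) this j p] show ?thesis
    unfolding Id_trans_J by (simp add: norm)
qed

lemma Id_trans_tm:
  assumes "\<Gamma> \<turnstile> a \<tturnstile> A" "\<Gamma> \<turnstile> b \<tturnstile> A" "\<Gamma> \<turnstile> c \<tturnstile> A" "\<Gamma> \<turnstile> q \<tturnstile> Idt S A b c" "\<Gamma> \<turnstile> p \<tturnstile> Idt S A a b"
  shows "\<Gamma> \<turnstile> Id_trans S A a b c q p \<tturnstile> Idt S A a c"
  using Id_trans_cong[OF ty_refl[OF tm_ty[OF assms(1)]] assms[THEN tm_refl]] by (rule eq_tm_left)

lemma Id_ap_cong:
  assumes A: "\<Gamma> \<turnstile> A \<doteq> A' Ty" and B: "\<Gamma> \<turnstile> B \<doteq> B' Ty" and h: "A # \<Gamma> \<turnstile> h \<doteq> h' \<tturnstile> shift 1 B"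
    and a: "\<Gamma> \<turnstile> a \<doteq> a' \<tturnstile> A" and b: "\<Gamma> \<turnstile> b \<doteq> b' \<tturnstile> A" and p: "\<Gamma> \<turnstile> p \<doteq> p' \<tturnstile> Idt S A a b"
  shows "\<Gamma> \<turnstile> Id_ap S A B h a b p \<doteq> Id_ap S A' B' h' a' b' p' \<tturnstile> Idt S B (inst a h) (inst b h)"
proof -
  let ?K = "Id_ctx S A \<Gamma>"
  have tA: "\<Gamma> \<turnstile> A Ty"
    using A by (rule eq_ty_left)
  have K: "ctx S ?K" and G: "ctx S (A # \<Gamma>)"
    using tA by (auto intro: Id_ctx_ctx dest: ty_ctx)
  have h2: "?K \<turnstile> subst (Var 2 \<triangleright> drop_vars 3) h \<doteq> subst (Var 2 \<triangleright> drop_vars 3) h' \<tturnstile> shift 3 B"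
    using eq_tm_subst[OF Var_subst_mor[OF tA K Id_ctx_drop(1) Id_ctx_vars(2)[OF tA]] h]
    by (simp add: norm)
  have h1: "?K \<turnstile> subst (Var 1 \<triangleright> drop_vars 3) h \<doteq> subst (Var 1 \<triangleright> drop_vars 3) h' \<tturnstile> shift 3 B"
    using eq_tm_subst[OF Var_subst_mor[OF tA K Id_ctx_drop(1) Id_ctx_vars(3)[OF tA]] h]
    by (simp add: norm)
  note C = Id_cong[OF shift_eq_ty[OF B K Id_ctx_drop(1)] h2 h1]
  have "A # \<Gamma> \<turnstile> shift 1 B \<doteq> shift 1 B' Ty"
    by (rule shift_eq_ty[OF B G]) simp
  from rfl_cong[OF this h]
  have d: "A # \<Gamma> \<turnstile> rfl S (shift 1 B) h \<doteq> rfl S (shift 1 B') h' \<tturnstile> subst (rfl_subst S A)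
      (Idt S (shift 3 B) (subst (Var 2 \<triangleright> drop_vars 3) h) (subst (Var 1 \<triangleright> drop_vars 3) h))"
    by (simp add: rfl_subst_def norm)
  from J_cong[OF A C d a b p] show ?thesis
    unfolding Id_ap_J by (simp add: norm)
qed

lemma Id_ap_tm:
  assumes "\<Gamma> \<turnstile> B Ty" "A # \<Gamma> \<turnstile> h \<tturnstile> shift 1 B" "\<Gamma> \<turnstile> a \<tturnstile> A" "\<Gamma> \<turnstile> b \<tturnstile> A" "\<Gamma> \<turnstile> p \<tturnstile> Idt S A a b"
  shows "\<Gamma> \<turnstile> Id_ap S A B h a b p \<tturnstile> Idt S B (inst a h) (inst b h)"
  using Id_ap_cong[OF ty_refl[OF tm_ty[OF assms(3)]] ty_refl[OF assms(1)] assms(2-)[THEN tm_refl]]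
  by (rule eq_tm_left)

text \<open>Composition is defined by elimination on the later path, so this unit law is pure
  computation: at reflexivity the eliminator returns the identity function, and the beta rule
  applies it to \<open>p\<close>.\<close>

lemma Id_trans_rfl_left:
  assumes a: "\<Gamma> \<turnstile> a \<tturnstile> A" and b: "\<Gamma> \<turnstile> b \<tturnstile> A" and p: "\<Gamma> \<turnstile> p \<tturnstile> Idt S A a b"
  shows "\<Gamma> \<turnstile> Id_trans S A a b b (rfl S A b) p \<doteq> p \<tturnstile> Idt S A a b"
proof -
  let ?K = "Id_ctx S A \<Gamma>" and ?E = "Idt S (shift 3 A) (shift 3 a) (Var 2)"
    and ?D = "Idt S (shift 1 A) (shift 1 a) (Var 0)"
  have tA: "\<Gamma> \<turnstile> A Ty"
    using a by (rule tm_ty)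
  have K: "ctx S ?K" and G: "ctx S \<Gamma>"
    using tA by (auto intro: Id_ctx_ctx dest: ty_ctx)
  have E: "?K \<turnstile> ?E Ty"
    by (intro Id_form Id_ctx_vars tA shift_tm[OF a] K Id_ctx_drop)
  have EK: "ctx S (?E # ?K)"
    using K E by simp
  have "?E # ?K \<turnstile> Var 2 \<tturnstile> shift 4 A"
    by (rule var'[OF EK]) (simp_all add: lookup_def Id_ctx_def norm)
  then have F: "?E # ?K \<turnstile> Idt S (shift 4 A) (shift 4 a) (Var 2) Ty"
    by (intro Id_form shift_tm[OF a] EK Id_ctx_drop)
  note C = Pt_form[OF E F]
  have D: "A # \<Gamma> \<turnstile> ?D Ty"
    by (intro Id_form head_var tA shift_tm[OF a]) simp_all
  have DG: "ctx S (?D # A # \<Gamma>)"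
    using tA G D by simp
  have v: "?D # A # \<Gamma> \<turnstile> Var 0 \<tturnstile> Idt S (shift 2 A) (shift 2 a) (Var 1)"
    by (rule var'[OF DG]; simp add: lookup_def norm)+
  have d: "A # \<Gamma> \<turnstile> lam S ?D (Idt S (shift 2 A) (shift 2 a) (Var 1)) (Var 0)
      \<tturnstile> subst (rfl_subst S A) (Pt S ?E (Idt S (shift 4 A) (shift 4 a) (Var 2)))"
    using lam_intro[OF v] by (simp add: rfl_subst_def norm)
  have j: "\<Gamma> \<turnstile> J S A (Pt S ?E (Idt S (shift 4 A) (shift 4 a) (Var 2)))
        (lam S ?D (Idt S (shift 2 A) (shift 2 a) (Var 1)) (Var 0)) b b (rfl S A b)
      \<doteq> lam S (Idt S A a b) (shift 1 (Idt S A a b)) (Var 0)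
      \<tturnstile> Pt S (Idt S A a b) (shift 1 (Idt S A a b))"
    using J_rfl[OF C d b] by (simp add: norm)
  have I: "\<Gamma> \<turnstile> Idt S A a b Ty"
    using a b by (rule Id_form)
  have 1: "\<Gamma> \<turnstile> Id_trans S A a b b (rfl S A b) p
      \<doteq> app_at S (Idt S A a b) (shift 1 (Idt S A a b)) (lam S (Idt S A a b) (shift 1 (Idt S A a b)) (Var 0)) p
      \<tturnstile> Idt S A a b"
    using app_at_cong[OF ty_refl[OF I] ty_refl[OF tm_ty[OF head_var(2)[OF I]]] j tm_refl[OF p]]
    unfolding Id_trans_J by (simp add: norm)
  show ?thesis
    using app_at_lam[OF head_var(2)[OF I] p] by (intro tm_trans[OF 1]) (simp add: norm)
qed

lemma Id_ap_rfl:
  assumes B: "\<Gamma> \<turnstile> B Ty" and h: "A # \<Gamma> \<turnstile> h \<tturnstile> shift 1 B" and a: "\<Gamma> \<turnstile> a \<tturnstile> A"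
  shows "\<Gamma> \<turnstile> Id_ap S A B h a a (rfl S A a) \<doteq> rfl S B (inst a h) \<tturnstile> Idt S B (inst a h) (inst a h)"
proof -
  let ?K = "Id_ctx S A \<Gamma>"
  have tA: "\<Gamma> \<turnstile> A Ty"
    using a by (rule tm_ty)
  have K: "ctx S ?K"
    using tA by (rule Id_ctx_ctx)
  have h2: "?K \<turnstile> subst (Var 2 \<triangleright> drop_vars 3) h \<tturnstile> shift 3 B"
    using tm_subst[OF Var_subst_mor[OF tA K Id_ctx_drop(1) Id_ctx_vars(2)[OF tA]] h]
    by (simp add: norm)
  have h1: "?K \<turnstile> subst (Var 1 \<triangleright> drop_vars 3) h \<tturnstile> shift 3 B"
    using tm_subst[OF Var_subst_mor[OF tA K Id_ctx_drop(1) Id_ctx_vars(3)[OF tA]] h]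
    by (simp add: norm)
  have d: "A # \<Gamma> \<turnstile> rfl S (shift 1 B) h \<tturnstile> subst (rfl_subst S A)
      (Idt S (shift 3 B) (subst (Var 2 \<triangleright> drop_vars 3) h) (subst (Var 1 \<triangleright> drop_vars 3) h))"
    using rfl_intro[OF h] by (simp add: rfl_subst_def norm)
  from J_rfl[OF Id_form[OF h2 h1] d a] show ?thesis
    unfolding Id_ap_J by (simp add: norm)
qed

text \<open>Here the eliminated path is arbitrary and nothing computes. Path induction reduces the
  claim to the composite of two reflexivities, where the left unit law applies.\<close>

lemma Id_trans_rfl_right:
  assumes a: "\<Gamma> \<turnstile> a \<tturnstile> A" and b: "\<Gamma> \<turnstile> b \<tturnstile> A" and p: "\<Gamma> \<turnstile> p \<tturnstile> Idt S A a b"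
  shows "\<Gamma> \<turnstile> Id_trans S A a a b p (rfl S A a) \<doteq> p \<tturnstile> Idt S A a b"
proof -
  have A: "\<Gamma> \<turnstile> A Ty"
    using a by (rule tm_ty)
  note V = Id_ctx_vars[OF A] and v = head_var[OF A]
  \<comment> \<open>\<open>u\<close> is the composite for the generic path \<open>Var 0\<close> from
    \<open>Var 2\<close> to \<open>Var 1\<close>; \<open>Id_eqI\<close> compares it with that path
    itself.\<close>
  have u: "Id_ctx S A \<Gamma> \<turnstile> Id_trans S (shift 3 A) (Var 2) (Var 2) (Var 1) (Var 0) (rfl S (shift 3 A) (Var 2))
      \<tturnstile> Idt S (shift 3 A) (Var 2) (Var 1)"
    by (intro Id_trans_tm V rfl_intro)
  have uv: "A # \<Gamma> \<turnstile> Id_trans S (shift 1 A) (Var 0) (Var 0) (Var 0) (rfl S (shift 1 A) (Var 0))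
      (rfl S (shift 1 A) (Var 0)) \<doteq> rfl S (shift 1 A) (Var 0) \<tturnstile> Idt S (shift 1 A) (Var 0) (Var 0)"
    by (intro Id_trans_rfl_left rfl_intro v)
  show ?thesis
    using Id_eqI[OF u V(4) _ a b p] uv by (simp add: rfl_subst_def norm)
qed

lemma Id_ap_id:
  assumes a: "\<Gamma> \<turnstile> a \<tturnstile> A" and b: "\<Gamma> \<turnstile> b \<tturnstile> A" and p: "\<Gamma> \<turnstile> p \<tturnstile> Idt S A a b"
  shows "\<Gamma> \<turnstile> Id_ap S A A (Var 0) a b p \<doteq> p \<tturnstile> Idt S A a b"
proof -
  have A: "\<Gamma> \<turnstile> A Ty"
    using a by (rule tm_ty)
  note V = Id_ctx_vars[OF A] and v = head_var[OF A]
  have u: "Id_ctx S A \<Gamma> \<turnstile> Id_ap S (shift 3 A) (shift 3 A) (Var 0) (Var 2) (Var 1) (Var 0)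
      \<tturnstile> Idt S (shift 3 A) (Var 2) (Var 1)"
    using Id_ap_tm[OF V(1) head_var(2)[OF V(1)] V(2-4)] by (simp add: norm)
  have uv: "A # \<Gamma> \<turnstile> Id_ap S (shift 1 A) (shift 1 A) (Var 0) (Var 0) (Var 0) (rfl S (shift 1 A) (Var 0))
      \<doteq> rfl S (shift 1 A) (Var 0) \<tturnstile> Idt S (shift 1 A) (Var 0) (Var 0)"
    using Id_ap_rfl[OF v(1) head_var(2)[OF v(1)] v(2)] by (simp add: norm)
  show ?thesis
    using Id_eqI[OF u V(4) _ a b p] uv by (simp add: rfl_subst_def norm)
qed

lemma Var_subst_tm:
  assumes "A # \<Gamma> \<turnstile> h \<tturnstile> shift 1 B" "ctx S \<Delta>" "drop n \<Delta> = \<Gamma>" "\<Delta> \<turnstile> a \<tturnstile> shift n A"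
  shows "\<Delta> \<turnstile> subst (a \<triangleright> drop_vars n) h \<tturnstile> shift n B"
proof -
  have "\<Gamma> \<turnstile> A Ty"
    using ty_ctx[OF tm_ty[OF assms(1)]] by simp
  from tm_subst[OF Var_subst_mor[OF this assms(2-4)] assms(1)] show ?thesis
    by (simp add: norm)
qed

lemma shift_under_tm:
  assumes "A # \<Gamma> \<turnstile> h \<tturnstile> shift 1 B" "ctx S \<Delta>" "drop n \<Delta> = \<Gamma>"
  shows "shift n A # \<Delta> \<turnstile> shift_under n h \<tturnstile> shift 1 (shift n B)"
proof -
  have "\<Gamma> \<turnstile> A Ty"
    using ty_ctx[OF tm_ty[OF assms(1)]] by simp
  from tm_subst[OF shift_under_mor[OF this assms(2,3)] assms(1)] show ?thesis
    by (simp add: norm)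
qed

lemma shift_under_inst: "inst a (shift_under n h) = subst (a \<triangleright> drop_vars n) h"
  by (simp add: norm)

text \<open>In path inductions the map \<open>h\<close> comes from \<open>\<Gamma>\<close> while the
  path lives in an extension such as \<open>Id_ctx S A \<Gamma>\<close>. Hence \<open>h\<close> is
  weakened below its own variable, and its values are single substitutions into the original
  \<open>h\<close>.\<close>

lemma Id_ap_shift_under:
  assumes B: "\<Gamma> \<turnstile> B Ty" and h: "A # \<Gamma> \<turnstile> h \<tturnstile> shift 1 B" and D: "ctx S \<Delta>" "drop n \<Delta> = \<Gamma>"
    and a: "\<Delta> \<turnstile> a \<tturnstile> shift n A" and b: "\<Delta> \<turnstile> b \<tturnstile> shift n A" and p: "\<Delta> \<turnstile> p \<tturnstile> Idt S (shift n A) a b"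
  shows "\<Delta> \<turnstile> Id_ap S (shift n A) (shift n B) (shift_under n h) a b p
    \<tturnstile> Idt S (shift n B) (subst (a \<triangleright> drop_vars n) h) (subst (b \<triangleright> drop_vars n) h)"
  unfolding shift_under_inst[symmetric]
  by (intro Id_ap_tm shift_ty[OF B] shift_under_tm[OF h] D a b p)

lemma Id_ap_rfl_shift_under:
  assumes B: "\<Gamma> \<turnstile> B Ty" and h: "A # \<Gamma> \<turnstile> h \<tturnstile> shift 1 B" and D: "ctx S \<Delta>" "drop n \<Delta> = \<Gamma>"
    and a: "\<Delta> \<turnstile> a \<tturnstile> shift n A"
  shows "\<Delta> \<turnstile> Id_ap S (shift n A) (shift n B) (shift_under n h) a a (rfl S (shift n A) a)
    \<doteq> rfl S (shift n B) (subst (a \<triangleright> drop_vars n) h)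
    \<tturnstile> Idt S (shift n B) (subst (a \<triangleright> drop_vars n) h) (subst (a \<triangleright> drop_vars n) h)"
  unfolding shift_under_inst[symmetric]
  by (intro Id_ap_rfl shift_ty[OF B] shift_under_tm[OF h] D a)

text \<open>By path induction: over reflexivity both sides become the reflexivity of
  \<open>precomp g h\<close>, the left one by one computation, the right one by computing first
  inside and then outside, with \<open>Id_ap_cong\<close> in between.\<close>

lemma Id_ap_comp:
  assumes B: "\<Gamma> \<turnstile> B Ty" and C: "\<Gamma> \<turnstile> C Ty"
    and g: "A # \<Gamma> \<turnstile> g \<tturnstile> shift 1 B" and h: "B # \<Gamma> \<turnstile> h \<tturnstile> shift 1 C"
    and a: "\<Gamma> \<turnstile> a \<tturnstile> A" and b: "\<Gamma> \<turnstile> b \<tturnstile> A" and p: "\<Gamma> \<turnstile> p \<tturnstile> Idt S A a b"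
  shows "\<Gamma> \<turnstile> Id_ap S A C (precomp g h) a b p
      \<doteq> Id_ap S B C h (inst a g) (inst b g) (Id_ap S A B g a b p)
      \<tturnstile> Idt S C (inst a (precomp g h)) (inst b (precomp g h))"
proof -
  have A: "\<Gamma> \<turnstile> A Ty"
    using a by (rule tm_ty)
  note V = Id_ctx_vars[OF A] and v = head_var[OF A]
  note K = Id_ctx_ctx[OF A] Id_ctx_drop(1)
  have v1: "drop 1 (A # \<Gamma>) = \<Gamma>"
    by simp
  let ?g = "\<lambda>x. subst (x \<triangleright> drop_vars 3) g" and ?h = "\<lambda>x. subst (x \<triangleright> drop_vars 3) h"
  have gh: "A # \<Gamma> \<turnstile> precomp g h \<tturnstile> shift 1 C"
    by (rule Var_subst_tm[OF h v(3) v1 g])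
  have u: "Id_ctx S A \<Gamma> \<turnstile> Id_ap S (shift 3 A) (shift 3 C) (shift_under 3 (precomp g h)) (Var 2) (Var 1) (Var 0)
      \<tturnstile> Idt S (shift 3 C) (?h (?g (Var 2))) (?h (?g (Var 1)))"
    using Id_ap_shift_under[OF C gh K V(2-4)] by (simp add: norm)
  have w: "Id_ctx S A \<Gamma> \<turnstile> Id_ap S (shift 3 B) (shift 3 C) (shift_under 3 h) (?g (Var 2)) (?g (Var 1))
        (Id_ap S (shift 3 A) (shift 3 B) (shift_under 3 g) (Var 2) (Var 1) (Var 0))
      \<tturnstile> Idt S (shift 3 C) (?h (?g (Var 2))) (?h (?g (Var 1)))"
    by (intro Id_ap_shift_under[OF C h K] Var_subst_tm[OF g K] Id_ap_shift_under[OF B g K] V(2-4))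
  have 1: "A # \<Gamma> \<turnstile> Id_ap S (shift 1 A) (shift 1 C) (shift_under 1 (precomp g h)) (Var 0) (Var 0)
        (rfl S (shift 1 A) (Var 0))
      \<doteq> rfl S (shift 1 C) (precomp g h) \<tturnstile> Idt S (shift 1 C) (precomp g h) (precomp g h)"
    using Id_ap_rfl_shift_under[OF C gh v(3) v1 v(2)] by (simp add: norm)
  have 2: "A # \<Gamma> \<turnstile> Id_ap S (shift 1 A) (shift 1 B) (shift_under 1 g) (Var 0) (Var 0) (rfl S (shift 1 A) (Var 0))
      \<doteq> rfl S (shift 1 B) g \<tturnstile> Idt S (shift 1 B) g g"
    using Id_ap_rfl_shift_under[OF B g v(3) v1 v(2)] by (simp add: norm)
  have B1: "A # \<Gamma> \<turnstile> shift 1 B Ty" and C1: "A # \<Gamma> \<turnstile> shift 1 C Ty"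
    by (intro shift_ty[OF B v(3) v1] shift_ty[OF C v(3) v1])+
  have 3: "A # \<Gamma> \<turnstile> Id_ap S (shift 1 B) (shift 1 C) (shift_under 1 h) g g
        (Id_ap S (shift 1 A) (shift 1 B) (shift_under 1 g) (Var 0) (Var 0) (rfl S (shift 1 A) (Var 0)))
      \<doteq> rfl S (shift 1 C) (precomp g h) \<tturnstile> Idt S (shift 1 C) (precomp g h) (precomp g h)"
  proof (rule tm_trans)
    show "A # \<Gamma> \<turnstile> Id_ap S (shift 1 B) (shift 1 C) (shift_under 1 h) g g
        (Id_ap S (shift 1 A) (shift 1 B) (shift_under 1 g) (Var 0) (Var 0) (rfl S (shift 1 A) (Var 0)))
      \<doteq> Id_ap S (shift 1 B) (shift 1 C) (shift_under 1 h) g g (rfl S (shift 1 B) g)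
      \<tturnstile> Idt S (shift 1 C) (precomp g h) (precomp g h)"
      using Id_ap_cong[OF ty_refl[OF B1] ty_refl[OF C1] tm_refl[OF shift_under_tm[OF h v(3) v1]]
          tm_refl[OF g] tm_refl[OF g] 2]
      unfolding shift_under_inst .
    show "A # \<Gamma> \<turnstile> Id_ap S (shift 1 B) (shift 1 C) (shift_under 1 h) g g (rfl S (shift 1 B) g)
      \<doteq> rfl S (shift 1 C) (precomp g h) \<tturnstile> Idt S (shift 1 C) (precomp g h) (precomp g h)"
      by (rule Id_ap_rfl_shift_under[OF C h v(3) v1 g])
  qed
  show ?thesis
    using Id_eqI[OF u w _ a b p] tm_trans[OF 1 tm_sym[OF 3]] by (simp add: rfl_subst_def norm)
qed

text \<open>By path induction the naturality square degenerates: both actions on the path become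
  reflexivities, and the two unit laws leave \<open>\<beta>\<close> on either side.\<close>

lemma Id_ap_natural:
  assumes B: "\<Gamma> \<turnstile> B Ty" and h: "A # \<Gamma> \<turnstile> h \<tturnstile> shift 1 B" and k: "A # \<Gamma> \<turnstile> k \<tturnstile> shift 1 B"
    and \<beta>: "A # \<Gamma> \<turnstile> \<beta> \<tturnstile> Idt S (shift 1 B) h k"
    and a: "\<Gamma> \<turnstile> a \<tturnstile> A" and b: "\<Gamma> \<turnstile> b \<tturnstile> A" and p: "\<Gamma> \<turnstile> p \<tturnstile> Idt S A a b"
  shows "\<Gamma> \<turnstile> Id_trans S B (inst a h) (inst b h) (inst b k) (inst b \<beta>) (Id_ap S A B h a b p)
      \<doteq> Id_trans S B (inst a h) (inst a k) (inst b k) (Id_ap S A B k a b p) (inst a \<beta>)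
      \<tturnstile> Idt S B (inst a h) (inst b k)"
proof -
  have A: "\<Gamma> \<turnstile> A Ty"
    using a by (rule tm_ty)
  note V = Id_ctx_vars[OF A] and v = head_var[OF A]
  note K = Id_ctx_ctx[OF A] Id_ctx_drop(1)
  have v1: "drop 1 (A # \<Gamma>) = \<Gamma>"
    by simp
  let ?s = "\<lambda>x. subst (x \<triangleright> drop_vars 3)"
  have b': "Id_ctx S A \<Gamma> \<turnstile> ?s x \<beta> \<tturnstile> Idt S (shift 3 B) (?s x h) (?s x k)"
    if "Id_ctx S A \<Gamma> \<turnstile> x \<tturnstile> shift 3 A" for x
    using tm_subst[OF Var_subst_mor[OF A K that] \<beta>] by (simp add: norm)
  have u: "Id_ctx S A \<Gamma> \<turnstile> Id_trans S (shift 3 B) (?s (Var 2) h) (?s (Var 1) h) (?s (Var 1) k) (?s (Var 1) \<beta>)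
      (Id_ap S (shift 3 A) (shift 3 B) (shift_under 3 h) (Var 2) (Var 1) (Var 0))
      \<tturnstile> Idt S (shift 3 B) (?s (Var 2) h) (?s (Var 1) k)"
    by (intro Id_trans_tm Var_subst_tm[OF h K] Var_subst_tm[OF k K] Id_ap_shift_under[OF B h K] b' V)
  have w: "Id_ctx S A \<Gamma> \<turnstile> Id_trans S (shift 3 B) (?s (Var 2) h) (?s (Var 2) k) (?s (Var 1) k)
      (Id_ap S (shift 3 A) (shift 3 B) (shift_under 3 k) (Var 2) (Var 1) (Var 0)) (?s (Var 2) \<beta>)
      \<tturnstile> Idt S (shift 3 B) (?s (Var 2) h) (?s (Var 1) k)"
    by (intro Id_trans_tm Var_subst_tm[OF h K] Var_subst_tm[OF k K] Id_ap_shift_under[OF B k K] b' V)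
  have r: "A # \<Gamma> \<turnstile> Id_ap S (shift 1 A) (shift 1 B) (shift_under 1 l) (Var 0) (Var 0) (rfl S (shift 1 A) (Var 0))
      \<doteq> rfl S (shift 1 B) l \<tturnstile> Idt S (shift 1 B) l l" if "A # \<Gamma> \<turnstile> l \<tturnstile> shift 1 B" for l
    using Id_ap_rfl_shift_under[OF B that v(3) v1 v(2)] by (simp add: norm)
  have B1: "A # \<Gamma> \<turnstile> shift 1 B \<doteq> shift 1 B Ty"
    by (intro ty_refl shift_ty[OF B v(3) v1])
  note hh = tm_refl[OF h] and kk = tm_refl[OF k] and bb = tm_refl[OF \<beta>]
  have 1: "A # \<Gamma> \<turnstile> Id_trans S (shift 1 B) h h k \<beta>
        (Id_ap S (shift 1 A) (shift 1 B) (shift_under 1 h) (Var 0) (Var 0) (rfl S (shift 1 A) (Var 0)))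
      \<doteq> \<beta> \<tturnstile> Idt S (shift 1 B) h k"
    by (rule tm_trans[OF Id_trans_cong[OF B1 hh hh kk bb r[OF h]] Id_trans_rfl_right[OF h k \<beta>]])
  have 2: "A # \<Gamma> \<turnstile> Id_trans S (shift 1 B) h k k
        (Id_ap S (shift 1 A) (shift 1 B) (shift_under 1 k) (Var 0) (Var 0) (rfl S (shift 1 A) (Var 0))) \<beta>
      \<doteq> \<beta> \<tturnstile> Idt S (shift 1 B) h k"
    by (rule tm_trans[OF Id_trans_cong[OF B1 hh kk kk r[OF k] bb] Id_trans_rfl_left[OF h k \<beta>]])
  show ?thesis
    using Id_eqI[OF u w _ a b p] tm_trans[OF 1 tm_sym[OF 2]] by (simp add: rfl_subst_def norm)
qed

text \<open>The telescopes for laws about two consecutive paths. \<open>M\<close> adds to a generic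
  \<open>q : Id(y,z)\<close> a path from the fixed point \<open>x\<close> to \<open>y\<close>; its
  target must vary with the source of \<open>q\<close> for \<open>q\<close> to be eliminable.
  \<open>N\<close> is what remains of \<open>M\<close> over reflexivity.\<close>

lemma based_path_vars:
  assumes x: "\<Gamma> \<turnstile> x \<tturnstile> A"
  defines "M \<equiv> Idt S (shift 3 A) (shift 3 x) (Var 2) # Id_ctx S A \<Gamma>"
    and "N \<equiv> Idt S (shift 1 A) (shift 1 x) (Var 0) # A # \<Gamma>"
  shows "ctx S M" "drop 4 M = \<Gamma>" "M \<turnstile> Var 3 \<tturnstile> shift 4 A" "M \<turnstile> Var 2 \<tturnstile> shift 4 A"
    "M \<turnstile> Var 1 \<tturnstile> Idt S (shift 4 A) (Var 3) (Var 2)"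
    "M \<turnstile> Var 0 \<tturnstile> Idt S (shift 4 A) (shift 4 x) (Var 3)"
    and "ctx S N" "drop 2 N = \<Gamma>" "N \<turnstile> Var 1 \<tturnstile> shift 2 A"
    "N \<turnstile> Var 0 \<tturnstile> Idt S (shift 2 A) (shift 2 x) (Var 1)"
proof -
  have A: "\<Gamma> \<turnstile> A Ty"
    using x by (rule tm_ty)
  have "Id_ctx S A \<Gamma> \<turnstile> Idt S (shift 3 A) (shift 3 x) (Var 2) Ty"
    by (intro Id_form Id_ctx_vars A shift_tm[OF x] Id_ctx_ctx Id_ctx_drop)
  then show M: "ctx S M"
    using Id_ctx_ctx[OF A] by (simp add: M_def)
  show "drop 4 M = \<Gamma>"
    by (simp add: M_def Id_ctx_def)
  show "M \<turnstile> Var 3 \<tturnstile> shift 4 A" "M \<turnstile> Var 2 \<tturnstile> shift 4 A"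
    "M \<turnstile> Var 1 \<tturnstile> Idt S (shift 4 A) (Var 3) (Var 2)"
    "M \<turnstile> Var 0 \<tturnstile> Idt S (shift 4 A) (shift 4 x) (Var 3)"
    by (rule var'[OF M]; simp add: M_def Id_ctx_def lookup_def norm)+
  have "A # \<Gamma> \<turnstile> Idt S (shift 1 A) (shift 1 x) (Var 0) Ty"
    by (intro Id_form head_var A shift_tm[OF x]) simp_all
  then show N: "ctx S N"
    using A ty_ctx by (auto simp: N_def)
  show "drop 2 N = \<Gamma>"
    by (simp add: N_def)
  show "N \<turnstile> Var 1 \<tturnstile> shift 2 A" "N \<turnstile> Var 0 \<tturnstile> Idt S (shift 2 A) (shift 2 x) (Var 1)"
    by (rule var'[OF N]; simp add: N_def lookup_def norm)+
qed

text \<open>Elimination is on the last path \<open>r\<close>, the factor on which composition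
  computes. The source of \<open>r\<close> is the target of \<open>q\<close>, so \<open>q\<close> is
  generalised along with it, while \<open>p\<close> is merely weakened.\<close>

lemma Id_trans_assoc:
  assumes a: "\<Gamma> \<turnstile> a \<tturnstile> A" and b: "\<Gamma> \<turnstile> b \<tturnstile> A" and c: "\<Gamma> \<turnstile> c \<tturnstile> A" and d: "\<Gamma> \<turnstile> d \<tturnstile> A"
    and p: "\<Gamma> \<turnstile> p \<tturnstile> Idt S A a b" and q: "\<Gamma> \<turnstile> q \<tturnstile> Idt S A b c" and r: "\<Gamma> \<turnstile> r \<tturnstile> Idt S A c d"
  shows "\<Gamma> \<turnstile> Id_trans S A a c d r (Id_trans S A a b c q p) \<doteq> Id_trans S A a b d (Id_trans S A b c d r q) p
    \<tturnstile> Idt S A a d"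
proof -
  let ?M = "Idt S (shift 3 A) (shift 3 b) (Var 2) # Id_ctx S A \<Gamma>"
    and ?N = "Idt S (shift 1 A) (shift 1 b) (Var 0) # A # \<Gamma>"
  note M = based_path_vars(1-6)[OF b] and N = based_path_vars(7-10)[OF b]
  have p4: "?M \<turnstile> shift 4 p \<tturnstile> Idt S (shift 4 A) (shift 4 a) (shift 4 b)"
    using shift_tm[OF p M(1,2)] by (simp add: norm)
  have p2: "?N \<turnstile> shift 2 p \<tturnstile> Idt S (shift 2 A) (shift 2 a) (shift 2 b)"
    using shift_tm[OF p N(1,2)] by (simp add: norm)
  note a4 = shift_tm[OF a M(1,2)] and b4 = shift_tm[OF b M(1,2)]
  note a2 = shift_tm[OF a N(1,2)] and b2 = shift_tm[OF b N(1,2)]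
  note A2 = ty_refl[OF tm_ty[OF a2]]
  have u: "?M \<turnstile> Id_trans S (shift 4 A) (shift 4 a) (Var 3) (Var 2) (Var 1)
        (Id_trans S (shift 4 A) (shift 4 a) (shift 4 b) (Var 3) (Var 0) (shift 4 p))
      \<tturnstile> Idt S (shift 4 A) (shift 4 a) (Var 2)"
    by (intro Id_trans_tm a4 b4 M p4)
  have w: "?M \<turnstile> Id_trans S (shift 4 A) (shift 4 a) (shift 4 b) (Var 2)
        (Id_trans S (shift 4 A) (shift 4 b) (Var 3) (Var 2) (Var 1) (Var 0)) (shift 4 p)
      \<tturnstile> Idt S (shift 4 A) (shift 4 a) (Var 2)"
    by (intro Id_trans_tm a4 b4 M p4)
  \<comment> \<open>Over reflexivity of \<open>r\<close> both bracketings reduce to the composite of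
    \<open>q\<close> and \<open>p\<close>: one by the unit law for the outer composition, the other
    by the unit law inside it.\<close>
  note qp = Id_trans_tm[OF a2 b2 N(3) N(4) p2]
  note 1 = Id_trans_rfl_left[OF a2 N(3) qp]
  note 2 = Id_trans_cong[OF A2 a2[THEN tm_refl] b2[THEN tm_refl] N(3)[THEN tm_refl]
      Id_trans_rfl_left[OF b2 N(3,4)] p2[THEN tm_refl]]
  show ?thesis
    using Id_eqI_extended[OF u w _ c d r, of q] q tm_trans[OF 1 tm_sym[OF 2]]
    by (simp add: rfl_subst_def norm)
qed

text \<open>Elimination is on \<open>q\<close>, with \<open>p\<close> generalised because its target
  moves. Over reflexivity both sides reduce to the action of \<open>h\<close> on \<open>p\<close>:
  the left by the unit law under \<open>Id_ap\<close>, the right by computing \<open>Id_ap\<close>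
  on reflexivity and then using the unit law.\<close>

lemma Id_ap_trans:
  assumes B: "\<Gamma> \<turnstile> B Ty" and h: "A # \<Gamma> \<turnstile> h \<tturnstile> shift 1 B"
    and a: "\<Gamma> \<turnstile> a \<tturnstile> A" and b: "\<Gamma> \<turnstile> b \<tturnstile> A" and c: "\<Gamma> \<turnstile> c \<tturnstile> A"
    and p: "\<Gamma> \<turnstile> p \<tturnstile> Idt S A a b" and q: "\<Gamma> \<turnstile> q \<tturnstile> Idt S A b c"
  shows "\<Gamma> \<turnstile> Id_ap S A B h a c (Id_trans S A a b c q p)
    \<doteq> Id_trans S B (inst a h) (inst b h) (inst c h) (Id_ap S A B h b c q) (Id_ap S A B h a b p)
    \<tturnstile> Idt S B (inst a h) (inst c h)"
proof -
  let ?M = "Idt S (shift 3 A) (shift 3 a) (Var 2) # Id_ctx S A \<Gamma>"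
    and ?N = "Idt S (shift 1 A) (shift 1 a) (Var 0) # A # \<Gamma>"
  note M = based_path_vars(1-6)[OF a] and N = based_path_vars(7-10)[OF a]
  let ?s = "\<lambda>x. subst (x \<triangleright> drop_vars 4) h" and ?t = "\<lambda>x. subst (x \<triangleright> drop_vars 2) h"
  let ?ap4 = "Id_ap S (shift 4 A) (shift 4 B) (shift_under 4 h)"
    and ?ap2 = "Id_ap S (shift 2 A) (shift 2 B) (shift_under 2 h)"
  note a4 = shift_tm[OF a M(1,2)] and a2 = shift_tm[OF a N(1,2)]
  note ht = Var_subst_tm[OF h N(1,2)] and ap2 = Id_ap_shift_under[OF B h N(1,2)]
  have A2: "?N \<turnstile> shift 2 A \<doteq> shift 2 A Ty" and B2: "?N \<turnstile> shift 2 B \<doteq> shift 2 B Ty"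
    using ty_refl[OF tm_ty[OF a2]] ty_refl[OF shift_ty[OF B N(1,2)]] .
  have u: "?M \<turnstile> ?ap4 (shift 4 a) (Var 2) (Id_trans S (shift 4 A) (shift 4 a) (Var 3) (Var 2) (Var 1) (Var 0))
      \<tturnstile> Idt S (shift 4 B) (?s (shift 4 a)) (?s (Var 2))"
    by (intro Id_ap_shift_under[OF B h M(1,2)] Id_trans_tm a4 M)
  have w: "?M \<turnstile> Id_trans S (shift 4 B) (?s (shift 4 a)) (?s (Var 3)) (?s (Var 2))
      (?ap4 (Var 3) (Var 2) (Var 1)) (?ap4 (shift 4 a) (Var 3) (Var 0))
      \<tturnstile> Idt S (shift 4 B) (?s (shift 4 a)) (?s (Var 2))"
    by (intro Id_ap_shift_under[OF B h M(1,2)] Id_trans_tm Var_subst_tm[OF h M(1,2)] a4 M)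
  have 1: "?N \<turnstile> ?ap2 (shift 2 a) (Var 1) (Id_trans S (shift 2 A) (shift 2 a) (Var 1) (Var 1)
        (rfl S (shift 2 A) (Var 1)) (Var 0))
      \<doteq> ?ap2 (shift 2 a) (Var 1) (Var 0) \<tturnstile> Idt S (shift 2 B) (?t (shift 2 a)) (?t (Var 1))"
    using Id_ap_cong[OF A2 B2 tm_refl[OF shift_under_tm[OF h N(1,2)]] a2[THEN tm_refl] N(3)[THEN tm_refl]
        Id_trans_rfl_left[OF a2 N(3,4)]]
    unfolding shift_under_inst .
  have 2: "?N \<turnstile> Id_trans S (shift 2 B) (?t (shift 2 a)) (?t (Var 1)) (?t (Var 1))
      (?ap2 (Var 1) (Var 1) (rfl S (shift 2 A) (Var 1))) (?ap2 (shift 2 a) (Var 1) (Var 0))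
      \<doteq> ?ap2 (shift 2 a) (Var 1) (Var 0) \<tturnstile> Idt S (shift 2 B) (?t (shift 2 a)) (?t (Var 1))"
    by (rule tm_trans[OF Id_trans_cong[OF B2 ht[OF a2, THEN tm_refl] ht[OF N(3), THEN tm_refl]
            ht[OF N(3), THEN tm_refl] Id_ap_rfl_shift_under[OF B h N(1-3)] ap2[OF a2 N(3,4), THEN tm_refl]]
          Id_trans_rfl_left[OF ht[OF a2] ht[OF N(3)] ap2[OF a2 N(3,4)]]])
  show ?thesis
    using Id_eqI_extended[OF u w _ b c q, of p] p tm_trans[OF 1 tm_sym[OF 2]]
    by (simp add: rfl_subst_def norm)
qed

end

section \<open>The 2-category of types\<close>

text \<open>With the types fixed, the sets of cells turn out to be images of these sets of
  expressions, and quantifying over cells becomes quantifying over expressions.\<close>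

definition tys :: "('s, 'z) ml2_scheme \<Rightarrow> 's ctxt \<Rightarrow> 's expr set" where
  "tys S \<Gamma> = {A. \<Gamma> \<turnstile>\<^bsub>S\<^esub> A Ty}"

definition tms :: "('s, 'z) ml2_scheme \<Rightarrow> 's ctxt \<Rightarrow> 's expr \<Rightarrow> 's expr \<Rightarrow> 's expr set" where
  "tms S \<Gamma> A B = {f. A # \<Gamma> \<turnstile>\<^bsub>S\<^esub> f \<tturnstile> shift 1 B}"

definition ids :: "('s, 'z) ml2_scheme \<Rightarrow> 's ctxt \<Rightarrow> 's expr \<Rightarrow> 's expr \<Rightarrow> 's expr \<Rightarrow> 's expr \<Rightarrow>
    's expr set" where
  "ids S \<Gamma> A B f g = {\<alpha>. A # \<Gamma> \<turnstile>\<^bsub>S\<^esub> \<alpha> \<tturnstile> Idt S (shift 1 B) f g}"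

text \<open>Operations on classes are unions over all representatives. Such a union is the intended
  class if all its members coincide and there is at least one; over no representatives it would be
  the empty set.\<close>

lemma Union_const: "c \<in> X \<Longrightarrow> (\<And>y. y \<in> X \<Longrightarrow> y = c) \<Longrightarrow> \<Union>X = c"
  by blast

lemma UN_const: "x \<in> X \<Longrightarrow> (\<And>y. y \<in> X \<Longrightarrow> k y = c) \<Longrightarrow> (\<Union>y\<in>X. k y) = c"
  by blast

context ML2
begin

section \<open>Equality of classes\<close>

lemma ty_class_eqI:
  assumes "\<Gamma> \<turnstile> A \<doteq> A' Ty"
  shows "ty_class S \<Gamma> A' = ty_class S \<Gamma> A"
  unfolding ty_class_def using ty_trans[OF assms] ty_trans[OF ty_sym[OF assms]]
  by (intro Collect_cong iffI)

lemma shift_1_eq: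
  assumes "\<Gamma> \<turnstile> A Ty" "\<Gamma> \<turnstile> B \<doteq> B' Ty"
  shows "A # \<Gamma> \<turnstile> shift 1 B \<doteq> shift 1 B' Ty"
  by (rule shift_eq_ty[OF assms(2) head_var(3)[OF assms(1)]]) simp

text \<open>The two classes compare terms in different contexts, \<open>A # \<Gamma>\<close> and
  \<open>A' # \<Gamma>\<close>, so transitivity becomes available only after conversion of context
  and type. The reverse inclusion is the same statement for the symmetric equalities.\<close>

lemma tm_class_sub:
  assumes A: "\<Gamma> \<turnstile> A \<doteq> A' Ty" and B: "\<Gamma> \<turnstile> B \<doteq> B' Ty" and f: "A # \<Gamma> \<turnstile> f \<doteq> f' \<tturnstile> shift 1 B"
  shows "tm_class S \<Gamma> A' B' f' \<subseteq> tm_class S \<Gamma> A B f"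
proof clarify
  fix A2 B2 f2 assume "(A2, B2, f2) \<in> tm_class S \<Gamma> A' B' f'"
  then have 2: "\<Gamma> \<turnstile> A' \<doteq> A2 Ty" "\<Gamma> \<turnstile> B' \<doteq> B2 Ty" "A' # \<Gamma> \<turnstile> f' \<doteq> f2 \<tturnstile> shift 1 B'"
    by (simp_all add: tm_class_def)
  have "A # \<Gamma> \<turnstile> f' \<doteq> f2 \<tturnstile> shift 1 B"
    by (rule eq_tm_conv[OF eq_tm_ctx_conv[OF ty_sym[OF A] 2(3)] shift_1_eq[OF eq_ty_left[OF A] ty_sym[OF B]]])
  then show "(A2, B2, f2) \<in> tm_class S \<Gamma> A B f"
    using ty_trans[OF A 2(1)] ty_trans[OF B 2(2)] tm_trans[OF f] by (simp add: tm_class_def)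
qed

lemma tm_class_sym:
  assumes A: "\<Gamma> \<turnstile> A \<doteq> A' Ty" and B: "\<Gamma> \<turnstile> B \<doteq> B' Ty" and f: "A # \<Gamma> \<turnstile> f \<doteq> f' \<tturnstile> shift 1 B"
  shows "A' # \<Gamma> \<turnstile> f' \<doteq> f \<tturnstile> shift 1 B'"
  by (rule eq_tm_conv[OF eq_tm_ctx_conv[OF A tm_sym[OF f]] shift_1_eq[OF eq_ty_right[OF A] B]])

lemma tm_class_eqI:
  assumes A: "\<Gamma> \<turnstile> A \<doteq> A' Ty" and B: "\<Gamma> \<turnstile> B \<doteq> B' Ty" and f: "A # \<Gamma> \<turnstile> f \<doteq> f' \<tturnstile> shift 1 B"
  shows "tm_class S \<Gamma> A' B' f' = tm_class S \<Gamma> A B f"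
  by (rule subset_antisym[OF tm_class_sub[OF A B f]
        tm_class_sub[OF ty_sym[OF A] ty_sym[OF B] tm_class_sym[OF A B f]]])

lemma Id_shift_eq:
  assumes A: "\<Gamma> \<turnstile> A Ty" and B: "\<Gamma> \<turnstile> B \<doteq> B' Ty" and f: "A # \<Gamma> \<turnstile> f \<doteq> f' \<tturnstile> shift 1 B"
    and g: "A # \<Gamma> \<turnstile> g \<doteq> g' \<tturnstile> shift 1 B"
  shows "A # \<Gamma> \<turnstile> Idt S (shift 1 B) f g \<doteq> Idt S (shift 1 B') f' g' Ty"
  by (intro Id_cong shift_1_eq A B f g)

lemma id_class_sub:
  assumes A: "\<Gamma> \<turnstile> A \<doteq> A' Ty" and B: "\<Gamma> \<turnstile> B \<doteq> B' Ty" and f: "A # \<Gamma> \<turnstile> f \<doteq> f' \<tturnstile> shift 1 B"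
    and g: "A # \<Gamma> \<turnstile> g \<doteq> g' \<tturnstile> shift 1 B" and \<alpha>: "A # \<Gamma> \<turnstile> \<alpha> \<doteq> \<alpha>' \<tturnstile> Idt S (shift 1 B) f g"
  shows "id_class S \<Gamma> A' B' f' g' \<alpha>' \<subseteq> id_class S \<Gamma> A B f g \<alpha>"
proof clarify
  fix A2 B2 f2 g2 \<alpha>2 assume "(A2, B2, f2, g2, \<alpha>2) \<in> id_class S \<Gamma> A' B' f' g' \<alpha>'"
  then have 2: "(A2, B2, f2) \<in> tm_class S \<Gamma> A' B' f'" "(A2, B2, g2) \<in> tm_class S \<Gamma> A' B' g'"
    "A' # \<Gamma> \<turnstile> \<alpha>' \<doteq> \<alpha>2 \<tturnstile> Idt S (shift 1 B') f' g'"
    by (simp_all add: tm_class_def id_class_def)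
  have "A # \<Gamma> \<turnstile> \<alpha>' \<doteq> \<alpha>2 \<tturnstile> Idt S (shift 1 B) f g"
    by (rule eq_tm_conv[OF eq_tm_ctx_conv[OF ty_sym[OF A] 2(3)] ty_sym[OF Id_shift_eq[OF eq_ty_left[OF A] B f g]]])
  then show "(A2, B2, f2, g2, \<alpha>2) \<in> id_class S \<Gamma> A B f g \<alpha>"
    using 2(1,2) tm_class_sub[OF A B f] tm_class_sub[OF A B g] tm_trans[OF \<alpha>]
    by (auto simp: tm_class_def id_class_def)
qed

lemma id_class_sym:
  assumes A: "\<Gamma> \<turnstile> A \<doteq> A' Ty" and B: "\<Gamma> \<turnstile> B \<doteq> B' Ty" and f: "A # \<Gamma> \<turnstile> f \<doteq> f' \<tturnstile> shift 1 B"
    and g: "A # \<Gamma> \<turnstile> g \<doteq> g' \<tturnstile> shift 1 B" and \<alpha>: "A # \<Gamma> \<turnstile> \<alpha> \<doteq> \<alpha>' \<tturnstile> Idt S (shift 1 B) f g"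
  shows "A' # \<Gamma> \<turnstile> \<alpha>' \<doteq> \<alpha> \<tturnstile> Idt S (shift 1 B') f' g'"
  by (rule eq_tm_ctx_conv[OF A eq_tm_conv[OF tm_sym[OF \<alpha>] Id_shift_eq[OF eq_ty_left[OF A] B f g]]])

lemma id_class_eqI:
  assumes A: "\<Gamma> \<turnstile> A \<doteq> A' Ty" and B: "\<Gamma> \<turnstile> B \<doteq> B' Ty" and f: "A # \<Gamma> \<turnstile> f \<doteq> f' \<tturnstile> shift 1 B"
    and g: "A # \<Gamma> \<turnstile> g \<doteq> g' \<tturnstile> shift 1 B" and \<alpha>: "A # \<Gamma> \<turnstile> \<alpha> \<doteq> \<alpha>' \<tturnstile> Idt S (shift 1 B) f g"
  shows "id_class S \<Gamma> A' B' f' g' \<alpha>' = id_class S \<Gamma> A B f g \<alpha>"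
  by (rule subset_antisym[OF id_class_sub[OF assms] id_class_sub[OF ty_sym[OF A] ty_sym[OF B]
        tm_class_sym[OF A B f] tm_class_sym[OF A B g] id_class_sym[OF assms]]])

lemma tm_class_refl: "A \<in> tys S \<Gamma> \<Longrightarrow> B \<in> tys S \<Gamma> \<Longrightarrow> f \<in> tms S \<Gamma> A B \<Longrightarrow>
    (A, B, f) \<in> tm_class S \<Gamma> A B f"
  by (simp add: tys_def tms_def tm_class_def ty_refl tm_refl)

lemma id_class_refl: "A \<in> tys S \<Gamma> \<Longrightarrow> B \<in> tys S \<Gamma> \<Longrightarrow> f \<in> tms S \<Gamma> A B \<Longrightarrow> g \<in> tms S \<Gamma> A B \<Longrightarrow>
    \<alpha> \<in> ids S \<Gamma> A B f g \<Longrightarrow> (A, B, f, g, \<alpha>) \<in> id_class S \<Gamma> A B f g \<alpha>"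
  by (simp add: tys_def tms_def ids_def id_class_def ty_refl tm_refl)

text \<open>The right-hand class contains its own representative, and membership of it in the
  left-hand class states all three equalities. Thus a 2-cell determines its endpoints and, up to
  definitional equality, its proof term.\<close>

lemma id_class_inject:
  assumes "A \<in> tys S \<Gamma>" "B \<in> tys S \<Gamma>" "f' \<in> tms S \<Gamma> A B" "g' \<in> tms S \<Gamma> A B" "\<alpha>' \<in> ids S \<Gamma> A B f' g'"
    "id_class S \<Gamma> A B f g \<alpha> = id_class S \<Gamma> A B f' g' \<alpha>'"
  shows "A # \<Gamma> \<turnstile> f \<doteq> f' \<tturnstile> shift 1 B" "A # \<Gamma> \<turnstile> g \<doteq> g' \<tturnstile> shift 1 B"
    "A # \<Gamma> \<turnstile> \<alpha> \<doteq> \<alpha>' \<tturnstile> Idt S (shift 1 B) f g"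
  using id_class_refl[OF assms(1-5)] unfolding assms(6)[symmetric] by (simp_all add: id_class_def)

lemma precomp_mor_eq:
  assumes "A # \<Gamma> \<turnstile> f \<doteq> f' \<tturnstile> shift 1 B" "\<Gamma> \<turnstile> B Ty"
  shows "ctx_mor_eq S (A # \<Gamma>) (f \<triangleright> drop_vars 1) (f' \<triangleright> drop_vars 1) (B # \<Gamma>)"
  by (intro ctx_mor_eq_extend ctx_mor_eq_refl ctx_mor_drop assms)
    (use ty_ctx[OF tm_ty[OF eq_tm_left[OF assms(1)]]] in simp_all)

lemma precomp_cong:
  assumes "A # \<Gamma> \<turnstile> f \<doteq> f' \<tturnstile> shift 1 B" "\<Gamma> \<turnstile> B Ty" "B # \<Gamma> \<turnstile> g \<doteq> g' \<tturnstile> shift 1 C"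
  shows "A # \<Gamma> \<turnstile> precomp f g \<doteq> precomp f' g' \<tturnstile> shift 1 C"
  using eq_tm_subst_cong[OF precomp_mor_eq[OF assms(1,2)] assms(3)] by (simp add: norm)

lemma precomp_id_cong:
  assumes "A # \<Gamma> \<turnstile> f \<doteq> f' \<tturnstile> shift 1 B" "\<Gamma> \<turnstile> B Ty" "B # \<Gamma> \<turnstile> \<alpha> \<doteq> \<alpha>' \<tturnstile> Idt S (shift 1 C) g k"
  shows "A # \<Gamma> \<turnstile> precomp f \<alpha> \<doteq> precomp f' \<alpha>' \<tturnstile> Idt S (shift 1 C) (precomp f g) (precomp f k)"
  using eq_tm_subst_cong[OF precomp_mor_eq[OF assms(1,2)] assms(3)] by (simp add: norm)

text \<open>Left whiskering applies \<open>h\<close> to a path that lives over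
  \<open>A # \<Gamma>\<close>, which is why \<open>h\<close> appears weakened below its own
  variable.\<close>

lemma whisker_cong:
  assumes A: "\<Gamma> \<turnstile> A Ty" and B: "\<Gamma> \<turnstile> B \<doteq> B' Ty" and C: "\<Gamma> \<turnstile> C \<doteq> C' Ty"
    and f: "A # \<Gamma> \<turnstile> f \<doteq> f' \<tturnstile> shift 1 B" and g: "A # \<Gamma> \<turnstile> g \<doteq> g' \<tturnstile> shift 1 B"
    and \<alpha>: "A # \<Gamma> \<turnstile> \<alpha> \<doteq> \<alpha>' \<tturnstile> Idt S (shift 1 B) f g" and h: "B # \<Gamma> \<turnstile> h \<doteq> h' \<tturnstile> shift 1 C"
  shows "A # \<Gamma> \<turnstile> Id_ap S (shift 1 B) (shift 1 C) (shift_under 1 h) f g \<alpha>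
    \<doteq> Id_ap S (shift 1 B') (shift 1 C') (shift_under 1 h') f' g' \<alpha>'
    \<tturnstile> Idt S (shift 1 C) (precomp f h) (precomp g h)"
proof -
  have "shift 1 B # A # \<Gamma> \<turnstile> shift_under 1 h \<doteq> shift_under 1 h' \<tturnstile> shift 1 (shift 1 C)"
    using eq_tm_subst[OF shift_under_mor[OF eq_ty_left[OF B] head_var(3)[OF A], of 1] h] by (simp add: norm)
  from Id_ap_cong[OF shift_1_eq[OF A B] shift_1_eq[OF A C] this f g \<alpha>] show ?thesis
    unfolding shift_under_inst .
qed

section \<open>Cells and operations on representatives\<close>

lemma HomCat_types: "HomCat (types_two_category S \<Gamma>) = types_homcat S \<Gamma>"
  by (simp add: types_two_category_def)

lemma Ob_types: "Ob (types_two_category S \<Gamma>) = ty_class S \<Gamma> ` tys S \<Gamma>"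
  by (auto simp: types_two_category_def tys_def)

text \<open>A 1-cell presented over other representatives \<open>A'\<close>, \<open>B'\<close> is
  given over \<open>A\<close>, \<open>B\<close> by the same raw term, thanks to context
  conversion.\<close>

lemma Obj_types:
  assumes "A \<in> tys S \<Gamma>" "B \<in> tys S \<Gamma>"
  shows "Obj (types_homcat S \<Gamma> (ty_class S \<Gamma> A) (ty_class S \<Gamma> B)) = tm_class S \<Gamma> A B ` tms S \<Gamma> A B"
proof
  show "tm_class S \<Gamma> A B ` tms S \<Gamma> A B \<subseteq> Obj (types_homcat S \<Gamma> (ty_class S \<Gamma> A) (ty_class S \<Gamma> B))"
    using assms by (auto simp: types_homcat_def tms_def tys_def ty_class_def intro: ty_refl)
  show "Obj (types_homcat S \<Gamma> (ty_class S \<Gamma> A) (ty_class S \<Gamma> B)) \<subseteq> tm_class S \<Gamma> A B ` tms S \<Gamma> A B"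
  proof
    fix F assume "F \<in> Obj (types_homcat S \<Gamma> (ty_class S \<Gamma> A) (ty_class S \<Gamma> B))"
    then obtain A' B' f where F: "F = tm_class S \<Gamma> A' B' f" and A: "\<Gamma> \<turnstile> A \<doteq> A' Ty"
      and B: "\<Gamma> \<turnstile> B \<doteq> B' Ty" and f: "A' # \<Gamma> \<turnstile> f \<tturnstile> shift 1 B'"
      by (auto simp: types_homcat_def ty_class_def)
    have f': "A # \<Gamma> \<turnstile> f \<doteq> f \<tturnstile> shift 1 B"
      by (rule tm_class_sym[OF ty_sym[OF A] ty_sym[OF B] tm_refl[OF f]])
    then have "f \<in> tms S \<Gamma> A B"
      unfolding tms_def by (blast dest: eq_tm_left)
    then show "F \<in> tm_class S \<Gamma> A B ` tms S \<Gamma> A B"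
      using F tm_class_eqI[OF A B f'] by blast
  qed
qed

lemma Hom_types:
  assumes "A \<in> tys S \<Gamma>" "B \<in> tys S \<Gamma>" "f \<in> tms S \<Gamma> A B" "g \<in> tms S \<Gamma> A B"
  shows "Hom (types_homcat S \<Gamma> X Y) (tm_class S \<Gamma> A B f) (tm_class S \<Gamma> A B g)
    = id_class S \<Gamma> A B f g ` ids S \<Gamma> A B f g"
proof
  show "id_class S \<Gamma> A B f g ` ids S \<Gamma> A B f g
      \<subseteq> Hom (types_homcat S \<Gamma> X Y) (tm_class S \<Gamma> A B f) (tm_class S \<Gamma> A B g)"
    using assms tm_class_refl by (fastforce simp: types_homcat_def ids_def)
  show "Hom (types_homcat S \<Gamma> X Y) (tm_class S \<Gamma> A B f) (tm_class S \<Gamma> A B g)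
      \<subseteq> id_class S \<Gamma> A B f g ` ids S \<Gamma> A B f g"
  proof
    fix a assume "a \<in> Hom (types_homcat S \<Gamma> X Y) (tm_class S \<Gamma> A B f) (tm_class S \<Gamma> A B g)"
    then obtain A' B' f' g' \<alpha> where a: "a = id_class S \<Gamma> A' B' f' g' \<alpha>" and A: "\<Gamma> \<turnstile> A \<doteq> A' Ty"
      and B: "\<Gamma> \<turnstile> B \<doteq> B' Ty" and f: "A # \<Gamma> \<turnstile> f \<doteq> f' \<tturnstile> shift 1 B" and g: "A # \<Gamma> \<turnstile> g \<doteq> g' \<tturnstile> shift 1 B"
      and \<alpha>: "A' # \<Gamma> \<turnstile> \<alpha> \<tturnstile> Idt S (shift 1 B') f' g'"
      by (auto simp: types_homcat_def tm_class_def)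
    have \<alpha>': "A # \<Gamma> \<turnstile> \<alpha> \<doteq> \<alpha> \<tturnstile> Idt S (shift 1 B) f g"
      by (rule id_class_sym[OF ty_sym[OF A] ty_sym[OF B] tm_class_sym[OF A B f] tm_class_sym[OF A B g] tm_refl[OF \<alpha>]])
    then have "\<alpha> \<in> ids S \<Gamma> A B f g"
      unfolding ids_def by (blast dest: eq_tm_left)
    then show "a \<in> id_class S \<Gamma> A B f g ` ids S \<Gamma> A B f g"
      using a id_class_eqI[OF A B f g \<alpha>'] by blast
  qed
qed

lemma Ident_types:
  assumes "A \<in> tys S \<Gamma>" "B \<in> tys S \<Gamma>" "f \<in> tms S \<Gamma> A B"
  shows "Ident (types_homcat S \<Gamma> X Y) (tm_class S \<Gamma> A B f) = id_class S \<Gamma> A B f f (rfl S (shift 1 B) f)"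
proof -
  have *: "id_class S \<Gamma> A' B' f' f' (rfl S (shift 1 B') f') = id_class S \<Gamma> A B f f (rfl S (shift 1 B) f)"
    if "(A', B', f') \<in> tm_class S \<Gamma> A B f" for A' B' f'
  proof -
    have 1: "\<Gamma> \<turnstile> A \<doteq> A' Ty" "\<Gamma> \<turnstile> B \<doteq> B' Ty" "A # \<Gamma> \<turnstile> f \<doteq> f' \<tturnstile> shift 1 B"
      using that by (auto simp: tm_class_def)
    show ?thesis
      by (rule id_class_eqI[OF 1 1(3) rfl_cong[OF shift_1_eq[OF eq_ty_left[OF 1(1)] 1(2)] 1(3)]])
  qed
  show ?thesis
    unfolding types_homcat_def category.select_convs
    by (rule UN_const[OF tm_class_refl[OF assms]]) (clarsimp simp del: One_nat_def, rule *)
qed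

lemma Comp_types:
  assumes "A \<in> tys S \<Gamma>" "B \<in> tys S \<Gamma>" "f \<in> tms S \<Gamma> A B" "g \<in> tms S \<Gamma> A B" "k \<in> tms S \<Gamma> A B"
    "\<alpha> \<in> ids S \<Gamma> A B f g" "\<beta> \<in> ids S \<Gamma> A B g k"
  shows "Comp (types_homcat S \<Gamma> X Y) (id_class S \<Gamma> A B g k \<beta>) (id_class S \<Gamma> A B f g \<alpha>)
    = id_class S \<Gamma> A B f k (Id_trans S (shift 1 B) f g k \<beta> \<alpha>)"
proof -
  have *: "id_class S \<Gamma> A' B' f' k' (Id_trans S (shift 1 B') f' g' k' \<beta>' \<alpha>')
      = id_class S \<Gamma> A B f k (Id_trans S (shift 1 B) f g k \<beta> \<alpha>)"
    if "(A', B', f', g', \<alpha>') \<in> id_class S \<Gamma> A B f g \<alpha>" "(A', B', g', k', \<beta>') \<in> id_class S \<Gamma> A B g k \<beta>"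
    for A' B' f' g' k' \<alpha>' \<beta>'
  proof -
    have 1: "\<Gamma> \<turnstile> A \<doteq> A' Ty" "\<Gamma> \<turnstile> B \<doteq> B' Ty" "A # \<Gamma> \<turnstile> f \<doteq> f' \<tturnstile> shift 1 B" "A # \<Gamma> \<turnstile> g \<doteq> g' \<tturnstile> shift 1 B"
      "A # \<Gamma> \<turnstile> k \<doteq> k' \<tturnstile> shift 1 B" "A # \<Gamma> \<turnstile> \<alpha> \<doteq> \<alpha>' \<tturnstile> Idt S (shift 1 B) f g"
      "A # \<Gamma> \<turnstile> \<beta> \<doteq> \<beta>' \<tturnstile> Idt S (shift 1 B) g k"
      using that by (auto simp: id_class_def)
    show ?thesis
      by (rule id_class_eqI[OF 1(1-3) 1(5) Id_trans_cong[OF shift_1_eq[OF eq_ty_left[OF 1(1)] 1(2)]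
              1(3-5) 1(7) 1(6)]])
  qed
  show ?thesis
    unfolding types_homcat_def category.select_convs
    \<comment> \<open>Reflexivity puts both given representatives into their classes with the same
      middle 1-cell \<open>g\<close>, so the union is not empty; \<open>*\<close> makes all its
      members equal.\<close>
    by (rule Union_const) (use id_class_refl[OF assms(1-4,6)] id_class_refl[OF assms(1,2,4,5,7)] in blast, use * in blast)
qed

lemma id1_types:
  assumes "A \<in> tys S \<Gamma>"
  shows "id1 (types_two_category S \<Gamma>) (ty_class S \<Gamma> A) = tm_class S \<Gamma> A A (Var 0)"
proof -
  have *: "tm_class S \<Gamma> A' A' (Var 0) = tm_class S \<Gamma> A A (Var 0)" if "\<Gamma> \<turnstile> A \<doteq> A' Ty" for A'
    by (rule tm_class_eqI[OF that that tm_refl[OF head_var(2)[OF eq_ty_left[OF that]]]])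
  have A: "A \<in> ty_class S \<Gamma> A"
    using assms by (simp add: tys_def ty_class_def ty_refl)
  show ?thesis
    unfolding types_two_category_def two_category.select_convs
    by (rule UN_const[OF A]) (rule *, simp add: ty_class_def)
qed

lemma comp1_types:
  assumes "A \<in> tys S \<Gamma>" "B \<in> tys S \<Gamma>" "C \<in> tys S \<Gamma>" "f \<in> tms S \<Gamma> A B" "g \<in> tms S \<Gamma> B C"
  shows "comp1 (types_two_category S \<Gamma>) (tm_class S \<Gamma> B C g) (tm_class S \<Gamma> A B f)
    = tm_class S \<Gamma> A C (precomp f g)"
proof -
  have *: "tm_class S \<Gamma> A' C' (precomp f' g') = tm_class S \<Gamma> A C (precomp f g)"
    if "(A', B', f') \<in> tm_class S \<Gamma> A B f" "(B', C', g') \<in> tm_class S \<Gamma> B C g" for A' B' C' f' g'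
  proof -
    have 1: "\<Gamma> \<turnstile> A \<doteq> A' Ty" "\<Gamma> \<turnstile> B \<doteq> B' Ty" "\<Gamma> \<turnstile> C \<doteq> C' Ty" "A # \<Gamma> \<turnstile> f \<doteq> f' \<tturnstile> shift 1 B"
      "B # \<Gamma> \<turnstile> g \<doteq> g' \<tturnstile> shift 1 C"
      using that by (auto simp: tm_class_def)
    show ?thesis
      by (rule tm_class_eqI[OF 1(1,3) precomp_cong[OF 1(4) eq_ty_left[OF 1(2)] 1(5)]])
  qed
  show ?thesis
    unfolding types_two_category_def two_category.select_convs
    by (rule Union_const) (use tm_class_refl[OF assms(1,2,4)] tm_class_refl[OF assms(2,3,5)] in blast, use * in blast)
qed

lemma wl_types:
  assumes "A \<in> tys S \<Gamma>" "B \<in> tys S \<Gamma>" "C \<in> tys S \<Gamma>" "f \<in> tms S \<Gamma> A B" "g \<in> tms S \<Gamma> A B"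
    "\<alpha> \<in> ids S \<Gamma> A B f g" "h \<in> tms S \<Gamma> B C"
  shows "wl (types_two_category S \<Gamma>) (tm_class S \<Gamma> B C h) (id_class S \<Gamma> A B f g \<alpha>)
    = id_class S \<Gamma> A C (precomp f h) (precomp g h)
        (Id_ap S (shift 1 B) (shift 1 C) (shift_under 1 h) f g \<alpha>)"
proof -
  have *: "id_class S \<Gamma> A' C' (precomp f' h') (precomp g' h')
        (Id_ap S (shift 1 B') (shift 1 C') (shift_under 1 h') f' g' \<alpha>')
      = id_class S \<Gamma> A C (precomp f h) (precomp g h)
        (Id_ap S (shift 1 B) (shift 1 C) (shift_under 1 h) f g \<alpha>)"
    if "(A', B', f', g', \<alpha>') \<in> id_class S \<Gamma> A B f g \<alpha>" "(B', C', h') \<in> tm_class S \<Gamma> B C h"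
    for A' B' C' f' g' h' \<alpha>'
  proof -
    have 1: "\<Gamma> \<turnstile> A \<doteq> A' Ty" "\<Gamma> \<turnstile> B \<doteq> B' Ty" "\<Gamma> \<turnstile> C \<doteq> C' Ty" "A # \<Gamma> \<turnstile> f \<doteq> f' \<tturnstile> shift 1 B"
      "A # \<Gamma> \<turnstile> g \<doteq> g' \<tturnstile> shift 1 B" "A # \<Gamma> \<turnstile> \<alpha> \<doteq> \<alpha>' \<tturnstile> Idt S (shift 1 B) f g" "B # \<Gamma> \<turnstile> h \<doteq> h' \<tturnstile> shift 1 C"
      using that by (auto simp: tm_class_def id_class_def)
    note B = eq_ty_left[OF 1(2)]
    show ?thesis
      by (rule id_class_eqI[OF 1(1,3) precomp_cong[OF 1(4) B 1(7)] precomp_cong[OF 1(5) B 1(7)]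
            whisker_cong[OF eq_ty_left[OF 1(1)] 1(2-7)]])
  qed
  show ?thesis
    unfolding types_two_category_def two_category.select_convs
    by (rule Union_const) (use id_class_refl[OF assms(1,2,4-6)] tm_class_refl[OF assms(2,3,7)] in blast, use * in blast)
qed

lemma wr_types:
  assumes "A \<in> tys S \<Gamma>" "B \<in> tys S \<Gamma>" "C \<in> tys S \<Gamma>" "f \<in> tms S \<Gamma> A B" "g \<in> tms S \<Gamma> B C"
    "k \<in> tms S \<Gamma> B C" "\<alpha> \<in> ids S \<Gamma> B C g k"
  shows "wr (types_two_category S \<Gamma>) (id_class S \<Gamma> B C g k \<alpha>) (tm_class S \<Gamma> A B f)
    = id_class S \<Gamma> A C (precomp f g) (precomp f k) (precomp f \<alpha>)"
proof -
  have *: "id_class S \<Gamma> A' C' (precomp f' g') (precomp f' k') (precomp f' \<alpha>')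
      = id_class S \<Gamma> A C (precomp f g) (precomp f k) (precomp f \<alpha>)"
    if "(A', B', f') \<in> tm_class S \<Gamma> A B f" "(B', C', g', k', \<alpha>') \<in> id_class S \<Gamma> B C g k \<alpha>"
    for A' B' C' f' g' k' \<alpha>'
  proof -
    have 1: "\<Gamma> \<turnstile> A \<doteq> A' Ty" "\<Gamma> \<turnstile> B \<doteq> B' Ty" "\<Gamma> \<turnstile> C \<doteq> C' Ty" "A # \<Gamma> \<turnstile> f \<doteq> f' \<tturnstile> shift 1 B"
      "B # \<Gamma> \<turnstile> g \<doteq> g' \<tturnstile> shift 1 C" "B # \<Gamma> \<turnstile> k \<doteq> k' \<tturnstile> shift 1 C" "B # \<Gamma> \<turnstile> \<alpha> \<doteq> \<alpha>' \<tturnstile> Idt S (shift 1 C) g k"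
      using that by (auto simp: tm_class_def id_class_def)
    note B = eq_ty_left[OF 1(2)]
    show ?thesis
      by (rule id_class_eqI[OF 1(1,3) precomp_cong[OF 1(4) B 1(5)] precomp_cong[OF 1(4) B 1(6)]
            precomp_id_cong[OF 1(4) B 1(7)]])
  qed
  show ?thesis
    unfolding types_two_category_def two_category.select_convs
    by (rule Union_const) (use tm_class_refl[OF assms(1,2,4)] id_class_refl[OF assms(2,3,5-7)] in blast, use * in blast)
qed

section \<open>Closure of the operations over fixed types\<close>

lemma tm_class_cong:
  assumes "A \<in> tys S \<Gamma>" "B \<in> tys S \<Gamma>" "A # \<Gamma> \<turnstile> f \<doteq> f' \<tturnstile> shift 1 B"
  shows "tm_class S \<Gamma> A B f = tm_class S \<Gamma> A B f'"
  using assms by (intro tm_class_eqI[symmetric]) (simp_all add: tys_def ty_refl)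

lemma id_class_cong:
  assumes "A \<in> tys S \<Gamma>" "B \<in> tys S \<Gamma>" "f \<in> tms S \<Gamma> A B" "g \<in> tms S \<Gamma> A B"
    "A # \<Gamma> \<turnstile> \<alpha> \<doteq> \<alpha>' \<tturnstile> Idt S (shift 1 B) f g"
  shows "id_class S \<Gamma> A B f g \<alpha> = id_class S \<Gamma> A B f g \<alpha>'"
  using assms by (intro id_class_eqI[symmetric]) (simp_all add: tys_def tms_def ty_refl tm_refl)

lemma Var_tms: "A \<in> tys S \<Gamma> \<Longrightarrow> Var 0 \<in> tms S \<Gamma> A A"
  unfolding tys_def tms_def by (simp add: var_0 del: One_nat_def)

lemma precomp_tms:
  assumes "B \<in> tys S \<Gamma>" "f \<in> tms S \<Gamma> A B" "g \<in> tms S \<Gamma> B C"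
  shows "precomp f g \<in> tms S \<Gamma> A C"
  using assms precomp_cong[of A \<Gamma> f f B g g C] unfolding tys_def tms_def
  by (auto intro: tm_refl eq_tm_left simp del: One_nat_def)

lemma rfl_ids: "f \<in> tms S \<Gamma> A B \<Longrightarrow> rfl S (shift 1 B) f \<in> ids S \<Gamma> A B f f"
  unfolding tms_def ids_def by (simp add: rfl_intro del: One_nat_def)

lemma Id_trans_ids:
  assumes "f \<in> tms S \<Gamma> A B" "g \<in> tms S \<Gamma> A B" "k \<in> tms S \<Gamma> A B"
    "\<beta> \<in> ids S \<Gamma> A B g k" "\<alpha> \<in> ids S \<Gamma> A B f g"
  shows "Id_trans S (shift 1 B) f g k \<beta> \<alpha> \<in> ids S \<Gamma> A B f k"
  using assms unfolding tms_def ids_def by (simp add: Id_trans_tm del: One_nat_def)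

lemma precomp_ids:
  assumes "B \<in> tys S \<Gamma>" "f \<in> tms S \<Gamma> A B" "\<alpha> \<in> ids S \<Gamma> B C g k"
  shows "precomp f \<alpha> \<in> ids S \<Gamma> A C (precomp f g) (precomp f k)"
  using assms precomp_id_cong[of A \<Gamma> f f B \<alpha> \<alpha> C g k] unfolding tys_def tms_def ids_def
  by (auto intro: tm_refl eq_tm_left simp del: One_nat_def)

lemma whisker_ids:
  assumes "A \<in> tys S \<Gamma>" "B \<in> tys S \<Gamma>" "C \<in> tys S \<Gamma>" "f \<in> tms S \<Gamma> A B" "g \<in> tms S \<Gamma> A B"
    "\<alpha> \<in> ids S \<Gamma> A B f g" "h \<in> tms S \<Gamma> B C"
  shows "Id_ap S (shift 1 B) (shift 1 C) (shift_under 1 h) f g \<alpha> \<in> ids S \<Gamma> A C (precomp f h) (precomp g h)"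
proof -
  have "\<Gamma> \<turnstile> A Ty" "\<Gamma> \<turnstile> B \<doteq> B Ty" "\<Gamma> \<turnstile> C \<doteq> C Ty" "A # \<Gamma> \<turnstile> f \<doteq> f \<tturnstile> shift 1 B" "A # \<Gamma> \<turnstile> g \<doteq> g \<tturnstile> shift 1 B"
    "A # \<Gamma> \<turnstile> \<alpha> \<doteq> \<alpha> \<tturnstile> Idt S (shift 1 B) f g" "B # \<Gamma> \<turnstile> h \<doteq> h \<tturnstile> shift 1 C"
    using assms by (simp_all add: tys_def tms_def ids_def ty_refl tm_refl)
  from eq_tm_left[OF whisker_cong[OF this]] show ?thesis
    by (simp add: ids_def)
qed

lemmas ids_closed = rfl_ids Id_trans_ids whisker_ids

section \<open>Strict laws of precomposition\<close>

lemma precomp_Var: "precomp (Var 0) e = e"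
  by (simp add: norm)

lemma precomp_precomp: "precomp f (precomp g e) = precomp (precomp f g) e"
  by (simp add: norm)

lemma precomp_rfl: "precomp f (rfl S (shift 1 C) g) = rfl S (shift 1 C) (precomp f g)"
  by (simp add: norm)

lemma precomp_Id_trans: "precomp f (Id_trans S (shift 1 C) g k l \<beta> \<alpha>) =
    Id_trans S (shift 1 C) (precomp f g) (precomp f k) (precomp f l) (precomp f \<beta>) (precomp f \<alpha>)"
  by (simp add: norm)

text \<open>\<open>C\<close>, \<open>D\<close> and \<open>h\<close> are weakened along the variable
  that \<open>f\<close> replaces, so the substitution leaves them unchanged and acts only on the
  path and its endpoints.\<close>

lemma precomp_Id_ap: "precomp f (Id_ap S (shift 1 C) (shift 1 D) (shift_under 1 h) g k \<alpha>) =
    Id_ap S (shift 1 C) (shift 1 D) (shift_under 1 h) (precomp f g) (precomp f k) (precomp f \<alpha>)"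
  by (simp add: norm)

section \<open>The axioms of a 2-category\<close>

lemma rfl_right_class:
  assumes "A \<in> tys S \<Gamma>" "B \<in> tys S \<Gamma>" "f \<in> tms S \<Gamma> A B" "g \<in> tms S \<Gamma> A B" "\<alpha> \<in> ids S \<Gamma> A B f g"
  shows "id_class S \<Gamma> A B f g (Id_trans S (shift 1 B) f f g \<alpha> (rfl S (shift 1 B) f)) = id_class S \<Gamma> A B f g \<alpha>"
  using assms by (intro id_class_cong) (simp_all add: tms_def ids_def Id_trans_rfl_right)

lemma rfl_left_class:
  assumes "A \<in> tys S \<Gamma>" "B \<in> tys S \<Gamma>" "f \<in> tms S \<Gamma> A B" "g \<in> tms S \<Gamma> A B" "\<alpha> \<in> ids S \<Gamma> A B f g"
  shows "id_class S \<Gamma> A B f g (Id_trans S (shift 1 B) f g g (rfl S (shift 1 B) g) \<alpha>) = id_class S \<Gamma> A B f g \<alpha>"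
  using assms by (intro id_class_cong) (simp_all add: tms_def ids_def Id_trans_rfl_left)

lemma assoc_class:
  assumes "A \<in> tys S \<Gamma>" "B \<in> tys S \<Gamma>" "f \<in> tms S \<Gamma> A B" "g \<in> tms S \<Gamma> A B" "k \<in> tms S \<Gamma> A B"
    "l \<in> tms S \<Gamma> A B" "\<alpha> \<in> ids S \<Gamma> A B f g" "\<beta> \<in> ids S \<Gamma> A B g k" "\<gamma> \<in> ids S \<Gamma> A B k l"
  shows "id_class S \<Gamma> A B f l (Id_trans S (shift 1 B) f k l \<gamma> (Id_trans S (shift 1 B) f g k \<beta> \<alpha>))
    = id_class S \<Gamma> A B f l (Id_trans S (shift 1 B) f g l (Id_trans S (shift 1 B) g k l \<gamma> \<beta>) \<alpha>)"
  using assms by (intro id_class_cong) (simp_all add: tms_def ids_def Id_trans_assoc)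

text \<open>
  \<open>One_nat_def\<close> is deleted because it turns the \<open>shift 1\<close> of a goal into \<open>shift (Suc 0)\<close>, which the
  rewrite rules about classes no longer match.
\<close>

lemma types_category:
  assumes "A \<in> tys S \<Gamma>" "B \<in> tys S \<Gamma>"
  shows "is_category (types_homcat S \<Gamma> (ty_class S \<Gamma> A) (ty_class S \<Gamma> B))"
  unfolding is_category_def using assms
  by (auto simp: Obj_types Hom_types Ident_types Comp_types ids_closed rfl_right_class rfl_left_class
      assoc_class simp del: One_nat_def)

text \<open>Functoriality of left whiskering is \<open>Id_ap_rfl\<close> and
  \<open>Id_ap_trans\<close> over the context \<open>A # \<Gamma>\<close>. Both hold only up to
  definitional equality, hence after passing to classes.\<close>

lemma wl_functor:
  assumes A: "A \<in> tys S \<Gamma>" and B: "B \<in> tys S \<Gamma>" and C: "C \<in> tys S \<Gamma>" and h: "h \<in> tms S \<Gamma> B C"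
  shows "is_functor (types_homcat S \<Gamma> (ty_class S \<Gamma> A) (ty_class S \<Gamma> B))
    (types_homcat S \<Gamma> (ty_class S \<Gamma> A) (ty_class S \<Gamma> C))
    (comp1 (types_two_category S \<Gamma>) (tm_class S \<Gamma> B C h)) (wl (types_two_category S \<Gamma>) (tm_class S \<Gamma> B C h))"
proof -
  note h1 = precomp_tms[OF B _ h]
  have B1: "A # \<Gamma> \<turnstile> shift 1 B Ty" and C1: "A # \<Gamma> \<turnstile> shift 1 C Ty"
    using A B C by (auto simp: tys_def intro: eq_ty_left shift_1_eq ty_refl simp del: One_nat_def)
  have h': "shift 1 B # A # \<Gamma> \<turnstile> shift_under 1 h \<tturnstile> shift 1 (shift 1 C)"
    using shift_under_tm[of B \<Gamma> h C "A # \<Gamma>" 1] h A head_var(3) by (simp add: tms_def tys_def)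
  have r: "id_class S \<Gamma> A C (precomp f h) (precomp f h)
      (Id_ap S (shift 1 B) (shift 1 C) (shift_under 1 h) f f (rfl S (shift 1 B) f))
    = id_class S \<Gamma> A C (precomp f h) (precomp f h) (rfl S (shift 1 C) (precomp f h))"
    if "f \<in> tms S \<Gamma> A B" for f
    using A C h1[OF that] Id_ap_rfl[OF C1 h', of f] that
    by (intro id_class_cong) (simp_all only: tms_def shift_under_inst mem_Collect_eq)
  have t: "id_class S \<Gamma> A C (precomp f h) (precomp k h)
      (Id_ap S (shift 1 B) (shift 1 C) (shift_under 1 h) f k (Id_trans S (shift 1 B) f g k \<beta> \<alpha>))
    = id_class S \<Gamma> A C (precomp f h) (precomp k h)
      (Id_trans S (shift 1 C) (precomp f h) (precomp g h) (precomp k h)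
        (Id_ap S (shift 1 B) (shift 1 C) (shift_under 1 h) g k \<beta>)
        (Id_ap S (shift 1 B) (shift 1 C) (shift_under 1 h) f g \<alpha>))"
    if "f \<in> tms S \<Gamma> A B" "g \<in> tms S \<Gamma> A B" "k \<in> tms S \<Gamma> A B" "\<alpha> \<in> ids S \<Gamma> A B f g" "\<beta> \<in> ids S \<Gamma> A B g k"
    for f g k \<alpha> \<beta>
    using A C h1[OF that(1)] h1[OF that(3)] Id_ap_trans[OF C1 h', of f g k \<alpha> \<beta>] that
    by (intro id_class_cong) (simp_all only: tms_def ids_def shift_under_inst mem_Collect_eq)
  show ?thesis
    unfolding is_functor_def using assms types_category
    by (auto simp: Obj_types Hom_types Ident_types Comp_types comp1_types wl_types ids_closed h1 r t
        simp del: One_nat_def)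
qed

lemma wr_functor:
  assumes A: "A \<in> tys S \<Gamma>" and B: "B \<in> tys S \<Gamma>" and C: "C \<in> tys S \<Gamma>" and f: "f \<in> tms S \<Gamma> A B"
  shows "is_functor (types_homcat S \<Gamma> (ty_class S \<Gamma> B) (ty_class S \<Gamma> C))
    (types_homcat S \<Gamma> (ty_class S \<Gamma> A) (ty_class S \<Gamma> C))
    (\<lambda>g. comp1 (types_two_category S \<Gamma>) g (tm_class S \<Gamma> A B f))
    (\<lambda>\<alpha>. wr (types_two_category S \<Gamma>) \<alpha> (tm_class S \<Gamma> A B f))"
  unfolding is_functor_def using assms types_category
  by (auto simp: Obj_types Hom_types Ident_types Comp_types comp1_types wr_types ids_closed
      precomp_tms[OF B f] precomp_ids[OF B f] precomp_rfl precomp_Id_trans simp del: One_nat_def)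

lemma whisker_Var_class:
  assumes A: "A \<in> tys S \<Gamma>" and B: "B \<in> tys S \<Gamma>" and f: "f \<in> tms S \<Gamma> A B" and g: "g \<in> tms S \<Gamma> A B"
    and \<alpha>: "\<alpha> \<in> ids S \<Gamma> A B f g"
  shows "wl (types_two_category S \<Gamma>) (tm_class S \<Gamma> B B (Var 0)) (id_class S \<Gamma> A B f g \<alpha>) = id_class S \<Gamma> A B f g \<alpha>"
    "wr (types_two_category S \<Gamma>) (id_class S \<Gamma> A B f g \<alpha>) (tm_class S \<Gamma> A A (Var 0)) = id_class S \<Gamma> A B f g \<alpha>"
proof -
  have "id_class S \<Gamma> A B f g (Id_ap S (shift 1 B) (shift 1 B) (Var 0) f g \<alpha>) = id_class S \<Gamma> A B f g \<alpha>"
    using assms by (intro id_class_cong) (simp_all add: tms_def ids_def Id_ap_id)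
  then show "wl (types_two_category S \<Gamma>) (tm_class S \<Gamma> B B (Var 0)) (id_class S \<Gamma> A B f g \<alpha>) = id_class S \<Gamma> A B f g \<alpha>"
    unfolding wl_types[OF A B B f g \<alpha> Var_tms[OF B]] by (simp add: norm)
  show "wr (types_two_category S \<Gamma>) (id_class S \<Gamma> A B f g \<alpha>) (tm_class S \<Gamma> A A (Var 0)) = id_class S \<Gamma> A B f g \<alpha>"
    unfolding wr_types[OF A A B Var_tms[OF A] f g \<alpha>] precomp_Var ..
qed

lemma wl_comp_class:
  assumes A: "A \<in> tys S \<Gamma>" and B: "B \<in> tys S \<Gamma>" and C: "C \<in> tys S \<Gamma>" and D: "D \<in> tys S \<Gamma>"
    and f: "f \<in> tms S \<Gamma> A B" and f': "f' \<in> tms S \<Gamma> A B" and \<alpha>: "\<alpha> \<in> ids S \<Gamma> A B f f'"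
    and g: "g \<in> tms S \<Gamma> B C" and h: "h \<in> tms S \<Gamma> C D"
  shows "wl (types_two_category S \<Gamma>) (comp1 (types_two_category S \<Gamma>) (tm_class S \<Gamma> C D h) (tm_class S \<Gamma> B C g))
      (id_class S \<Gamma> A B f f' \<alpha>)
    = wl (types_two_category S \<Gamma>) (tm_class S \<Gamma> C D h)
        (wl (types_two_category S \<Gamma>) (tm_class S \<Gamma> B C g) (id_class S \<Gamma> A B f f' \<alpha>))"
proof -
  note gh = precomp_tms[OF C g h] and fg = precomp_tms[OF B f g] precomp_tms[OF B f' g]
  have C1: "A # \<Gamma> \<turnstile> shift 1 C Ty" and D1: "A # \<Gamma> \<turnstile> shift 1 D Ty"
    using A C D by (auto simp: tys_def intro: eq_ty_left shift_1_eq ty_refl simp del: One_nat_def)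
  have g': "shift 1 B # A # \<Gamma> \<turnstile> shift_under 1 g \<tturnstile> shift 1 (shift 1 C)"
    using shift_under_tm[of B \<Gamma> g C "A # \<Gamma>" 1] g A head_var(3) by (simp add: tms_def tys_def)
  have h': "shift 1 C # A # \<Gamma> \<turnstile> shift_under 1 h \<tturnstile> shift 1 (shift 1 D)"
    using shift_under_tm[of C \<Gamma> h D "A # \<Gamma>" 1] h A head_var(3) by (simp add: tms_def tys_def)
  have "A # \<Gamma> \<turnstile> Id_ap S (shift 1 B) (shift 1 D) (shift_under 1 (precomp g h)) f f' \<alpha>
    \<doteq> Id_ap S (shift 1 C) (shift 1 D) (shift_under 1 h) (precomp f g) (precomp f' g)
        (Id_ap S (shift 1 B) (shift 1 C) (shift_under 1 g) f f' \<alpha>)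
    \<tturnstile> Idt S (shift 1 D) (precomp f (precomp g h)) (precomp f' (precomp g h))"
    using Id_ap_comp[OF C1 D1 g' h', of f f' \<alpha>] f f' \<alpha> by (simp add: norm tms_def ids_def)
  from id_class_cong[OF A D precomp_tms[OF B f gh] precomp_tms[OF B f' gh] this]
  have "id_class S \<Gamma> A D (precomp f (precomp g h)) (precomp f' (precomp g h))
      (Id_ap S (shift 1 B) (shift 1 D) (shift_under 1 (precomp g h)) f f' \<alpha>)
    = id_class S \<Gamma> A D (precomp f (precomp g h)) (precomp f' (precomp g h))
      (Id_ap S (shift 1 C) (shift 1 D) (shift_under 1 h) (precomp f g) (precomp f' g)
        (Id_ap S (shift 1 B) (shift 1 C) (shift_under 1 g) f f' \<alpha>))" .
  then show ?thesis
    unfolding comp1_types[OF B C D g h] wl_types[OF A B D f f' \<alpha> gh] wl_types[OF A B C f f' \<alpha> g]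
      wl_types[OF A C D fg whisker_ids[OF A B C f f' \<alpha> g] h] precomp_precomp .
qed

text \<open>A 2-cell from \<open>f\<close> to \<open>f'\<close> is a path over
  \<open>A # \<Gamma>\<close>, and interchange is the naturality square of the weakened
  \<open>\<beta>\<close> at that path.\<close>

lemma interchange_class:
  assumes A: "A \<in> tys S \<Gamma>" and B: "B \<in> tys S \<Gamma>" and C: "C \<in> tys S \<Gamma>"
    and f: "f \<in> tms S \<Gamma> A B" and f': "f' \<in> tms S \<Gamma> A B" and \<alpha>: "\<alpha> \<in> ids S \<Gamma> A B f f'"
    and g: "g \<in> tms S \<Gamma> B C" and g': "g' \<in> tms S \<Gamma> B C" and \<beta>: "\<beta> \<in> ids S \<Gamma> B C g g'"
  shows "Comp (types_homcat S \<Gamma> X Y)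
      (wr (types_two_category S \<Gamma>) (id_class S \<Gamma> B C g g' \<beta>) (tm_class S \<Gamma> A B f'))
      (wl (types_two_category S \<Gamma>) (tm_class S \<Gamma> B C g) (id_class S \<Gamma> A B f f' \<alpha>))
    = Comp (types_homcat S \<Gamma> X Y)
      (wl (types_two_category S \<Gamma>) (tm_class S \<Gamma> B C g') (id_class S \<Gamma> A B f f' \<alpha>))
      (wr (types_two_category S \<Gamma>) (id_class S \<Gamma> B C g g' \<beta>) (tm_class S \<Gamma> A B f))"
proof -
  have C1: "A # \<Gamma> \<turnstile> shift 1 C Ty"
    using A C by (auto simp: tys_def intro: eq_ty_left shift_1_eq ty_refl simp del: One_nat_def)
  have h': "shift 1 B # A # \<Gamma> \<turnstile> shift_under 1 h \<tturnstile> shift 1 (shift 1 C)" if "h \<in> tms S \<Gamma> B C" for h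
    using shift_under_tm[of B \<Gamma> h C "A # \<Gamma>" 1] that A head_var(3) by (simp add: tms_def tys_def)
  have 1: "\<Gamma> \<turnstile> B Ty" "ctx S (A # \<Gamma>)" "B # \<Gamma> \<turnstile> \<beta> \<tturnstile> Idt S (shift 1 C) g g'"
    using B A \<beta> head_var(3) by (auto simp: tys_def ids_def)
  have b': "shift 1 B # A # \<Gamma> \<turnstile> shift_under 1 \<beta>
      \<tturnstile> Idt S (shift 1 (shift 1 C)) (shift_under 1 g) (shift_under 1 g')"
    using tm_subst[OF shift_under_mor[OF 1(1,2), of 1] 1(3)] by (simp add: norm)
  have n: "A # \<Gamma> \<turnstile> Id_trans S (shift 1 C) (precomp f g) (precomp f' g) (precomp f' g') (precomp f' \<beta>)
        (Id_ap S (shift 1 B) (shift 1 C) (shift_under 1 g) f f' \<alpha>)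
      \<doteq> Id_trans S (shift 1 C) (precomp f g) (precomp f g') (precomp f' g')
        (Id_ap S (shift 1 B) (shift 1 C) (shift_under 1 g') f f' \<alpha>) (precomp f \<beta>)
      \<tturnstile> Idt S (shift 1 C) (precomp f g) (precomp f' g')"
    using Id_ap_natural[OF C1 h'[OF g] h'[OF g'] b', of f f' \<alpha>] f f' \<alpha>
    unfolding tms_def ids_def shift_under_inst by simp
  note fg = precomp_tms[OF B f g] precomp_tms[OF B f' g] precomp_tms[OF B f g'] precomp_tms[OF B f' g']
  show ?thesis
    unfolding wr_types[OF A B C f' g g' \<beta>] wr_types[OF A B C f g g' \<beta>] wl_types[OF A B C f f' \<alpha> g]
      wl_types[OF A B C f f' \<alpha> g']
      Comp_types[OF A C fg(1,2,4) whisker_ids[OF A B C f f' \<alpha> g] precomp_ids[OF B f' \<beta>]]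
      Comp_types[OF A C fg(1,3,4) precomp_ids[OF B f \<beta>] whisker_ids[OF A B C f f' \<alpha> g']]
    by (rule id_class_cong[OF A C fg(1,4) n])
qed

lemma comp1_assoc_class:
  assumes A: "A \<in> tys S \<Gamma>" and B: "B \<in> tys S \<Gamma>" and C: "C \<in> tys S \<Gamma>" and D: "D \<in> tys S \<Gamma>"
    and f: "f \<in> tms S \<Gamma> A B" and g: "g \<in> tms S \<Gamma> B C" and h: "h \<in> tms S \<Gamma> C D"
  shows "comp1 (types_two_category S \<Gamma>) (tm_class S \<Gamma> C D h)
      (comp1 (types_two_category S \<Gamma>) (tm_class S \<Gamma> B C g) (tm_class S \<Gamma> A B f))
    = comp1 (types_two_category S \<Gamma>)
      (comp1 (types_two_category S \<Gamma>) (tm_class S \<Gamma> C D h) (tm_class S \<Gamma> B C g)) (tm_class S \<Gamma> A B f)"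
  unfolding comp1_types[OF A B C f g] comp1_types[OF B C D g h]
    comp1_types[OF A C D precomp_tms[OF B f g] h] comp1_types[OF A B D f precomp_tms[OF C g h]]
  by (simp only: precomp_precomp)

lemma wr_comp_class:
  assumes A: "A \<in> tys S \<Gamma>" and B: "B \<in> tys S \<Gamma>" and C: "C \<in> tys S \<Gamma>" and D: "D \<in> tys S \<Gamma>"
    and f: "f \<in> tms S \<Gamma> A B" and g: "g \<in> tms S \<Gamma> B C" and h: "h \<in> tms S \<Gamma> C D" and h': "h' \<in> tms S \<Gamma> C D"
    and \<alpha>: "\<alpha> \<in> ids S \<Gamma> C D h h'"
  shows "wr (types_two_category S \<Gamma>) (id_class S \<Gamma> C D h h' \<alpha>)
      (comp1 (types_two_category S \<Gamma>) (tm_class S \<Gamma> B C g) (tm_class S \<Gamma> A B f))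
    = wr (types_two_category S \<Gamma>)
      (wr (types_two_category S \<Gamma>) (id_class S \<Gamma> C D h h' \<alpha>) (tm_class S \<Gamma> B C g)) (tm_class S \<Gamma> A B f)"
  unfolding comp1_types[OF A B C f g] wr_types[OF B C D g h h' \<alpha>]
    wr_types[OF A C D precomp_tms[OF B f g] h h' \<alpha>]
    wr_types[OF A B D f precomp_tms[OF C g h] precomp_tms[OF C g h'] precomp_ids[OF C g \<alpha>]]
  by (simp only: precomp_precomp)

lemma wl_wr_class:
  assumes A: "A \<in> tys S \<Gamma>" and B: "B \<in> tys S \<Gamma>" and C: "C \<in> tys S \<Gamma>" and D: "D \<in> tys S \<Gamma>"
    and f: "f \<in> tms S \<Gamma> A B" and g: "g \<in> tms S \<Gamma> B C" and g': "g' \<in> tms S \<Gamma> B C"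
    and \<alpha>: "\<alpha> \<in> ids S \<Gamma> B C g g'" and h: "h \<in> tms S \<Gamma> C D"
  shows "wr (types_two_category S \<Gamma>)
      (wl (types_two_category S \<Gamma>) (tm_class S \<Gamma> C D h) (id_class S \<Gamma> B C g g' \<alpha>)) (tm_class S \<Gamma> A B f)
    = wl (types_two_category S \<Gamma>) (tm_class S \<Gamma> C D h)
      (wr (types_two_category S \<Gamma>) (id_class S \<Gamma> B C g g' \<alpha>) (tm_class S \<Gamma> A B f))"
  unfolding wl_types[OF B C D g g' \<alpha> h] wr_types[OF A B C f g g' \<alpha>]
    wr_types[OF A B D f precomp_tms[OF C g h] precomp_tms[OF C g' h] whisker_ids[OF B C D g g' \<alpha> h]]
    wl_types[OF A C D precomp_tms[OF B f g] precomp_tms[OF B f g'] precomp_ids[OF B f \<alpha>] h]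
  by (simp only: precomp_precomp precomp_Id_ap)

lemma comp1_closed:
  assumes A: "A \<in> tys S \<Gamma>" and B: "B \<in> tys S \<Gamma>" and C: "C \<in> tys S \<Gamma>"
    and f: "f \<in> tms S \<Gamma> A B" and g: "g \<in> tms S \<Gamma> B C"
  shows "comp1 (types_two_category S \<Gamma>) (tm_class S \<Gamma> B C g) (tm_class S \<Gamma> A B f)
    \<in> tm_class S \<Gamma> A C ` tms S \<Gamma> A C"
  unfolding comp1_types[OF assms] using precomp_tms[OF B f g] by blast

lemma types_is_two_category: "is_two_category (types_two_category S \<Gamma>)"
  \<comment> \<open>Composites first stay folded, since the laws for classes are stated with
    \<open>comp1\<close>; what is left, such as the unit laws for 1-cells, is settled on
    representatives.\<close>
  unfolding is_two_category_def HomCat_types Ob_types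
  by (auto simp: types_category id1_types Var_tms Obj_types Hom_types comp1_closed wl_functor wr_functor
      whisker_Var_class wl_comp_class wr_comp_class wl_wr_class interchange_class comp1_assoc_class)
    (simp_all add: comp1_types Var_tms precomp_Var del: One_nat_def)

section \<open>The action of a context morphism\<close>

lemma subst_tys: "ctx_mor S \<Delta> \<sigma> \<Gamma> \<Longrightarrow> A \<in> tys S \<Gamma> \<Longrightarrow> subst \<sigma> A \<in> tys S \<Delta>"
  by (simp add: tys_def ty_subst)

lemma subst_lift_shift: "subst (lift \<sigma>) (shift 1 B) = shift 1 (subst \<sigma> B)"
  by (simp add: norm)

lemma tys_lift_mor: "ctx_mor S \<Delta> \<sigma> \<Gamma> \<Longrightarrow> A \<in> tys S \<Gamma> \<Longrightarrow> ctx_mor S (subst \<sigma> A # \<Delta>) (lift \<sigma>) (A # \<Gamma>)"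
  unfolding tys_def using ctx_mor_lift by blast

lemma subst_tms:
  assumes "ctx_mor S \<Delta> \<sigma> \<Gamma>" "A \<in> tys S \<Gamma>" "f \<in> tms S \<Gamma> A B"
  shows "subst (lift \<sigma>) f \<in> tms S \<Delta> (subst \<sigma> A) (subst \<sigma> B)"
  using tm_subst[OF tys_lift_mor[OF assms(1,2)]] assms(3)
  unfolding tms_def subst_lift_shift[symmetric] by blast

lemma subst_ids:
  assumes "ctx_mor S \<Delta> \<sigma> \<Gamma>" "A \<in> tys S \<Gamma>" "\<alpha> \<in> ids S \<Gamma> A B f g"
  shows "subst (lift \<sigma>) \<alpha> \<in> ids S \<Delta> (subst \<sigma> A) (subst \<sigma> B) (subst (lift \<sigma>) f) (subst (lift \<sigma>) g)"
  using tm_subst[OF tys_lift_mor[OF assms(1,2)]] assms(3)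
  unfolding ids_def subst_lift_shift[symmetric] subst_Idt[symmetric] by blast

lemma on0_types:
  assumes \<sigma>: "ctx_mor S \<Delta> \<sigma> \<Gamma>" and A: "A \<in> tys S \<Gamma>"
  shows "on0 (types_two_map S \<Delta> \<sigma>) (ty_class S \<Gamma> A) = ty_class S \<Delta> (subst \<sigma> A)"
proof -
  have *: "ty_class S \<Delta> (subst \<sigma> A') = ty_class S \<Delta> (subst \<sigma> A)" if "\<Gamma> \<turnstile> A \<doteq> A' Ty" for A'
    by (rule ty_class_eqI[OF eq_ty_subst[OF \<sigma> that]])
  have A': "A \<in> ty_class S \<Gamma> A"
    using A by (simp add: tys_def ty_class_def ty_refl)
  show ?thesis
    unfolding types_two_map_def two_map.select_convs
    by (rule UN_const[OF A']) (rule *, simp add: ty_class_def)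
qed

lemma on1_types:
  assumes \<sigma>: "ctx_mor S \<Delta> \<sigma> \<Gamma>" and A: "A \<in> tys S \<Gamma>" "B \<in> tys S \<Gamma>" "f \<in> tms S \<Gamma> A B"
  shows "on1 (types_two_map S \<Delta> \<sigma>) (tm_class S \<Gamma> A B f)
    = tm_class S \<Delta> (subst \<sigma> A) (subst \<sigma> B) (subst (lift \<sigma>) f)"
proof -
  have *: "tm_class S \<Delta> (subst \<sigma> A') (subst \<sigma> B') (subst (lift \<sigma>) f')
      = tm_class S \<Delta> (subst \<sigma> A) (subst \<sigma> B) (subst (lift \<sigma>) f)"
    if "(A', B', f') \<in> tm_class S \<Gamma> A B f" for A' B' f'
  proof -
    have 1: "\<Gamma> \<turnstile> A \<doteq> A' Ty" "\<Gamma> \<turnstile> B \<doteq> B' Ty" "A # \<Gamma> \<turnstile> f \<doteq> f' \<tturnstile> shift 1 B"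
      using that by (auto simp: tm_class_def)
    show ?thesis
      using eq_tm_subst[OF tys_lift_mor[OF \<sigma> A(1)] 1(3)] unfolding subst_lift_shift
      by (rule tm_class_eqI[OF eq_ty_subst[OF \<sigma> 1(1)] eq_ty_subst[OF \<sigma> 1(2)]])
  qed
  show ?thesis
    unfolding types_two_map_def two_map.select_convs
    by (rule UN_const[OF tm_class_refl[OF A]]) (clarsimp simp del: One_nat_def, rule *)
qed

lemma on2_types:
  assumes \<sigma>: "ctx_mor S \<Delta> \<sigma> \<Gamma>" and A: "A \<in> tys S \<Gamma>" "B \<in> tys S \<Gamma>" "f \<in> tms S \<Gamma> A B" "g \<in> tms S \<Gamma> A B"
    "\<alpha> \<in> ids S \<Gamma> A B f g"
  shows "on2 (types_two_map S \<Delta> \<sigma>) (id_class S \<Gamma> A B f g \<alpha>)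
    = id_class S \<Delta> (subst \<sigma> A) (subst \<sigma> B) (subst (lift \<sigma>) f) (subst (lift \<sigma>) g) (subst (lift \<sigma>) \<alpha>)"
proof -
  have *: "id_class S \<Delta> (subst \<sigma> A') (subst \<sigma> B') (subst (lift \<sigma>) f') (subst (lift \<sigma>) g') (subst (lift \<sigma>) \<alpha>')
      = id_class S \<Delta> (subst \<sigma> A) (subst \<sigma> B) (subst (lift \<sigma>) f) (subst (lift \<sigma>) g) (subst (lift \<sigma>) \<alpha>)"
    if "(A', B', f', g', \<alpha>') \<in> id_class S \<Gamma> A B f g \<alpha>" for A' B' f' g' \<alpha>'
  proof -
    have 1: "\<Gamma> \<turnstile> A \<doteq> A' Ty" "\<Gamma> \<turnstile> B \<doteq> B' Ty" "A # \<Gamma> \<turnstile> f \<doteq> f' \<tturnstile> shift 1 B" "A # \<Gamma> \<turnstile> g \<doteq> g' \<tturnstile> shift 1 B"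
      "A # \<Gamma> \<turnstile> \<alpha> \<doteq> \<alpha>' \<tturnstile> Idt S (shift 1 B) f g"
      using that by (auto simp: id_class_def)
    note s = eq_tm_subst[OF tys_lift_mor[OF \<sigma> A(1)]]
    show ?thesis
      using s[OF 1(3)] s[OF 1(4)] s[OF 1(5)] unfolding subst_lift_shift subst_Idt
      by (rule id_class_eqI[OF eq_ty_subst[OF \<sigma> 1(1)] eq_ty_subst[OF \<sigma> 1(2)]])
  qed
  show ?thesis
    unfolding types_two_map_def two_map.select_convs
    by (rule UN_const[OF id_class_refl[OF A]]) (clarsimp simp del: One_nat_def, rule *)
qed

lemma subst_precomp: "subst (lift \<sigma>) (precomp f e) = precomp (subst (lift \<sigma>) f) (subst (lift \<sigma>) e)"
  by (simp add: norm)

text \<open>All operations are stable under substitution as raw expressions, so the action preserves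
  composition and whiskering strictly, as a 2-functor must.\<close>

lemma subst_Id_ap_shift_under: "subst (lift \<sigma>) (Id_ap S (shift 1 B) (shift 1 C) (shift_under 1 h) f g \<alpha>) =
    Id_ap S (shift 1 (subst \<sigma> B)) (shift 1 (subst \<sigma> C)) (shift_under 1 (subst (lift \<sigma>) h))
      (subst (lift \<sigma>) f) (subst (lift \<sigma>) g) (subst (lift \<sigma>) \<alpha>)"
  by (simp add: norm)

text \<open>A lifted substitution fixes the newest variable, so identity 1-cells are sent to
  identity 1-cells.\<close>

lemma lift_0: "lift \<sigma> 0 = Var 0"
  by (simp add: lift_def)

lemma on_functor:
  assumes \<sigma>: "ctx_mor S \<Delta> \<sigma> \<Gamma>" and A: "A \<in> tys S \<Gamma>" and B: "B \<in> tys S \<Gamma>"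
  shows "is_functor (types_homcat S \<Gamma> (ty_class S \<Gamma> A) (ty_class S \<Gamma> B))
    (types_homcat S \<Delta> (ty_class S \<Delta> (subst \<sigma> A)) (ty_class S \<Delta> (subst \<sigma> B)))
    (on1 (types_two_map S \<Delta> \<sigma>)) (on2 (types_two_map S \<Delta> \<sigma>))"
  unfolding is_functor_def using assms types_category subst_tys[OF \<sigma>]
  by (auto simp: Obj_types Hom_types Ident_types Comp_types on1_types[OF \<sigma>] on2_types[OF \<sigma>] subst_tms[OF \<sigma>]
      subst_ids[OF \<sigma>] ids_closed subst_rfl subst_Id_trans subst_lift_shift simp del: One_nat_def)

lemma on1_comp1_class:
  assumes \<sigma>: "ctx_mor S \<Delta> \<sigma> \<Gamma>" and A: "A \<in> tys S \<Gamma>" and B: "B \<in> tys S \<Gamma>" and C: "C \<in> tys S \<Gamma>"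
    and f: "f \<in> tms S \<Gamma> A B" and g: "g \<in> tms S \<Gamma> B C"
  shows "on1 (types_two_map S \<Delta> \<sigma>) (comp1 (types_two_category S \<Gamma>) (tm_class S \<Gamma> B C g) (tm_class S \<Gamma> A B f))
    = comp1 (types_two_category S \<Delta>) (on1 (types_two_map S \<Delta> \<sigma>) (tm_class S \<Gamma> B C g))
        (on1 (types_two_map S \<Delta> \<sigma>) (tm_class S \<Gamma> A B f))"
  using assms subst_tys[OF \<sigma>] subst_tms[OF \<sigma> A f] subst_tms[OF \<sigma> B g] precomp_tms[OF B f g]
  by (simp add: comp1_types on1_types[OF \<sigma>] subst_precomp del: One_nat_def)

lemma on2_wl_class:
  assumes \<sigma>: "ctx_mor S \<Delta> \<sigma> \<Gamma>" and A: "A \<in> tys S \<Gamma>" and B: "B \<in> tys S \<Gamma>" and C: "C \<in> tys S \<Gamma>"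
    and f: "f \<in> tms S \<Gamma> A B" and g: "g \<in> tms S \<Gamma> A B" and \<alpha>: "\<alpha> \<in> ids S \<Gamma> A B f g" and h: "h \<in> tms S \<Gamma> B C"
  shows "on2 (types_two_map S \<Delta> \<sigma>) (wl (types_two_category S \<Gamma>) (tm_class S \<Gamma> B C h) (id_class S \<Gamma> A B f g \<alpha>))
    = wl (types_two_category S \<Delta>) (on1 (types_two_map S \<Delta> \<sigma>) (tm_class S \<Gamma> B C h))
        (on2 (types_two_map S \<Delta> \<sigma>) (id_class S \<Gamma> A B f g \<alpha>))"
  using assms subst_tys[OF \<sigma>] subst_tms[OF \<sigma> A f] subst_tms[OF \<sigma> A g] subst_tms[OF \<sigma> B h]
    precomp_tms[OF B f h] precomp_tms[OF B g h] subst_ids[OF \<sigma> A \<alpha>]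
  by (simp add: wl_types on1_types[OF \<sigma>] on2_types[OF \<sigma>] subst_precomp subst_Id_ap_shift_under whisker_ids
      del: One_nat_def)

lemma on2_wr_class:
  assumes \<sigma>: "ctx_mor S \<Delta> \<sigma> \<Gamma>" and A: "A \<in> tys S \<Gamma>" and B: "B \<in> tys S \<Gamma>" and C: "C \<in> tys S \<Gamma>"
    and f: "f \<in> tms S \<Gamma> A B" and g: "g \<in> tms S \<Gamma> B C" and k: "k \<in> tms S \<Gamma> B C" and \<alpha>: "\<alpha> \<in> ids S \<Gamma> B C g k"
  shows "on2 (types_two_map S \<Delta> \<sigma>) (wr (types_two_category S \<Gamma>) (id_class S \<Gamma> B C g k \<alpha>) (tm_class S \<Gamma> A B f))
    = wr (types_two_category S \<Delta>) (on2 (types_two_map S \<Delta> \<sigma>) (id_class S \<Gamma> B C g k \<alpha>))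
        (on1 (types_two_map S \<Delta> \<sigma>) (tm_class S \<Gamma> A B f))"
  using assms subst_tys[OF \<sigma>] subst_tms[OF \<sigma> A f] subst_tms[OF \<sigma> B g] subst_tms[OF \<sigma> B k]
    precomp_tms[OF B f g] precomp_tms[OF B f k] subst_ids[OF \<sigma> B \<alpha>] precomp_ids[OF B f \<alpha>]
  by (simp add: wr_types on1_types[OF \<sigma>] on2_types[OF \<sigma>] subst_precomp del: One_nat_def)

lemma types_is_two_functor:
  assumes \<sigma>: "ctx_mor S \<Delta> \<sigma> \<Gamma>"
  shows "is_two_functor (types_two_category S \<Gamma>) (types_two_category S \<Delta>) (types_two_map S \<Delta> \<sigma>)"
  unfolding is_two_functor_def HomCat_types Ob_types
  by (auto simp: types_is_two_category on0_types[OF \<sigma>] subst_tys[OF \<sigma>] on_functor[OF \<sigma>] id1_types Var_tms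
      on1_types[OF \<sigma>] lift_0 Obj_types Hom_types on1_comp1_class[OF \<sigma>] on2_wl_class[OF \<sigma>]
      on2_wr_class[OF \<sigma>, simplified on1_types[OF \<sigma>]] simp del: One_nat_def)

end

section \<open>Surjective equivalences\<close>

lemma is_functor_comp:
  assumes "is_functor C D F\<^sub>0 F\<^sub>1" "is_functor D E G\<^sub>0 G\<^sub>1"
  shows "is_functor C E (\<lambda>x. G\<^sub>0 (F\<^sub>0 x)) (\<lambda>f. G\<^sub>1 (F\<^sub>1 f))"
  using assms unfolding is_functor_def by simp blast

text \<open>
  A functor on arrows does not see their domain and codomain, so the section on arrows needs the
  hom-sets of the codomain to be disjoint.
\<close>

lemma surjective_equivalenceI:
  assumes P: "is_functor C D P\<^sub>0 P\<^sub>1"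
    and disj: "\<And>d d' e e' g. \<lbrakk>d \<in> Obj D; d' \<in> Obj D; e \<in> Obj D; e' \<in> Obj D; g \<in> Hom D d d'; g \<in> Hom D e e'\<rbrakk>
      \<Longrightarrow> d = e \<and> d' = e'"
    and surj: "\<And>d. d \<in> Obj D \<Longrightarrow> \<exists>c \<in> Obj C. P\<^sub>0 c = d"
    and full: "\<And>c c' g. \<lbrakk>c \<in> Obj C; c' \<in> Obj C; g \<in> Hom D (P\<^sub>0 c) (P\<^sub>0 c')\<rbrakk> \<Longrightarrow> \<exists>f \<in> Hom C c c'. P\<^sub>1 f = g"
    and faithful: "\<And>c c' f f'. \<lbrakk>c \<in> Obj C; c' \<in> Obj C; f \<in> Hom C c c'; f' \<in> Hom C c c'; P\<^sub>1 f = P\<^sub>1 f'\<rbrakk>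
      \<Longrightarrow> f = f'"
  shows "surjective_equivalence C D P\<^sub>0 P\<^sub>1"
proof -
  have C: "is_category C" and D: "is_category D"
    using P by (auto simp: is_functor_def)
  have C_id: "\<And>x. x \<in> Obj C \<Longrightarrow> Ident C x \<in> Hom C x x"
    and C_comp: "\<And>x y z f g. \<lbrakk>x \<in> Obj C; y \<in> Obj C; z \<in> Obj C; f \<in> Hom C x y; g \<in> Hom C y z\<rbrakk>
      \<Longrightarrow> Comp C g f \<in> Hom C x z"
    using C by (auto simp: is_category_def)
  have D_id: "\<And>x. x \<in> Obj D \<Longrightarrow> Ident D x \<in> Hom D x x"
    and D_comp: "\<And>x y z f g. \<lbrakk>x \<in> Obj D; y \<in> Obj D; z \<in> Obj D; f \<in> Hom D x y; g \<in> Hom D y z\<rbrakk>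
      \<Longrightarrow> Comp D g f \<in> Hom D x z"
    and D_unit: "\<And>x y f. \<lbrakk>x \<in> Obj D; y \<in> Obj D; f \<in> Hom D x y\<rbrakk>
      \<Longrightarrow> Comp D f (Ident D x) = f \<and> Comp D (Ident D y) f = f"
    using D by (auto simp: is_category_def)
  have P_Obj: "\<And>x. x \<in> Obj C \<Longrightarrow> P\<^sub>0 x \<in> Obj D"
    and P_Hom: "\<And>x y f. \<lbrakk>x \<in> Obj C; y \<in> Obj C; f \<in> Hom C x y\<rbrakk> \<Longrightarrow> P\<^sub>1 f \<in> Hom D (P\<^sub>0 x) (P\<^sub>0 y)"
    and P_id: "\<And>x. x \<in> Obj C \<Longrightarrow> P\<^sub>1 (Ident C x) = Ident D (P\<^sub>0 x)"
    and P_comp: "\<And>x y z f g. \<lbrakk>x \<in> Obj C; y \<in> Obj C; z \<in> Obj C; f \<in> Hom C x y; g \<in> Hom C y z\<rbrakk>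
      \<Longrightarrow> P\<^sub>1 (Comp C g f) = Comp D (P\<^sub>1 g) (P\<^sub>1 f)"
    using P by (auto simp: is_functor_def)
  from surj obtain I\<^sub>0 where I\<^sub>0: "\<And>d. d \<in> Obj D \<Longrightarrow> I\<^sub>0 d \<in> Obj C \<and> P\<^sub>0 (I\<^sub>0 d) = d"
    by metis
  \<comment> \<open>Lifts through \<open>P\<close> exist by fullness and are unique by faithfulness;
    all structure below is made of such lifts.\<close>
  define L where "L c c' g = (SOME f. f \<in> Hom C c c' \<and> P\<^sub>1 f = g)" for c c' g
  have L: "L c c' g \<in> Hom C c c'" "P\<^sub>1 (L c c' g) = g"
    if "c \<in> Obj C" "c' \<in> Obj C" "g \<in> Hom D (P\<^sub>0 c) (P\<^sub>0 c')" for c c' g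
    using someI_ex[of "\<lambda>f. f \<in> Hom C c c' \<and> P\<^sub>1 f = g"] full[OF that] unfolding L_def by blast+
  define I\<^sub>1 where "I\<^sub>1 g = (let (d, d') = SOME (d, d'). d \<in> Obj D \<and> d' \<in> Obj D \<and> g \<in> Hom D d d'
    in L (I\<^sub>0 d) (I\<^sub>0 d') g)" for g
  have I\<^sub>1: "I\<^sub>1 g = L (I\<^sub>0 d) (I\<^sub>0 d') g" if "d \<in> Obj D" "d' \<in> Obj D" "g \<in> Hom D d d'" for d d' g
  proof -
    have "(SOME (d, d'). d \<in> Obj D \<and> d' \<in> Obj D \<and> g \<in> Hom D d d') = (d, d')"
      by (rule some_equality) (use that disj in auto)
    then show ?thesis
      by (simp add: I\<^sub>1_def)
  qed
  have I\<^sub>1_Hom: "I\<^sub>1 g \<in> Hom C (I\<^sub>0 d) (I\<^sub>0 d')" and PI: "P\<^sub>1 (I\<^sub>1 g) = g"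
    if "d \<in> Obj D" "d' \<in> Obj D" "g \<in> Hom D d d'" for d d' g
    using L[of "I\<^sub>0 d" "I\<^sub>0 d'" g] I\<^sub>0 I\<^sub>1[OF that] that by auto
  \<comment> \<open>As \<open>c\<close> and \<open>I\<^sub>0 (P\<^sub>0 c)\<close> have the same
    image under \<open>P\<close>, the identity of that image can be lifted. This gives the condition
    on the image of \<open>\<theta>\<close> by construction; the other equations hold since both
    sides have the same image and \<open>P\<close> is faithful.\<close>
  define \<theta> where "\<theta> c = L c (I\<^sub>0 (P\<^sub>0 c)) (Ident D (P\<^sub>0 c))" for c
  have \<theta>: "\<theta> c \<in> Hom C c (I\<^sub>0 (P\<^sub>0 c))" "P\<^sub>1 (\<theta> c) = Ident D (P\<^sub>0 c)" if "c \<in> Obj C" for c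
    using L[of c "I\<^sub>0 (P\<^sub>0 c)" "Ident D (P\<^sub>0 c)"] I\<^sub>0[OF P_Obj[OF that]] D_id[OF P_Obj[OF that]] that
    by (auto simp: \<theta>_def)
  have "is_functor D C I\<^sub>0 I\<^sub>1"
  proof -
    have "I\<^sub>1 (Ident D x) = Ident C (I\<^sub>0 x)" if "x \<in> Obj D" for x
      using I\<^sub>0[OF that] I\<^sub>1_Hom[OF that that D_id[OF that]] PI[OF that that D_id[OF that]] C_id P_id
      by (intro faithful[of "I\<^sub>0 x" "I\<^sub>0 x"]) auto
    moreover have "I\<^sub>1 (Comp D g f) = Comp C (I\<^sub>1 g) (I\<^sub>1 f)"
      if "x \<in> Obj D" "y \<in> Obj D" "z \<in> Obj D" "f \<in> Hom D x y" "g \<in> Hom D y z" for x y z f g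
    proof (rule faithful[of "I\<^sub>0 x" "I\<^sub>0 z"])
      note gf = D_comp[OF that]
      note o = I\<^sub>0[OF that(1)] I\<^sub>0[OF that(2)] I\<^sub>0[OF that(3)]
        and m = I\<^sub>1_Hom[OF that(1,2,4)] I\<^sub>1_Hom[OF that(2,3,5)]
      show "I\<^sub>0 x \<in> Obj C" "I\<^sub>0 z \<in> Obj C"
        using o by auto
      show "I\<^sub>1 (Comp D g f) \<in> Hom C (I\<^sub>0 x) (I\<^sub>0 z)"
        by (rule I\<^sub>1_Hom[OF that(1,3) gf])
      show "Comp C (I\<^sub>1 g) (I\<^sub>1 f) \<in> Hom C (I\<^sub>0 x) (I\<^sub>0 z)"
        using C_comp[OF _ _ _ m] o by auto
      show "P\<^sub>1 (I\<^sub>1 (Comp D g f)) = P\<^sub>1 (Comp C (I\<^sub>1 g) (I\<^sub>1 f))"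
        using P_comp[OF _ _ _ m] o PI[OF that(1,3) gf] PI[OF that(1,2,4)] PI[OF that(2,3,5)] by auto
    qed
    ultimately show ?thesis
      using C D I\<^sub>0 I\<^sub>1_Hom by (auto simp: is_functor_def)
  qed
  moreover have "is_iso C c (I\<^sub>0 (P\<^sub>0 c)) (\<theta> c)" if c: "c \<in> Obj C" for c
  proof -
    let ?c' = "I\<^sub>0 (P\<^sub>0 c)"
    note Pc = P_Obj[OF c]
    have c': "?c' \<in> Obj C" "P\<^sub>0 ?c' = P\<^sub>0 c"
      using I\<^sub>0[OF Pc] by auto
    \<comment> \<open>The inverse of \<open>\<theta> c\<close> is the lift of the same identity in
      the opposite direction.\<close>
    define g where "g = L ?c' c (Ident D (P\<^sub>0 c))"
    have g: "g \<in> Hom C ?c' c" "P\<^sub>1 g = Ident D (P\<^sub>0 c)"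
      using L[OF c'(1) c] D_id[OF Pc] c'(2) by (auto simp: g_def)
    note u = D_unit[OF Pc Pc D_id[OF Pc]]
    have "Comp C g (\<theta> c) = Ident C c"
      by (rule faithful[OF c c C_comp[OF c c'(1) c \<theta>(1)[OF c] g(1)] C_id[OF c]])
        (simp add: P_comp[OF c c'(1) c \<theta>(1)[OF c] g(1)] g(2) \<theta>(2)[OF c] P_id[OF c] u)
    moreover have "Comp C (\<theta> c) g = Ident C ?c'"
      by (rule faithful[OF c'(1) c'(1) C_comp[OF c'(1) c c'(1) g(1) \<theta>(1)[OF c]] C_id[OF c'(1)]])
        (simp add: P_comp[OF c'(1) c c'(1) g(1) \<theta>(1)[OF c]] g(2) \<theta>(2)[OF c] P_id[OF c'(1)] c'(2) u)
    ultimately show ?thesis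
      using \<theta>(1)[OF c] g(1) by (auto simp: is_iso_def)
  qed
  moreover have "Comp C (\<theta> c') f = Comp C (I\<^sub>1 (P\<^sub>1 f)) (\<theta> c)"
    if c: "c \<in> Obj C" and c': "c' \<in> Obj C" and f: "f \<in> Hom C c c'" for c c' f
  proof -
    note Pc = P_Obj[OF c] and Pc' = P_Obj[OF c'] and Pf = P_Hom[OF c c' f]
    have o: "I\<^sub>0 (P\<^sub>0 c) \<in> Obj C" "I\<^sub>0 (P\<^sub>0 c') \<in> Obj C"
      using I\<^sub>0 Pc Pc' by auto
    note If = I\<^sub>1_Hom[OF Pc Pc' Pf]
    show ?thesis
      by (rule faithful[OF c o(2) C_comp[OF c c' o(2) f \<theta>(1)[OF c']] C_comp[OF c o \<theta>(1)[OF c] If]])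
        (simp add: P_comp[OF c c' o(2) f \<theta>(1)[OF c']] P_comp[OF c o \<theta>(1)[OF c] If] \<theta>(2)[OF c] \<theta>(2)[OF c']
          PI[OF Pc Pc' Pf] D_unit[OF Pc Pc' Pf])
  qed
  moreover have "\<theta> (I\<^sub>0 d) = Ident C (I\<^sub>0 d)" if "d \<in> Obj D" for d
    using I\<^sub>0[OF that] \<theta>[of "I\<^sub>0 d"] C_id[of "I\<^sub>0 d"] P_id[of "I\<^sub>0 d"]
    by (intro faithful[of "I\<^sub>0 d" "I\<^sub>0 d"]) auto
  ultimately show ?thesis
    unfolding surjective_equivalence_def using P I\<^sub>0 PI \<theta>(2) by blast
qed

section \<open>Dependent sums\<close>

context ML2
begin

text \<open>Weakening followed by precomposition with the pairing is a single substitution, and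
  precisely the one in the elimination and computation rules for \<open>\<Sigma>\<close>. This is
  what identifies the functor \<open>h \<mapsto> Uh \<circ> \<eta>\<close> with restriction to
  pairs.\<close>

lemma pair_subst_lift: "precomp (pair S (shift 2 A) (shift_under 2 B) (Var 1) (Var 0)) (shift_under 1 e)
    = subst (pair_subst S A B) e"
  by (simp add: pair_subst_def norm)

text \<open>What does not depend on \<open>z\<close> is merely weakened by \<open>x\<close> and
  \<open>y\<close>. So a motive coming from a type over \<open>\<Gamma>\<close> restricts to the
  codomain required of 1-cells over the extended context.\<close>

lemma pair_subst_shift: "subst (pair_subst S A B) (shift 1 e) = shift 1 (shift 1 e)"
  by (simp add: pair_subst_def norm)

lemma Sg_tys: "A \<in> tys S \<Gamma> \<Longrightarrow> B \<in> tys S (A # \<Gamma>) \<Longrightarrow> Sg S A B \<in> tys S \<Gamma>"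
  by (simp add: tys_def Sg_form)

lemma pair_tms:
  assumes "B \<in> tys S (A # \<Gamma>)"
  shows "pair S (shift 2 A) (shift_under 2 B) (Var 1) (Var 0) \<in> tms S (A # \<Gamma>) B (shift 1 (Sg S A B))"
proof -
  have B: "A # \<Gamma> \<turnstile> B Ty"
    using assms by (simp add: tys_def)
  then have A: "\<Gamma> \<turnstile> A Ty"
    using ty_ctx by fastforce
  note BA = head_var(3)[OF B]
  have B2: "shift 2 A # B # A # \<Gamma> \<turnstile> shift_under 2 B Ty"
    by (rule ty_subst[OF shift_under_mor[OF A BA] B]) simp
  \<comment> \<open>\<open>Var 1\<close> is \<open>x\<close> and \<open>Var 0\<close> is
    \<open>y\<close>; the type of \<open>y\<close> has to be recognised as the weakened family
    \<open>B\<close> instantiated at \<open>x\<close>.\<close>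
  have "B # A # \<Gamma> \<turnstile> Var 1 \<tturnstile> shift 2 A" "B # A # \<Gamma> \<turnstile> Var 0 \<tturnstile> inst (Var 1) (shift_under 2 B)"
    by (rule var'[OF BA]; simp add: lookup_def norm)+
  from pair_intro[OF B2 this] show ?thesis
    by (simp add: tms_def norm)
qed

text \<open>The counterpart of \<open>Id_eqI\<close> for \<open>\<Sigma>\<close>. The restriction to
  elements of an identity type is what makes discreteness applicable.\<close>

lemma Sg_eqI:
  assumes u: "Sg S A B # \<Gamma> \<turnstile> u \<tturnstile> Idt S T s t" and v: "Sg S A B # \<Gamma> \<turnstile> v \<tturnstile> Idt S T s t"
    and uv: "B # A # \<Gamma> \<turnstile> subst (pair_subst S A B) u \<doteq> subst (pair_subst S A B) v
      \<tturnstile> subst (pair_subst S A B) (Idt S T s t)"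
  shows "Sg S A B # \<Gamma> \<turnstile> u \<doteq> v \<tturnstile> Idt S T s t"
proof -
  have "Sg S A B # \<Gamma> \<turnstile> Idt S (Idt S T s t) u v Ty"
    using u v by (rule Id_form)
  moreover have "B # A # \<Gamma> \<turnstile> rfl S (subst (pair_subst S A B) (Idt S T s t)) (subst (pair_subst S A B) u)
      \<tturnstile> subst (pair_subst S A B) (Idt S (Idt S T s t) u v)"
    unfolding subst_Idt[of _ "Idt S T s t" u v] using uv by (rule rfl_of_eq)
  ultimately show ?thesis
    by (rule Id_discrete[OF u v Sg_elim])
qed

text \<open>Surjectivity and fullness use the elimination rule with different motives: the type
  \<open>C\<close>, which is constant over \<open>\<Sigma>(A,B)\<close>, and the family
  \<open>Id(h,h')\<close>, which varies over it and calls for the dependent form of the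
  rule.\<close>

lemma Sg_retract_bireflection:
  assumes A: "A \<in> tys S \<Gamma>" and B: "B \<in> tys S (A # \<Gamma>)"
  shows "retract_bireflection (types_two_category S \<Gamma>) (types_two_category S (A # \<Gamma>)) (weakening S \<Gamma> A)
    (ty_class S (A # \<Gamma>) B) (ty_class S \<Gamma> (Sg S A B))
    (tm_class S (A # \<Gamma>) B (shift 1 (Sg S A B)) (pair S (shift 2 A) (shift_under 2 B) (Var 1) (Var 0)))"
    (is "retract_bireflection ?K ?L ?U ?x ?z ?\<eta>")
proof -
  let ?Z = "Sg S A B" and ?q = "pair S (shift 2 A) (shift_under 2 B) (Var 1) (Var 0)"
    and ?\<pi> = "subst (pair_subst S A B)"
  have Z: "?Z \<in> tys S \<Gamma>"
    using A B by (rule Sg_tys)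
  have q: "?q \<in> tms S (A # \<Gamma>) B (shift 1 ?Z)"
    using B by (rule pair_tms)
  have \<sigma>: "ctx_mor S (A # \<Gamma>) (drop_vars 1) \<Gamma>"
    using A ty_ctx by (intro ctx_mor_drop) (auto simp: tys_def)
  have U: "?U = types_two_map S (A # \<Gamma>) (drop_vars 1)"
    by (simp add: weakening_def)
  have Z1: "shift 1 ?Z \<in> tys S (A # \<Gamma>)"
    by (rule subst_tys[OF \<sigma> Z])
  have "surjective_equivalence (types_homcat S \<Gamma> ?z (ty_class S \<Gamma> C))
      (types_homcat S (A # \<Gamma>) ?x (ty_class S (A # \<Gamma>) (shift 1 C)))
      (\<lambda>h. comp1 ?L (on1 ?U h) ?\<eta>) (\<lambda>\<alpha>. wr ?L (on2 ?U \<alpha>) ?\<eta>)"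
    if C: "C \<in> tys S \<Gamma>" for C
  proof -
    have C1: "shift 1 C \<in> tys S (A # \<Gamma>)"
      by (rule subst_tys[OF \<sigma> C])
    have SgC: "?Z # \<Gamma> \<turnstile> shift 1 C Ty"
      using shift_1_eq ty_refl Z C eq_ty_left unfolding tys_def by blast
    have P\<^sub>0: "comp1 ?L (on1 ?U (tm_class S \<Gamma> ?Z C h)) ?\<eta> = tm_class S (A # \<Gamma>) B (shift 1 C) (?\<pi> h)"
      if "h \<in> tms S \<Gamma> ?Z C" for h
      unfolding U on1_types[OF \<sigma> Z C that] comp1_types[OF B Z1 C1 q subst_tms[OF \<sigma> Z that]] pair_subst_lift ..
    have P\<^sub>1: "wr ?L (on2 ?U (id_class S \<Gamma> ?Z C h h' \<alpha>)) ?\<eta>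
        = id_class S (A # \<Gamma>) B (shift 1 C) (?\<pi> h) (?\<pi> h') (?\<pi> \<alpha>)"
      if "h \<in> tms S \<Gamma> ?Z C" "h' \<in> tms S \<Gamma> ?Z C" "\<alpha> \<in> ids S \<Gamma> ?Z C h h'" for h h' \<alpha>
      unfolding U on2_types[OF \<sigma> Z C that]
        wr_types[OF B Z1 C1 q subst_tms[OF \<sigma> Z that(1)] subst_tms[OF \<sigma> Z that(2)] subst_ids[OF \<sigma> Z that(3)]]
        pair_subst_lift ..
    have \<pi>_tms: "?\<pi> h \<in> tms S (A # \<Gamma>) B (shift 1 C)" if "h \<in> tms S \<Gamma> ?Z C" for h
      using precomp_tms[OF Z1 q subst_tms[OF \<sigma> Z that]] unfolding pair_subst_lift .
    have \<pi>_ids: "?\<pi> \<alpha> \<in> ids S (A # \<Gamma>) B (shift 1 C) (?\<pi> h) (?\<pi> h')" if "\<alpha> \<in> ids S \<Gamma> ?Z C h h'" for \<alpha> h h'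
      using precomp_ids[OF Z1 q subst_ids[OF \<sigma> Z that]] unfolding pair_subst_lift .
    have \<pi>_Id: "?\<pi> (Idt S (shift 1 C) h h') = Idt S (shift 1 (shift 1 C)) (?\<pi> h) (?\<pi> h')" for h h'
      unfolding subst_Idt pair_subst_shift ..
    note Obj_z = Obj_types[OF Z C] and Obj_x = Obj_types[OF B C1]
      and Hom_z = Hom_types[OF Z C] and Hom_x = Hom_types[OF B C1]
    show ?thesis
    proof (rule surjective_equivalenceI)
      show "is_functor (types_homcat S \<Gamma> ?z (ty_class S \<Gamma> C))
          (types_homcat S (A # \<Gamma>) ?x (ty_class S (A # \<Gamma>) (shift 1 C)))
          (\<lambda>h. comp1 ?L (on1 ?U h) ?\<eta>) (\<lambda>\<alpha>. wr ?L (on2 ?U \<alpha>) ?\<eta>)"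
        unfolding U by (rule is_functor_comp[OF on_functor[OF \<sigma> Z C] wr_functor[OF B Z1 C1 q]])
    next
      fix d d' e e' g
      assume "d \<in> Obj (types_homcat S (A # \<Gamma>) ?x (ty_class S (A # \<Gamma>) (shift 1 C)))"
        "d' \<in> Obj (types_homcat S (A # \<Gamma>) ?x (ty_class S (A # \<Gamma>) (shift 1 C)))"
        "e \<in> Obj (types_homcat S (A # \<Gamma>) ?x (ty_class S (A # \<Gamma>) (shift 1 C)))"
        "e' \<in> Obj (types_homcat S (A # \<Gamma>) ?x (ty_class S (A # \<Gamma>) (shift 1 C)))"
        and g: "g \<in> Hom (types_homcat S (A # \<Gamma>) ?x (ty_class S (A # \<Gamma>) (shift 1 C))) d d'"
        "g \<in> Hom (types_homcat S (A # \<Gamma>) ?x (ty_class S (A # \<Gamma>) (shift 1 C))) e e'"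
      then obtain k k' l l' where k: "k \<in> tms S (A # \<Gamma>) B (shift 1 C)" "k' \<in> tms S (A # \<Gamma>) B (shift 1 C)"
        "l \<in> tms S (A # \<Gamma>) B (shift 1 C)" "l' \<in> tms S (A # \<Gamma>) B (shift 1 C)"
        and d: "d = tm_class S (A # \<Gamma>) B (shift 1 C) k" "d' = tm_class S (A # \<Gamma>) B (shift 1 C) k'"
          "e = tm_class S (A # \<Gamma>) B (shift 1 C) l" "e' = tm_class S (A # \<Gamma>) B (shift 1 C) l'"
        unfolding Obj_x by blast
      \<comment> \<open>A common 2-cell is represented over both pairs of endpoints; since its class
        records the endpoints, these agree definitionally.\<close>
      from g obtain \<alpha> \<beta> where "\<beta> \<in> ids S (A # \<Gamma>) B (shift 1 C) l l'"
        "id_class S (A # \<Gamma>) B (shift 1 C) k k' \<alpha> = id_class S (A # \<Gamma>) B (shift 1 C) l l' \<beta>"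
        unfolding d Hom_x[OF k(1,2)] Hom_x[OF k(3,4)] by blast
      from id_class_inject(1,2)[OF B C1 k(3,4) this] show "d = e \<and> d' = e'"
        unfolding d by (intro conjI tm_class_cong[OF B C1])
    next
      fix d assume "d \<in> Obj (types_homcat S (A # \<Gamma>) ?x (ty_class S (A # \<Gamma>) (shift 1 C)))"
      then obtain k where k: "k \<in> tms S (A # \<Gamma>) B (shift 1 C)" and d: "d = tm_class S (A # \<Gamma>) B (shift 1 C) k"
        unfolding Obj_x by blast
      \<comment> \<open>The preimage of \<open>k\<close> is its extension from pairs to all of
        \<open>\<Sigma>(A,B)\<close>; the computation rule says that it restricts to
        \<open>k\<close> again.\<close>
      let ?h = "Sg_elim S A B (shift 1 C) k"
      have k': "B # A # \<Gamma> \<turnstile> k \<tturnstile> ?\<pi> (shift 1 C)"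
        using k unfolding pair_subst_shift tms_def by simp
      have h: "?h \<in> tms S \<Gamma> ?Z C"
        using Sg_elim[OF SgC k'] by (simp add: tms_def)
      have "tm_class S (A # \<Gamma>) B (shift 1 C) (?\<pi> ?h) = d"
        unfolding d using Sg_comp[OF SgC k'] unfolding pair_subst_shift by (rule tm_class_cong[OF B C1])
      then show "\<exists>c \<in> Obj (types_homcat S \<Gamma> ?z (ty_class S \<Gamma> C)). comp1 ?L (on1 ?U c) ?\<eta> = d"
        unfolding Obj_z using h P\<^sub>0[OF h] by auto
    next
      fix c c' g
      assume "c \<in> Obj (types_homcat S \<Gamma> ?z (ty_class S \<Gamma> C))" "c' \<in> Obj (types_homcat S \<Gamma> ?z (ty_class S \<Gamma> C))"
        and g: "g \<in> Hom (types_homcat S (A # \<Gamma>) ?x (ty_class S (A # \<Gamma>) (shift 1 C)))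
          (comp1 ?L (on1 ?U c) ?\<eta>) (comp1 ?L (on1 ?U c') ?\<eta>)"
      then obtain h h' where h: "h \<in> tms S \<Gamma> ?Z C" "h' \<in> tms S \<Gamma> ?Z C"
        and c: "c = tm_class S \<Gamma> ?Z C h" "c' = tm_class S \<Gamma> ?Z C h'"
        unfolding Obj_z by blast
      from g obtain \<gamma> where \<gamma>: "\<gamma> \<in> ids S (A # \<Gamma>) B (shift 1 C) (?\<pi> h) (?\<pi> h')"
        and g': "g = id_class S (A # \<Gamma>) B (shift 1 C) (?\<pi> h) (?\<pi> h') \<gamma>"
        unfolding c P\<^sub>0[OF h(1)] P\<^sub>0[OF h(2)] Hom_x[OF \<pi>_tms[OF h(1)] \<pi>_tms[OF h(2)]] by blast
      \<comment> \<open>A 2-cell between the restrictions of \<open>h\<close> and \<open>h'\<close>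
        proves \<open>?I\<close> on pairs, so elimination with motive \<open>?I\<close> extends
        it.\<close>
      let ?I = "Idt S (shift 1 C) h h'"
      let ?\<alpha> = "Sg_elim S A B ?I \<gamma>"
      have I: "?Z # \<Gamma> \<turnstile> ?I Ty"
        using h by (intro Id_form) (simp_all add: tms_def)
      have \<gamma>': "B # A # \<Gamma> \<turnstile> \<gamma> \<tturnstile> ?\<pi> ?I"
        using \<gamma> unfolding \<pi>_Id ids_def by simp
      have \<alpha>: "?\<alpha> \<in> ids S \<Gamma> ?Z C h h'"
        using Sg_elim[OF I \<gamma>'] by (simp add: ids_def)
      have "id_class S (A # \<Gamma>) B (shift 1 C) (?\<pi> h) (?\<pi> h') (?\<pi> ?\<alpha>) = g"
        unfolding g' using Sg_comp[OF I \<gamma>'] unfolding \<pi>_Id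
        by (rule id_class_cong[OF B C1 \<pi>_tms[OF h(1)] \<pi>_tms[OF h(2)]])
      then show "\<exists>f \<in> Hom (types_homcat S \<Gamma> ?z (ty_class S \<Gamma> C)) c c'. wr ?L (on2 ?U f) ?\<eta> = g"
        unfolding c Hom_z[OF h] using \<alpha> P\<^sub>1[OF h \<alpha>] by auto
    next
      fix c c' f f'
      assume "c \<in> Obj (types_homcat S \<Gamma> ?z (ty_class S \<Gamma> C))" "c' \<in> Obj (types_homcat S \<Gamma> ?z (ty_class S \<Gamma> C))"
        and f: "f \<in> Hom (types_homcat S \<Gamma> ?z (ty_class S \<Gamma> C)) c c'"
          "f' \<in> Hom (types_homcat S \<Gamma> ?z (ty_class S \<Gamma> C)) c c'"
        and eq: "wr ?L (on2 ?U f) ?\<eta> = wr ?L (on2 ?U f') ?\<eta>"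
      then obtain h h' where h: "h \<in> tms S \<Gamma> ?Z C" "h' \<in> tms S \<Gamma> ?Z C"
        and c: "c = tm_class S \<Gamma> ?Z C h" "c' = tm_class S \<Gamma> ?Z C h'"
        unfolding Obj_z by blast
      from f obtain \<alpha> \<beta> where \<alpha>: "\<alpha> \<in> ids S \<Gamma> ?Z C h h'" "\<beta> \<in> ids S \<Gamma> ?Z C h h'"
        and f': "f = id_class S \<Gamma> ?Z C h h' \<alpha>" "f' = id_class S \<Gamma> ?Z C h h' \<beta>"
        unfolding c Hom_z[OF h] by blast
      have "B # A # \<Gamma> \<turnstile> ?\<pi> \<alpha> \<doteq> ?\<pi> \<beta> \<tturnstile> ?\<pi> (Idt S (shift 1 C) h h')"
        using id_class_inject(3)[OF B C1 \<pi>_tms[OF h(1)] \<pi>_tms[OF h(2)] \<pi>_ids[OF \<alpha>(2)]]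
          eq[unfolded f' P\<^sub>1[OF h \<alpha>(1)] P\<^sub>1[OF h \<alpha>(2)]] unfolding \<pi>_Id by blast
      from Sg_eqI[OF _ _ this] have "?Z # \<Gamma> \<turnstile> \<alpha> \<doteq> \<beta> \<tturnstile> Idt S (shift 1 C) h h'"
        using \<alpha> unfolding ids_def by blast
      then show "f = f'"
        unfolding f' by (rule id_class_cong[OF Z C h])
    qed
  qed
  then show ?thesis
    unfolding retract_bireflection_def HomCat_types Ob_types
    using Z q by (auto simp: U on0_types[OF \<sigma>] Obj_types[OF B Z1] simp del: One_nat_def)
qed

end

theorem proposition4p4p1:
  fixes S :: "'s ml2" and \<Gamma> :: "'s ctxt" and A :: "'s expr"
  assumes "ML2 S" and "ctx S \<Gamma>" and "\<Gamma> \<turnstile>\<^bsub>S\<^esub> A Ty"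
  shows "\<exists>F \<eta>. left_retract_biadjoint (types_two_category S \<Gamma>) (types_two_category S (A # \<Gamma>))
    (weakening S \<Gamma> A) F \<eta>"
proof -
  interpret ML2 S
    by (rule assms(1))
  have A: "A \<in> tys S \<Gamma>"
    using assms(3) by (simp add: tys_def)
  have "ctx_mor S (A # \<Gamma>) (drop_vars 1) \<Gamma>"
    using assms(2,3) by (intro ctx_mor_drop) auto
  then have "is_two_functor (types_two_category S \<Gamma>) (types_two_category S (A # \<Gamma>)) (weakening S \<Gamma> A)"
    unfolding weakening_def by (rule types_is_two_functor)
  \<comment> \<open>A retract biadjoint is a mere choice of bireflections, with no coherence between
    them; existence for each class therefore suffices, and no canonical representative
    \<open>B\<close> has to be singled out.\<close>
  moreover have "\<forall>x \<in> Ob (types_two_category S (A # \<Gamma>)). \<exists>z \<eta>.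
      retract_bireflection (types_two_category S \<Gamma>) (types_two_category S (A # \<Gamma>)) (weakening S \<Gamma> A) x z \<eta>"
    unfolding Ob_types using Sg_retract_bireflection[OF A] by blast
  ultimately show ?thesis
    unfolding left_retract_biadjoint_def by metis
qed

end
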